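(* Let $\alpha\in\mathbb C\setminus\mathbb Z$. Then for $\theta_1,\theta_2\in\mathbb C$ with $\theta_1\neq\theta_2$, $$\mathrm{gen}\!\int_0^\infty U_{\theta_1,\alpha}(z)\,U_{\theta_2,\alpha}(z)\,e^{-z}z^\alpha\,dz=\frac{2\pi}{(\theta_1-\theta_2)\sin\pi\alpha}\Bigg(\frac{1}{\Gamma\big(\frac{1+\theta_1-\alpha}{2}\big)\Gamma\big(\frac{1+\theta_2+\alpha}{2}\big)}-\frac{1}{\Gamma\big(\frac{1+\theta_2-\alpha}{2}\big)\Gamma\big(\frac{1+\theta_1+\alpha}{2}\big)}\Bigg),$$ and for $\theta\in\mathbb C$, $$\mathrm{gen}\!\int_0^\infty U_{\theta,\alpha}(z)^2\,e^{-z}z^\alpha\,dz=\frac{\pi}{\sin\pi\alpha}\;\frac{\psi\big(\frac{1+\theta+\alpha}{2}\big)-\psi\big(\frac{1+\theta-\alpha}{2}\big)}{\Gamma\big(\frac{1+\theta+\alpha}{2}\big)\Gamma\big(\frac{1+\theta-\alpha}{2}\big)}.$$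
   Context: Tricomi's confluent function in Lie-algebraic parameters: for $\theta,\alpha\in\mathbb C$ and $z>0$, $U_{\theta,\alpha}(z):=U\big(\tfrac{1+\alpha+\theta}{2};1+\alpha;z\big)$, where $U(a;c;z)$ is the standard Tricomi confluent hypergeometric function, i.e. the solution of $zf''+(c-z)f'-af=0$ with $U(a;c;z)\sim z^{-a}$ as $z\to+\infty$ (equivalently $U(a;c;z)=z^{-a}\,{}_2F_0(a,1+a-c;-;-z^{-1})$). $\Gamma$ is the Gamma function and $\psi=\Gamma'/\Gamma$ the digamma function. Generalized integral: a function $f$ on $]0,\infty[$ is integrable in the generalized sense if it is integrable on $]1,\infty[$ and there exist a finite set $\Omega\subset\mathbb C$ and complex coefficients $(f_k)_{k\in\Omega}$ such that $f-\sum_{k\in\Omega}f_kr^k$ is integrable on $]0,1[$. For such $f$, $$\mathrm{gen}\!\int_0^\infty f(r)\,dr:=\sum_{k\in\Omega\setminus\{-1\}}\frac{f_k}{k+1}+\int_0^1\Big(f(r)-\sum_{k\in\Omega}f_kr^k\Big)dr+\int_1^\infty f(r)\,dr,$$ which does not depend on the choice of $\Omega$. For special values of the parameters at which individual terms on the right-hand sides are singular (form "$0$ divided by $0$"), the singularities are only apparent and the right-hand sides are understood as their limits (analytic continuation in the parameters). *)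

theory Defs
  imports "HOL-Analysis.Analysis" "HOL-Library.Landau_Symbols"
begin

definition kummer_solution :: "complex \<Rightarrow> complex \<Rightarrow> (real \<Rightarrow> complex) \<Rightarrow> bool" where
  "kummer_solution a c f \<longleftrightarrow>
     (\<exists>f' f''. \<forall>z>0. (f has_vector_derivative f' z) (at z) \<and>
                   (f' has_vector_derivative f'' z) (at z) \<and>
                   of_real z * f'' z + (c - of_real z) * f' z - a * f z = 0)"

text \<open>
  The normalisation at infinity determines a solution uniquely on the positive half-line, because
  every solution independent of \<open>U\<close> grows like \<open>exp z * z powr (a - c)\<close>.  The description is
  therefore meaningful for all complex \<open>a\<close>, \<open>c\<close> and all \<open>z > 0\<close>; nothing is claimed for \<open>z \<le> 0\<close>.
\<close>
definition tricomi_U :: "complex \<Rightarrow> complex \<Rightarrow> real \<Rightarrow> complex" where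
  "tricomi_U a c z =
     (THE w. \<exists>f. kummer_solution a c f \<and> f \<sim>[at_top] (\<lambda>x. of_real x powr (- a)) \<and> w = f z)"

definition tricomi_Lie :: "complex \<Rightarrow> complex \<Rightarrow> real \<Rightarrow> complex" where
  "tricomi_Lie \<theta> \<alpha> z = tricomi_U ((1 + \<alpha> + \<theta>) / 2) (1 + \<alpha>) z"

definition gen_expansion ::
    "(real \<Rightarrow> complex) \<Rightarrow> complex set \<Rightarrow> (complex \<Rightarrow> complex) \<Rightarrow> bool" where
  "gen_expansion f \<Omega> c \<longleftrightarrow>
     finite \<Omega> \<and>
     f absolutely_integrable_on {1<..} \<and>
     (\<lambda>r. f r - (\<Sum>k\<in>\<Omega>. c k * of_real r powr k)) absolutely_integrable_on {0<..<1}"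

definition gen_integrable :: "(real \<Rightarrow> complex) \<Rightarrow> bool" where
  "gen_integrable f \<longleftrightarrow> (\<exists>\<Omega> c. gen_expansion f \<Omega> c)"

text \<open>The value does not depend on the expansion chosen, so the description is meaningful
  whenever \<open>f\<close> is integrable in the generalized sense.\<close>
definition gen_integral :: "(real \<Rightarrow> complex) \<Rightarrow> complex" where
  "gen_integral f =
     (THE I. \<exists>\<Omega> c. gen_expansion f \<Omega> c \<and>
        I = (\<Sum>k\<in>\<Omega> - {-1}. c k / (k + 1))
            + (LINT r:{0<..<1}|lebesgue. f r - (\<Sum>k\<in>\<Omega>. c k * of_real r powr k))
            + (LINT r:{1<..}|lebesgue. f r))"

text \<open>
  The right-hand side for coinciding parameters, and the set of parameters at which all of its
  terms are finite.  At the poles of \<open>\<psi>\<close> the library value of \<^const>\<open>Digamma\<close> is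
  an arbitrary number, so there the formula has to be replaced by its limit from the regular set.
\<close>
definition diag_rhs :: "complex \<Rightarrow> complex \<Rightarrow> complex" where
  "diag_rhs \<theta> \<alpha> =
     of_real pi / sin (of_real pi * \<alpha>) *
       ((Digamma ((1 + \<theta> + \<alpha>) / 2) - Digamma ((1 + \<theta> - \<alpha>) / 2)) /
        (Gamma ((1 + \<theta> + \<alpha>) / 2) * Gamma ((1 + \<theta> - \<alpha>) / 2)))"

definition diag_regular :: "(complex \<times> complex) set" where
  "diag_regular =
     {(\<theta>, \<alpha>). \<alpha> \<notin> \<int> \<and> (1 + \<theta> + \<alpha>) / 2 \<notin> \<int>\<^sub>\<le>\<^sub>0 \<and> (1 + \<theta> - \<alpha>) / 2 \<notin> \<int>\<^sub>\<le>\<^sub>0}"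

end

theory Submission
  imports Defs "HOL-Complex_Analysis.Complex_Analysis"
begin

text \<open>
  Put \<open>a = (1 + \<theta> + \<alpha>) / 2\<close>, so that \<open>U\<close> solves Kummer's equation with parameters \<open>a\<close>
  and \<open>1 + \<alpha>\<close>.  In self-adjoint form this equation reads
  \<open>(z powr (1 + \<alpha>) * exp (- z) * U')' = a * z powr \<alpha> * exp (- z) * U\<close>.  For two parameters \<open>a\<close> and \<open>b\<close>
  the weighted Wronskian \<open>w = z powr (1 + \<alpha>) * exp (- z) * (U_a' * U_b - U_a * U_b')\<close> is therefore
  \<open>a - b\<close> times a primitive of the integrand (\<open>kummer_wronskian_has_vector_derivative\<close>).

  At infinity \<open>w\<close> vanishes.  Near 0 the connection formula
  \<open>U_a = Gamma (- \<alpha>) / Gamma (a - \<alpha>) * M + Gamma \<alpha> / Gamma a * z powr (- \<alpha>) * N\<close>, with entire \<open>M\<close> and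
  \<open>N\<close>, makes \<open>w\<close> a sum of powers with exponents in \<open>1 + \<alpha> + nat\<close>, \<open>nat\<close> and \<open>1 - \<alpha> + nat\<close>.  The generalized
  integral of a derivative discards every power except the constant one, so \<open>a - b\<close> times the integral
  is minus the constant term of \<open>w\<close>.  Only the mixed products contribute to it, and Euler's reflection
  formula turns \<open>\<alpha> * Gamma \<alpha> * Gamma (- \<alpha>)\<close> into \<open>- \<pi> / sin (\<pi> * \<alpha>)\<close>.  This is
  \<open>gen_integral_tricomi_offdiag\<close>.  The diagonal value is the limit \<open>b \<rightarrow> a\<close>: the part near 0 is a series
  dominated uniformly in \<open>b\<close>, the part at infinity is an integral dominated uniformly in \<open>b\<close>
  (\<open>tricomi_integral_tendsto\<close>).  The limit of the difference quotient is expressed by the derivative of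
  the entire function \<open>1 / Gamma\<close>, which yields the digamma function away from the poles and the
  continuous extension at the poles.

  The function \<open>U\<close> is defined only by its asymptotics, so the connection formula has to be established
  for all complex \<open>a\<close> and nonintegral \<open>\<alpha>\<close>.  Solutions with the asymptotics of \<open>U\<close> are unique, because the
  weighted Wronskian of two of them is constant and must be 0 (\<open>kummer_unique_at_top\<close>).  For large \<open>Re a\<close> the Laplace integral of
  \<open>t powr (a - 1) * (1 + t) powr (\<alpha> - a)\<close>, divided by \<open>Gamma a\<close>, is such a solution.  Its coefficient
  of \<open>z powr (- \<alpha>) * N\<close> is read off at \<open>z = 0\<close> if \<open>Re \<alpha> > 0\<close> and follows for all \<open>\<alpha>\<close> by differentiation,
  which shifts both parameters by 1; the other coefficient follows from the symmetry
  \<open>f \<mapsto> z powr (- \<alpha>) * f\<close> and uniqueness (\<open>laplace_U_eq_T\<close>).  A contiguous relation that lowers \<open>a\<close> by 1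
  then transports the asymptotics and the bounds to all \<open>a\<close> (\<open>tricomi_U_eq_T\<close>, \<open>tricomi_T_bound\<close>).
\<close>

section \<open>The generalized integral\<close>

lemma powr_integrable_near_0_imp:
  fixes c k :: complex
  assumes int: "(\<lambda>r::real. c * of_real r powr k) absolutely_integrable_on {0<..<1}" and "c \<noteq> 0"
  shows "Re k > -1"
proof (rule ccontr)
  assume k: "\<not> Re k > -1"
  define g where "g = (\<lambda>r::real. norm (c * of_real r powr k))"
  have g: "g integrable_on {0<..<1}"
    using absolutely_integrable_norm[OF int] unfolding g_def o_def
    by (rule set_lebesgue_integral_eq_integral(1))
  \<comment> \<open>the integral of \<open>norm c / r\<close> over \<open>{e..1/2}\<close> exceeds that of \<open>g\<close> over the whole interval\<close>
  define e where "e = exp (- (integral {0<..<1} g / norm c + 2))"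
  have I0: "integral {0<..<1} g \<ge> 0"
    by (rule integral_nonneg[OF g]) (simp add: g_def)
  have "integral {0<..<1} g / norm c \<ge> 0" using I0 by simp
  then have e: "0 < e" "e < 1/2"
  proof -
    have "e \<le> exp (-2)" unfolding e_def using I0 by simp
    also have "exp (-2::real) < 1/2"
      using exp_ge_add_one_self[of "2::real"] by (simp add: exp_minus divide_simps)
    finally show "e < 1/2" .
  qed (simp add: e_def)
  have "((\<lambda>r. norm c / r) has_integral (norm c * ln (1/2) - norm c * ln e)) {e..1/2}"
    using e by (intro fundamental_theorem_of_calculus)
      (auto intro!: derivative_eq_intros simp: has_real_derivative_iff_has_vector_derivative[symmetric])
  then have 1: "integral {e..1/2} (\<lambda>r. norm c / r) = norm c * ln (1/2) - norm c * ln e"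
    and 2: "(\<lambda>r. norm c / r) integrable_on {e..1/2}"
    by (auto simp: integral_unique integrable_on_def)
  have gsub: "g integrable_on {e..1/2}"
    unfolding g_def using e
    by (intro integrable_continuous_interval continuous_intros) auto
  have "norm c * ln (1/2) - norm c * ln e \<le> integral {e..1/2} g"
    unfolding 1[symmetric]
  proof (rule integral_le[OF 2 gsub])
    fix r assume r: "r \<in> {e..1/2}"
    then have "0 < r" "r < 1" using e by auto
    then have "r powr (-1) \<le> r powr (Re k)"
      using k by (intro powr_mono') auto
    then show "norm c / r \<le> g r"
      using \<open>0 < r\<close> \<open>c \<noteq> 0\<close> unfolding g_def
      by (simp add: norm_mult norm_powr_real_powr powr_minus field_simps)
  qed
  also have "\<dots> \<le> integral {0<..<1} g"
    using e by (intro integral_subset_le gsub g) (auto simp: g_def)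
  finally have "norm c * ln (1/2) + integral {0<..<1} g + 2 * norm c \<le> integral {0<..<1} g"
    using \<open>c \<noteq> 0\<close> by (simp add: e_def algebra_simps)
  then have "norm c * (ln (1/2) + 2) \<le> 0" by (simp add: algebra_simps)
  moreover have "ln (1/2::real) + 2 > 0" using ln_2_less_1 by (simp add: ln_div)
  ultimately show False using \<open>c \<noteq> 0\<close> by (simp add: mult_le_0_iff)
qed

lemma absolutely_integrable_shrink:
  fixes g :: "real \<Rightarrow> complex"
  assumes "g absolutely_integrable_on {0<..<1}" "0 < l" "l < 1"
  shows "(\<lambda>r. g (l * r)) absolutely_integrable_on {0<..<1}"
proof -
  have im: "(\<lambda>r. l * r) ` {0<..<1} = {0<..<l}"
  proof (intro equalityI subsetI)
    fix x assume "x \<in> {0<..<l}"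
    then have "x = l * (x / l)" "x / l \<in> {0<..<1}" using assms by (auto simp: field_simps)
    then show "x \<in> (\<lambda>r. l * r) ` {0<..<1}" by blast
  qed (use assms in auto)
  have "g absolutely_integrable_on {0<..<l}"
    by (rule set_integrable_subset[OF assms(1)]) (use assms in auto)
  then have "(\<lambda>r. \<bar>l\<bar> *\<^sub>R g (l * r)) absolutely_integrable_on {0<..<1}"
    using assms
    by (subst absolutely_integrable_change_of_variables_real[symmetric])
      (auto intro!: derivative_eq_intros inj_onI simp: im)
  then have "(\<lambda>r. (1 / l) *\<^sub>R (\<bar>l\<bar> *\<^sub>R g (l * r))) absolutely_integrable_on {0<..<1}"
    by (rule absolutely_integrable_scaleR_left)
  then show ?thesis using assms by simp
qed

lemma powr_scale_separates:
  fixes k k' :: complex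
  assumes "k \<noteq> k'"
  obtains l :: real where "0 < l" "l < 1" "of_real l powr k \<noteq> of_real l powr k'"
proof (rule ccontr)
  note sep = that
  assume *: "\<not> thesis"
  \<comment> \<open>if no scaling factor \<open>exp (- t)\<close> separates the exponents, \<open>f\<close> is constantly 1\<close>
  define f where "f = (\<lambda>t::real. exp (- of_real t * (k - k')))"
  have f1: "f t = 1" if "t > 0" for t
  proof -
    have "of_real (exp (-t)) powr k = of_real (exp (-t)) powr k'"
    proof (rule ccontr)
      assume "of_real (exp (-t)) powr k \<noteq> of_real (exp (-t)) powr k'"
      then have thesis using that by (intro sep[of "exp (-t)"]) auto
      then show False using * by simp
    qed
    then have "exp (- of_real t * k) = exp (- of_real t * k')"
      by (simp add: powr_def Ln_of_real mult.commute flip: of_real_exp)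
    then show ?thesis unfolding f_def
      by (simp add: ring_distribs exp_diff exp_add exp_minus)
  qed
  have "(f has_vector_derivative - (k - k') * f 1) (at 1)"
    unfolding f_def
    by (rule has_vector_derivative_real_field) (auto intro!: derivative_eq_intros)
  moreover have "(f has_vector_derivative 0) (at 1)"
  proof (rule has_vector_derivative_transform_within_open[of "\<lambda>_. 1" _ _ "{0<..}"])
  qed (auto simp: f1)
  ultimately have "- (k - k') * f 1 = 0"
    using vector_derivative_unique_at by blast
  then show False using assms f1[of 1] by simp
qed

text \<open>
  An integrable combination of powers contains only integrable powers.  Cancellation between terms is
  excluded by removing the other exponents one at a time: subtracting a multiple of the function from
  its rescaling \<open>r \<mapsto> l * r\<close> eliminates one exponent and keeps the coefficient of \<open>k0\<close> nonzero.
\<close>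
lemma powr_sum_integrable_near_0_imp:
  fixes d :: "complex \<Rightarrow> complex"
  assumes "finite S" "(\<lambda>r::real. \<Sum>k\<in>S. d k * of_real r powr k) absolutely_integrable_on {0<..<1}"
    "k0 \<in> S" "d k0 \<noteq> 0"
  shows "Re k0 > -1"
  using assms
proof (induction "card S" arbitrary: S d rule: less_induct)
  case less
  show ?case
  proof (cases "S = {k0}")
    case True
    then show ?thesis using less.prems powr_integrable_near_0_imp[of "d k0" k0] by simp
  next
    case False
    then obtain k1 where k1: "k1 \<in> S" "k1 \<noteq> k0" using less.prems by auto
    obtain l :: real where l: "0 < l" "l < 1" "of_real l powr k0 \<noteq> of_real l powr k1"
      using powr_scale_separates k1 by metis
    define g where "g = (\<lambda>r::real. \<Sum>k\<in>S. d k * of_real r powr k)"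
    define e where "e = (\<lambda>k. d k * (of_real l powr k - of_real l powr k1))"
    have "(\<lambda>r. g (l * r) - of_real l powr k1 * g r) absolutely_integrable_on {0<..<1}"
      using absolutely_integrable_shrink[of g l] less.prems(2) l
      by (intro set_integral_diff(1) set_integrable_mult_right) (auto simp: g_def)
    moreover have "g (l * r) - of_real l powr k1 * g r = (\<Sum>k\<in>S - {k1}. e k * of_real r powr k)"
      if "r \<in> {0<..<1}" for r
    proof -
      have "g (l * r) - of_real l powr k1 * g r = (\<Sum>k\<in>S. e k * of_real r powr k)"
        unfolding g_def e_def sum_distrib_left sum_subtractf[symmetric] using that l
        by (intro sum.cong refl) (simp add: powr_times_real algebra_simps)
      also have "\<dots> = (\<Sum>k\<in>S - {k1}. e k * of_real r powr k)"
        using less.prems(1) k1 by (subst sum.remove[of _ k1]) (auto simp: e_def)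
      finally show ?thesis .
    qed
    ultimately have "(\<lambda>r::real. \<Sum>k\<in>S - {k1}. e k * of_real r powr k) absolutely_integrable_on {0<..<1}"
      by (subst set_integrable_cong[OF refl refl]) (auto intro: sym)
    moreover have "card (S - {k1}) < card S"
      using less.prems(1) k1 by (intro psubset_card_mono) auto
    ultimately show ?thesis
      using less.prems k1 l by (intro less.hyps[of "S - {k1}" e]) (auto simp: e_def)
  qed
qed

text \<open>A power that is integrable near the origin contributes its ordinary integral.\<close>
lemma powr_integral_0_1:
  fixes k :: complex
  assumes "Re k > -1"
  shows "(\<lambda>r::real. of_real r powr k) absolutely_integrable_on {0<..<1}"
    and "integral {0<..<1} (\<lambda>r::real. of_real r powr k) = 1 / (k + 1)"
proof -
  have "k \<noteq> -1" using assms by auto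
  then have k: "k \<noteq> -1" "k + 1 \<noteq> 0" by (auto simp: add_eq_0_iff2)
  define F where "F = (\<lambda>r::real. of_real r powr (k + 1) / (k + 1))"
  have "continuous_on {0..1} F" unfolding F_def using assms k
    by (intro continuous_intros) auto
  then have I: "((\<lambda>r::real. of_real r powr k) has_integral (F 1 - F 0)) {0..1}"
  proof (rule fundamental_theorem_of_calculus_interior[rotated])
    fix r :: real assume "r \<in> {0<..<1}"
    then show "(F has_vector_derivative of_real r powr k) (at r)"
      unfolding F_def using k
      by (auto intro!: derivative_eq_intros has_vector_derivative_real_field simp: powr_diff)
  qed simp
  have I': "((\<lambda>r::real. of_real r powr k) has_integral (1 / (k + 1))) {0<..<1}"
    using I k by (simp add: F_def has_integral_Icc_iff_Ioo)
  have "((\<lambda>r::real. r powr Re k) integrable_on {0..1})"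
    using integrable_on_powr_from_0[of "Re k" 1] assms by simp
  then have J: "((\<lambda>r::real. r powr Re k) integrable_on {0<..<1})"
    by (simp add: integrable_on_Icc_iff_Ioo)
  show "(\<lambda>r::real. of_real r powr k) absolutely_integrable_on {0<..<1}"
    by (rule absolutely_integrable_integrable_bound[OF _ _ J])
      (use I' in \<open>auto simp: norm_powr_real_powr integrable_on_def\<close>)
  show "integral {0<..<1} (\<lambda>r::real. of_real r powr k) = 1 / (k + 1)"
    using I' by (rule integral_unique)
qed

text \<open>
  The value of the generalized integral computed from one given expansion, with Henstock-Kurzweil
  integrals in place of Lebesgue integrals.
\<close>
definition gen_value :: "(real \<Rightarrow> complex) \<Rightarrow> complex set \<Rightarrow> (complex \<Rightarrow> complex) \<Rightarrow> complex" where
  "gen_value f S c = (\<Sum>k\<in>S - {-1}. c k / (k + 1))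
     + integral {0<..<1} (\<lambda>r. f r - (\<Sum>k\<in>S. c k * of_real r powr k)) + integral {1<..} f"

lemma gen_value_unique:
  assumes "gen_expansion f S c" "gen_expansion f S' c'"
  shows "gen_value f S c = gen_value f S' c'"
proof -
  define T where "T = S \<union> S'"
  define b where "b = (\<lambda>k. if k \<in> S then c k else 0)"
  define b' where "b' = (\<lambda>k. if k \<in> S' then c' k else 0)"
  define d where "d = (\<lambda>k. b' k - b k)"
  have fin: "finite S" "finite S'" "finite T"
    using assms by (auto simp: gen_expansion_def T_def)
  have ext: "(\<Sum>k\<in>S. c k * h k) = (\<Sum>k\<in>T. b k * h k)" "(\<Sum>k\<in>S'. c' k * h k) = (\<Sum>k\<in>T. b' k * h k)"
    for h :: "complex \<Rightarrow> complex"
    using fin by (auto intro!: sum.mono_neutral_cong_left simp: b_def b'_def T_def)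
  have ext': "(\<Sum>k\<in>S - {-1}. c k / (k + 1)) = (\<Sum>k\<in>T - {-1}. b k / (k + 1))"
    "(\<Sum>k\<in>S' - {-1}. c' k / (k + 1)) = (\<Sum>k\<in>T - {-1}. b' k / (k + 1))"
    using fin by (auto intro!: sum.mono_neutral_cong_left simp: b_def b'_def T_def split: if_splits)
  define g where "g = (\<lambda>r::real. f r - (\<Sum>k\<in>T. b k * of_real r powr k))"
  define g' where "g' = (\<lambda>r::real. f r - (\<Sum>k\<in>T. b' k * of_real r powr k))"
  have int: "g absolutely_integrable_on {0<..<1}" "g' absolutely_integrable_on {0<..<1}"
    using assms by (auto simp: gen_expansion_def g_def g'_def ext)
  have dsum: "g r - g' r = (\<Sum>k\<in>T. d k * of_real r powr k)" for r
    by (simp add: g_def g'_def d_def algebra_simps sum_subtractf)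
  have "(\<lambda>r. g r - g' r) absolutely_integrable_on {0<..<1}"
    using int by (rule set_integral_diff(1))
  then have dint: "(\<lambda>r::real. \<Sum>k\<in>T. d k * of_real r powr k) absolutely_integrable_on {0<..<1}"
    by (simp add: dsum)
  have re: "Re k > -1" if "k \<in> T" "d k \<noteq> 0" for k
    using powr_sum_integrable_near_0_imp[OF fin(3) dint that] .
  have dsum': "(\<Sum>k\<in>T. d k * of_real r powr k) = (\<Sum>k\<in>{k \<in> T. d k \<noteq> 0}. d k * of_real r powr k)" for r :: real
    using fin by (intro sum.mono_neutral_right) auto
  have "integral {0<..<1} g - integral {0<..<1} g' = integral {0<..<1} (\<lambda>r. g r - g' r)"
    using int by (intro integral_diff[symmetric] set_lebesgue_integral_eq_integral(1))
  also have "\<dots> = integral {0<..<1} (\<lambda>r::real. \<Sum>k\<in>{k \<in> T. d k \<noteq> 0}. d k * of_real r powr k)"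
    by (simp add: dsum dsum')
  also have "\<dots> = (\<Sum>k\<in>{k \<in> T. d k \<noteq> 0}. integral {0<..<1} (\<lambda>r::real. d k * of_real r powr k))"
    using fin re
    by (intro integral_sum set_lebesgue_integral_eq_integral(1) set_integrable_mult_right
        powr_integral_0_1) auto
  also have "\<dots> = (\<Sum>k\<in>{k \<in> T. d k \<noteq> 0}. d k / (k + 1))"
    using re by (intro sum.cong refl) (simp add: powr_integral_0_1)
  also have "\<dots> = (\<Sum>k\<in>T - {-1}. d k / (k + 1))"
    using fin re by (intro sum.mono_neutral_left) fastforce+
  finally have "integral {0<..<1} g - integral {0<..<1} g' = (\<Sum>k\<in>T - {-1}. d k / (k + 1))" .
  then have "(\<Sum>k\<in>T - {-1}. b k / (k + 1)) + integral {0<..<1} g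
      = (\<Sum>k\<in>T - {-1}. b' k / (k + 1)) + integral {0<..<1} g'"
    by (simp add: d_def diff_divide_distrib sum_subtractf algebra_simps)
  then show ?thesis
    by (simp add: gen_value_def ext ext' g_def g'_def)
qed

lemma gen_integral_eqI:
  assumes "gen_expansion f S c"
  shows "gen_integrable f" "gen_integral f = gen_value f S c"
proof -
  show "gen_integrable f" using assms by (auto simp: gen_integrable_def)
  have *: "(\<Sum>k\<in>S - {-1}. c k / (k + 1))
            + (LINT r:{0<..<1}|lebesgue. f r - (\<Sum>k\<in>S. c k * of_real r powr k))
            + (LINT r:{1<..}|lebesgue. f r) = gen_value f S c" if "gen_expansion f S c" for S c
    using that unfolding gen_value_def gen_expansion_def
    by (simp add: set_lebesgue_integral_eq_integral(2))
  show "gen_integral f = gen_value f S c"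
    unfolding gen_integral_def
  proof (rule the_equality)
    show "\<exists>S' c'. gen_expansion f S' c' \<and>
        gen_value f S c = (\<Sum>k\<in>S' - {-1}. c' k / (k + 1))
            + (LINT r:{0<..<1}|lebesgue. f r - (\<Sum>k\<in>S'. c' k * of_real r powr k))
            + (LINT r:{1<..}|lebesgue. f r)"
      by (intro exI[of _ S] exI[of _ c] conjI assms *[OF assms, symmetric])
  next
    fix I assume "\<exists>S c. gen_expansion f S c \<and>
        I = (\<Sum>k\<in>S - {-1}. c k / (k + 1))
            + (LINT r:{0<..<1}|lebesgue. f r - (\<Sum>k\<in>S. c k * of_real r powr k))
            + (LINT r:{1<..}|lebesgue. f r)"
    then obtain S' c' where S': "gen_expansion f S' c'" 
      and I: "I = (\<Sum>k\<in>S' - {-1}. c' k / (k + 1))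
            + (LINT r:{0<..<1}|lebesgue. f r - (\<Sum>k\<in>S'. c' k * of_real r powr k))
            + (LINT r:{1<..}|lebesgue. f r)" by (elim exE conjE)
    show "I = gen_value f S c"
      unfolding I *[OF S'] by (rule gen_value_unique[OF S' assms])
  qed
qed

text \<open>
  The same value for an indexed family of exponents, in which exponents may coincide: for instance
  \<open>\<alpha> + n\<close> and \<open>- \<alpha> + m\<close> overlap if \<open>2 * \<alpha>\<close> is an integer.
\<close>
lemma gen_integral_family:
  fixes e a :: "'i \<Rightarrow> complex"
  assumes fin: "finite I" and inf: "f absolutely_integrable_on {1<..}"
    and zero: "(\<lambda>r. f r - (\<Sum>i\<in>I. a i * of_real r powr e i)) absolutely_integrable_on {0<..<1}"
    and ne: "\<And>i. i \<in> I \<Longrightarrow> e i \<noteq> -1"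
  shows "gen_integrable f"
    and "gen_integral f = (\<Sum>i\<in>I. a i / (e i + 1))
      + integral {0<..<1} (\<lambda>r. f r - (\<Sum>i\<in>I. a i * of_real r powr e i)) + integral {1<..} f"
proof -
  define S where "S = e ` I"
  define c where "c = (\<lambda>k. \<Sum>i\<in>{i \<in> I. e i = k}. a i)"
  have grp: "(\<Sum>i\<in>I. a i * h (e i)) = (\<Sum>k\<in>S. c k * h k)" for h :: "complex \<Rightarrow> complex"
    unfolding S_def c_def
    by (subst sum.image_gen[OF fin, of _ e]) (auto intro!: sum.cong simp: sum_distrib_right)
  have grp_powr: "(\<Sum>i\<in>I. a i * of_real r powr e i) = (\<Sum>k\<in>S. c k * of_real r powr k)" for r :: real
    by (rule grp)
  have grp_div: "(\<Sum>i\<in>I. a i / (e i + 1)) = (\<Sum>k\<in>S. c k / (k + 1))"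
    using grp[of "\<lambda>k. 1 / (k + 1)"] by simp
  have exp: "gen_expansion f S c"
    using fin inf zero unfolding grp_powr by (simp add: gen_expansion_def S_def)
  have "S - {-1} = S" using ne by (auto simp: S_def)
  then have "gen_value f S c = (\<Sum>i\<in>I. a i / (e i + 1))
      + integral {0<..<1} (\<lambda>r. f r - (\<Sum>i\<in>I. a i * of_real r powr e i)) + integral {1<..} f"
    unfolding grp_powr grp_div by (simp add: gen_value_def)
  then show "gen_integrable f" "gen_integral f = (\<Sum>i\<in>I. a i / (e i + 1))
      + integral {0<..<1} (\<lambda>r. f r - (\<Sum>i\<in>I. a i * of_real r powr e i)) + integral {1<..} f"
    using gen_integral_eqI[OF exp] by auto
qed

section \<open>Entire power series and generalized integrals\<close>

text \<open>
  Power series that converge everywhere.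
\<close>
definition entire_fps :: "complex fps \<Rightarrow> bool" where
  "entire_fps F \<longleftrightarrow> fps_conv_radius F = \<infinity>"

lemma entire_fpsI:
  assumes "\<And>z. summable (\<lambda>n. fps_nth F n * z ^ n)"
  shows "entire_fps F"
  unfolding entire_fps_def fps_conv_radius_def by (rule conv_radius_inftyI'') (rule assms)

lemma entire_fps_summable:
  assumes "entire_fps F"
  shows "summable (\<lambda>n. fps_nth F n * z ^ n)" "summable (\<lambda>n. norm (fps_nth F n * z ^ n))"
  using assms by (auto simp: entire_fps_def intro!: summable_fps norm_summable_fps)

named_theorems entire

lemma entire_simple [entire, simp]: "entire_fps (fps_const c)" "entire_fps fps_X" "entire_fps (fps_exp b)" "entire_fps 0" "entire_fps 1"
  by (simp_all add: entire_fps_def)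

lemma entire_add [entire]: "entire_fps F \<Longrightarrow> entire_fps G \<Longrightarrow> entire_fps (F + G)"
  using fps_conv_radius_add[of F G] by (simp add: entire_fps_def)
lemma entire_diff [entire]: "entire_fps F \<Longrightarrow> entire_fps G \<Longrightarrow> entire_fps (F - G)"
  using fps_conv_radius_diff[of F G] by (simp add: entire_fps_def)
lemma entire_mult [entire]: "entire_fps F \<Longrightarrow> entire_fps G \<Longrightarrow> entire_fps (F * G)"
  using fps_conv_radius_mult[of F G] by (simp add: entire_fps_def)
lemma entire_deriv [entire]: "entire_fps F \<Longrightarrow> entire_fps (fps_deriv F)"
  using fps_conv_radius_deriv[of F] by (simp add: entire_fps_def)
lemma entire_shift [entire]: "entire_fps F \<Longrightarrow> entire_fps (fps_shift N F)"
  by (simp add: entire_fps_def)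

lemma eval_entire:
  assumes "entire_fps F" "entire_fps G"
  shows "eval_fps (F + G) z = eval_fps F z + eval_fps G z"
    "eval_fps (F - G) z = eval_fps F z - eval_fps G z"
    "eval_fps (F * G) z = eval_fps F z * eval_fps G z"
  using assms by (auto simp: entire_fps_def intro!: eval_fps_add eval_fps_diff eval_fps_mult)

lemma continuous_on_eval_entire:
  assumes "entire_fps F" "continuous_on A g"
  shows "continuous_on A (\<lambda>x. eval_fps F (g x))"
  using assms by (intro continuous_on_eval_fps') (auto simp: entire_fps_def)

lemma eval_entire_has_vector_derivative:
  assumes "entire_fps F"
  shows "((\<lambda>r. eval_fps F (complex_of_real r)) has_vector_derivative eval_fps (fps_deriv F) (of_real r)) (at r)"
  using assms
  by (intro has_vector_derivative_real_field has_field_derivative_eval_fps) (simp add: entire_fps_def)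

lemma eval_entire_split:
  assumes "entire_fps F"
  shows "eval_fps F z = (\<Sum>n<N. fps_nth F n * z ^ n) + z ^ N * eval_fps (fps_shift N F) z"
proof -
  have "eval_fps F z = (\<Sum>n. fps_nth F (n + N) * z ^ (n + N)) + (\<Sum>n<N. fps_nth F n * z ^ n)"
    unfolding eval_fps_def
    by (rule suminf_split_initial_segment) (rule entire_fps_summable[OF assms])
  also have "(\<Sum>n. fps_nth F (n + N) * z ^ (n + N)) = (\<Sum>n. z ^ N * (fps_nth (fps_shift N F) n * z ^ n))"
    by (simp add: power_add mult_ac)
  also have "\<dots> = z ^ N * eval_fps (fps_shift N F) z"
    unfolding eval_fps_def
    by (rule suminf_mult) (rule entire_fps_summable[OF entire_shift[OF assms]])
  finally show ?thesis by simp
qed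

text \<open>
  The power series \<open>P\<close> such that \<open>z powr (s + 1) * P z\<close> is the primitive of \<open>z powr s * F z\<close> without
  constant term.  Where \<open>s + n = -1\<close> the coefficient is 0 by the convention for division; all
  uses exclude this case.
\<close>
definition powr_prim :: "complex \<Rightarrow> complex fps \<Rightarrow> complex fps" where
  "powr_prim s F = Abs_fps (\<lambda>n. fps_nth F n / (s + of_nat n + 1))"

lemma powr_prim_nth [simp]: "fps_nth (powr_prim s F) n = fps_nth F n / (s + of_nat n + 1)"
  by (simp add: powr_prim_def)

lemma entire_powr_prim [entire]:
  assumes "entire_fps F"
  shows "entire_fps (powr_prim s F)"
proof (rule entire_fpsI)
  fix z
  obtain N :: nat where N: "real N \<ge> norm s + 2" using real_arch_simple by blast
  show "summable (\<lambda>n. fps_nth (powr_prim s F) n * z ^ n)"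
  proof (rule summable_comparison_test'[OF entire_fps_summable(2)[OF assms, of z]])
    fix n assume n: "n \<ge> N"
    have "1 \<le> real (Suc n) - norm s" using N n by simp
    also have "\<dots> \<le> norm (of_nat (Suc n) - (- s))"
      using norm_triangle_ineq2[of "of_nat (Suc n) :: complex" "- s"]
      by (simp only: norm_of_nat norm_minus_cancel)
    also have "of_nat (Suc n) - (- s) = s + of_nat n + 1" by simp
    finally have "1 \<le> norm (s + of_nat n + 1)" .
    then have "norm (fps_nth F n) / norm (s + of_nat n + 1) \<le> norm (fps_nth F n)"
      by (intro divide_le_eq[THEN iffD2]) (auto simp: mult_le_cancel_left1)
    then show "norm (fps_nth (powr_prim s F) n * z ^ n) \<le> norm (fps_nth F n * z ^ n)"
      by (simp add: norm_mult norm_divide mult_right_mono del: times_divide_eq_left)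
  qed
qed

lemma powr_prim_ode:
  assumes "\<And>n. s + of_nat n \<noteq> -1"
  shows "fps_const (s + 1) * powr_prim s F + fps_X * fps_deriv (powr_prim s F) = F"
proof (rule fps_ext)
  fix n
  have "s + of_nat n + 1 \<noteq> 0" using assms[of n] by (metis add_eq_0_iff add.commute)
  then show "fps_nth (fps_const (s + 1) * powr_prim s F + fps_X * fps_deriv (powr_prim s F)) n = fps_nth F n"
    by (cases n) (simp_all add: divide_simps, simp_all add: algebra_simps)
qed

lemma powr_prim_shift: "powr_prim (s + of_nat N) (fps_shift N F) = fps_shift N (powr_prim s F)"
  by (rule fps_ext) (simp add: add_ac)

text \<open>
  After \<open>N\<close> terms have been removed, the remainder is integrable and its primitive vanishes at 0.
\<close>
lemma powr_fps_remainder: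
  assumes F: "entire_fps F" and s: "\<And>n. s + of_nat n \<noteq> -1" and N: "Re s + real N > -1"
  defines "g \<equiv> (\<lambda>r::real. of_real r powr s * eval_fps F (of_real r)
              - (\<Sum>n<N. fps_nth F n * of_real r powr (s + of_nat n)))"
  shows "g absolutely_integrable_on {0<..<1}"
    and "integral {0<..<1} g = eval_fps (powr_prim s F) 1 - (\<Sum>n<N. fps_nth F n / (s + of_nat n + 1))"
proof -
  define H where "H = fps_shift N F"
  define t where "t = s + of_nat N"
  have H: "entire_fps H" using F by (simp add: H_def entire)
  have t: "t + of_nat n \<noteq> -1" for n using s[of "N + n"] by (simp add: t_def add_ac)
  have t1: "Re t > -1" "t + 1 \<noteq> 0" using N t[of 0] by (auto simp: t_def add_eq_0_iff2)
  have geq: "g r = eval_fps H (of_real r) * of_real r powr t" if "r \<in> {0<..<1}" for r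
    using that
    by (simp add: g_def eval_entire_split[OF F, of _ N] H_def t_def powr_add powr_nat' ring_distribs
        sum_distrib_left mult_ac)
  have "continuous_on {0..1} (\<lambda>r::real. eval_fps H (of_real r))"
    by (intro continuous_on_eval_entire H continuous_intros)
  then have "bounded ((\<lambda>r::real. eval_fps H (of_real r)) ` {0..1})"
    using compact_continuous_image compact_imp_bounded by blast
  then have bdd: "bounded ((\<lambda>r::real. eval_fps H (of_real r)) ` {0<..<1})"
    by (rule bounded_subset) auto
  have "(\<lambda>r::real. eval_fps H (of_real r) * of_real r powr t) absolutely_integrable_on {0<..<1}"
  proof (rule absolutely_integrable_bounded_measurable_product[OF bilinear_times _ _ bdd])
    show "(\<lambda>r::real. eval_fps H (of_real r)) \<in> borel_measurable (lebesgue_on {0<..<1})"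
      by (intro continuous_imp_measurable_on_sets_lebesgue continuous_on_eval_entire H
          continuous_intros) auto
  qed (use t1 in \<open>auto intro: powr_integral_0_1\<close>)
  then show g1: "g absolutely_integrable_on {0<..<1}"
    by (subst set_integrable_cong[OF refl refl geq]) auto
  define P where "P = powr_prim t H"
  have P: "entire_fps P" using H by (simp add: P_def entire)
  define Q where "Q = (\<lambda>r::real. of_real r powr (t + 1) * eval_fps P (of_real r))"
  have "(g has_integral (Q 1 - Q 0)) {0..1}"
  proof (rule fundamental_theorem_of_calculus_interior)
    show "continuous_on {0..1} Q"
      unfolding Q_def using t1 by (intro continuous_intros continuous_on_eval_entire P) auto
    fix r :: real assume r: "r \<in> {0<..<1}"
    have ode: "eval_fps H (of_real r) = (t + 1) * eval_fps P (of_real r) + of_real r * eval_fps (fps_deriv P) (of_real r)"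
      unfolding P_def by (subst powr_prim_ode[OF t, of H, symmetric]) (simp add: eval_entire entire H)
    have "((\<lambda>r. of_real r powr (t + 1)) has_vector_derivative ((t + 1) * of_real r powr t)) (at r)"
      using r by (auto intro!: derivative_eq_intros has_vector_derivative_real_field simp: powr_diff)
    then have "(Q has_vector_derivative (of_real r powr (t + 1) * eval_fps (fps_deriv P) (of_real r) +
        (t + 1) * of_real r powr t * eval_fps P (of_real r))) (at r)"
      unfolding Q_def by (intro has_vector_derivative_mult eval_entire_has_vector_derivative P)
    moreover have "of_real r powr (t + 1) = of_real r powr t * of_real r"
      using r by (simp add: powr_add)
    ultimately show "(Q has_vector_derivative g r) (at r)"
      unfolding geq[OF r] ode by (simp add: algebra_simps)
  qed simp
  then have "integral {0<..<1} g = Q 1 - Q 0"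
    by (intro integral_unique) (simp add: has_integral_Icc_iff_Ioo)
  also have "\<dots> = eval_fps (fps_shift N (powr_prim s F)) 1"
    using t1 by (simp add: Q_def P_def H_def t_def powr_prim_shift)
  also have "\<dots> = eval_fps (powr_prim s F) 1 - (\<Sum>n<N. fps_nth F n / (s + of_nat n + 1))"
    using eval_entire_split[OF entire_powr_prim[OF F], of s 1 N] by simp
  finally show "integral {0<..<1} g = eval_fps (powr_prim s F) 1 - (\<Sum>n<N. fps_nth F n / (s + of_nat n + 1))" .
qed

text \<open>
  The part of the generalized integral over the unit interval is the value at 1 of the formal primitive.
\<close>
lemma gen_integral_powr_fps_sum:
  fixes s :: "'j \<Rightarrow> complex" and F :: "'j \<Rightarrow> complex fps"
  assumes J: "finite J" and F: "\<And>j. j \<in> J \<Longrightarrow> entire_fps (F j)"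
    and s: "\<And>j n. j \<in> J \<Longrightarrow> s j + of_nat n \<noteq> -1"
    and f: "\<And>r. r \<in> {0<..<1} \<Longrightarrow> f r = (\<Sum>j\<in>J. of_real r powr s j * eval_fps (F j) (of_real r))"
    and inf: "f absolutely_integrable_on {1<..}"
  shows "gen_integrable f"
    and "gen_integral f = (\<Sum>j\<in>J. eval_fps (powr_prim (s j) (F j)) 1) + integral {1<..} f"
proof -
  obtain N :: nat where N: "real N > Max ((\<lambda>j. \<bar>Re (s j)\<bar>) ` J)"
    using reals_Archimedean2 by blast
  have N: "Re (s j) + real N > -1" if "j \<in> J" for j
  proof -
    have "\<bar>Re (s j)\<bar> \<le> Max ((\<lambda>j. \<bar>Re (s j)\<bar>) ` J)" using J that by (intro Max_ge) auto
    then show ?thesis using N by linarith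
  qed
  define g where "g = (\<lambda>j (r::real). of_real r powr s j * eval_fps (F j) (of_real r)
              - (\<Sum>n<N. fps_nth (F j) n * of_real r powr (s j + of_nat n)))"
  have g: "g j absolutely_integrable_on {0<..<1}"
    "integral {0<..<1} (g j) = eval_fps (powr_prim (s j) (F j)) 1 - (\<Sum>n<N. fps_nth (F j) n / (s j + of_nat n + 1))"
    if "j \<in> J" for j
    unfolding g_def using that by (auto intro!: powr_fps_remainder F s N)
  define I where "I = J \<times> {..<N}"
  define e where "e = (\<lambda>(j, n). s j + of_nat n :: complex)"
  define a where "a = (\<lambda>(j, n). fps_nth (F j) n)"
  have rem: "f r - (\<Sum>i\<in>I. a i * of_real r powr e i) = (\<Sum>j\<in>J. g j r)" if "r \<in> {0<..<1}" for r
    unfolding f[OF that] g_def sum_subtractf I_def e_def a_def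
    by (simp add: sum.cartesian_product prod.case_distrib case_prod_beta)
  have "(\<lambda>r. \<Sum>j\<in>J. g j r) absolutely_integrable_on {0<..<1}"
    using J g by (intro absolutely_integrable_sum) auto
  then have zero: "(\<lambda>r. f r - (\<Sum>i\<in>I. a i * of_real r powr e i)) absolutely_integrable_on {0<..<1}"
    by (subst set_integrable_cong[OF refl refl rem]) auto
  have fin: "finite I" using J by (simp add: I_def)
  have ne: "e i \<noteq> -1" if "i \<in> I" for i using that s by (auto simp: e_def I_def)
  note G = gen_integral_family[OF fin inf zero ne]
  show "gen_integrable f" by (rule G(1))
  have "integral {0<..<1} (\<lambda>r. f r - (\<Sum>i\<in>I. a i * of_real r powr e i)) = integral {0<..<1} (\<lambda>r. \<Sum>j\<in>J. g j r)"
    by (intro integral_cong rem)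
  also have "\<dots> = (\<Sum>j\<in>J. integral {0<..<1} (g j))"
    using J g by (intro integral_sum set_lebesgue_integral_eq_integral(1)) auto
  also have "\<dots> = (\<Sum>j\<in>J. eval_fps (powr_prim (s j) (F j)) 1) - (\<Sum>i\<in>I. a i / (e i + 1))"
    using g by (simp add: sum_subtractf I_def a_def e_def sum.cartesian_product case_prod_beta)
  finally show "gen_integral f = (\<Sum>j\<in>J. eval_fps (powr_prim (s j) (F j)) 1) + integral {1<..} f"
    using G(2) by simp
qed

section \<open>The Kummer equation\<close>

text \<open>
  Kummer's series \<open>M(a; c; z)\<close>.
\<close>
definition kummer_fps :: "complex \<Rightarrow> complex \<Rightarrow> complex fps" where
  "kummer_fps a c = Abs_fps (\<lambda>n. pochhammer a n / (pochhammer c n * fact n))"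

lemma kummer_fps_nth: "fps_nth (kummer_fps a c) n = pochhammer a n / (pochhammer c n * fact n)"
  by (simp add: kummer_fps_def)

lemma kummer_fps_0 [simp]: "fps_nth (kummer_fps a c) 0 = 1"
  by (simp add: kummer_fps_nth)

lemma kummer_fps_Suc:
  "fps_nth (kummer_fps a c) (Suc n) = fps_nth (kummer_fps a c) n * ((a + of_nat n) / ((c + of_nat n) * of_nat (Suc n)))"
  by (simp add: kummer_fps_nth pochhammer_Suc)

lemma entire_kummer_fps [entire, simp]: "entire_fps (kummer_fps a c)"
proof (rule entire_fpsI)
  fix z :: complex
  have "(\<lambda>n. (norm a + real n) * norm z / ((real n - norm c) * real (Suc n))) \<longlonglongrightarrow> 0"
    by real_asymp
  then have "eventually (\<lambda>n. (norm a + real n) * norm z / ((real n - norm c) * real (Suc n)) < 1/2) sequentially"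
    by (rule order_tendstoD) simp
  moreover have "eventually (\<lambda>n. real n > norm c) sequentially" by real_asymp
  ultimately have "eventually (\<lambda>n. norm (fps_nth (kummer_fps a c) (Suc n) * z ^ Suc n)
      \<le> 1/2 * norm (fps_nth (kummer_fps a c) n * z ^ n)) sequentially"
  proof eventually_elim
    case (elim n)
    have "norm ((a + of_nat n) / ((c + of_nat n) * of_nat (Suc n)) * z)
        \<le> (norm a + real n) * norm z / ((real n - norm c) * real (Suc n))"
      unfolding norm_mult norm_divide norm_of_nat times_divide_eq_left
      using norm_triangle_ineq[of a "of_nat n"] norm_triangle_ineq2[of "of_nat n" "- c"] elim
      by (intro frac_le mult_mono mult_right_mono) (auto simp: add.commute)
    also have "\<dots> \<le> 1/2" using elim by simp
    finally have "norm (fps_nth (kummer_fps a c) n * z ^ n) *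
        norm ((a + of_nat n) / ((c + of_nat n) * of_nat (Suc n)) * z)
        \<le> norm (fps_nth (kummer_fps a c) n * z ^ n) * (1/2)"
      by (rule mult_left_mono) simp
    then show ?case
      unfolding kummer_fps_Suc power_Suc norm_mult by (simp only: mult_ac)
  qed
  then obtain N where "\<And>n. n \<ge> N \<Longrightarrow> norm (fps_nth (kummer_fps a c) (Suc n) * z ^ Suc n)
      \<le> 1/2 * norm (fps_nth (kummer_fps a c) n * z ^ n)"
    unfolding eventually_sequentially by blast
  then show "summable (\<lambda>n. fps_nth (kummer_fps a c) n * z ^ n)"
    by (intro summable_ratio_test[of "1/2" N]) auto
qed

lemma kummer_fps_ode:
  assumes "\<And>n. c + of_nat n \<noteq> 0"
  shows "fps_X * fps_deriv (fps_deriv (kummer_fps a c)) =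
    fps_const a * kummer_fps a c - (fps_const c - fps_X) * fps_deriv (kummer_fps a c)"
proof (rule fps_ext)
  fix n
  have *: "(c + of_nat n) * of_nat (Suc n) * fps_nth (kummer_fps a c) (Suc n) = (a + of_nat n) * fps_nth (kummer_fps a c) n" for n
    unfolding kummer_fps_Suc using assms[of n] by (simp del: of_nat_Suc)
  show "fps_nth (fps_X * fps_deriv (fps_deriv (kummer_fps a c))) n =
    fps_nth (fps_const a * kummer_fps a c - (fps_const c - fps_X) * fps_deriv (kummer_fps a c)) n"
    using *[of n] by (cases n) (auto simp: algebra_simps)
qed

text \<open>
  A solution of Kummer's equation on the positive half-line together with its derivative.
\<close>
definition kummer_pair :: "complex \<Rightarrow> complex \<Rightarrow> (real \<Rightarrow> complex) \<Rightarrow> (real \<Rightarrow> complex) \<Rightarrow> bool" where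
  "kummer_pair a c f f' \<longleftrightarrow> (\<forall>z>0. (f has_vector_derivative f' z) (at z) \<and>
     (f' has_vector_derivative (a * f z - (c - of_real z) * f' z) / of_real z) (at z))"

lemma kummer_pairD:
  assumes "kummer_pair a c f f'" "z > 0"
  shows "(f has_vector_derivative f' z) (at z)"
    "(f' has_vector_derivative (a * f z - (c - of_real z) * f' z) / of_real z) (at z)"
  using assms by (auto simp: kummer_pair_def)

lemma kummer_solution_iff: "kummer_solution a c f \<longleftrightarrow> (\<exists>f'. kummer_pair a c f f')"
proof
  assume "kummer_solution a c f"
  then obtain f' f'' where *: "\<And>z. z > 0 \<Longrightarrow> (f has_vector_derivative f' z) (at z) \<and>
                   (f' has_vector_derivative f'' z) (at z) \<and>
                   of_real z * f'' z + (c - of_real z) * f' z - a * f z = 0"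
    unfolding kummer_solution_def by blast
  have "f'' z = (a * f z - (c - of_real z) * f' z) / of_real z" if "z > 0" for z
  proof -
    have "of_real z * f'' z = a * f z - (c - of_real z) * f' z" 
      using *[OF that] by (simp add: algebra_simps)
    then show ?thesis using that by (simp add: field_simps)
  qed
  then have "kummer_pair a c f f'" unfolding kummer_pair_def using * by metis
  then show "\<exists>f'. kummer_pair a c f f'" by blast
next
  assume "\<exists>f'. kummer_pair a c f f'"
  then obtain f' where *: "kummer_pair a c f f'" by blast
  show "kummer_solution a c f"
    unfolding kummer_solution_def
    by (rule exI[of _ f'], rule exI[of _ "\<lambda>z. (a * f z - (c - of_real z) * f' z) / of_real z"])
      (use * in \<open>auto simp: kummer_pair_def\<close>)
qed

lemma kummer_pair_lincomb:
  assumes "kummer_pair a c f f'" "kummer_pair a c g g'"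
  shows "kummer_pair a c (\<lambda>z. s * f z + t * g z) (\<lambda>z. s * f' z + t * g' z)"
  unfolding kummer_pair_def
proof (intro allI impI conjI)
  fix z :: real assume z: "z > 0"
  show "((\<lambda>z. s * f z + t * g z) has_vector_derivative s * f' z + t * g' z) (at z)"
    using kummer_pairD(1)[OF assms(1) z] kummer_pairD(1)[OF assms(2) z]
    by (intro has_vector_derivative_add has_vector_derivative_mult_right)
  have "((\<lambda>z. s * f' z + t * g' z) has_vector_derivative
      s * ((a * f z - (c - of_real z) * f' z) / of_real z) + t * ((a * g z - (c - of_real z) * g' z) / of_real z)) (at z)"
    using kummer_pairD(2)[OF assms(1) z] kummer_pairD(2)[OF assms(2) z]
    by (intro has_vector_derivative_add has_vector_derivative_mult_right)
  also have "s * ((a * f z - (c - of_real z) * f' z) / of_real z) + t * ((a * g z - (c - of_real z) * g' z) / of_real z)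
      = (a * (s * f z + t * g z) - (c - of_real z) * (s * f' z + t * g' z)) / of_real z"
    using z by (simp add: divide_simps) (simp add: algebra_simps)
  finally show "((\<lambda>z. s * f' z + t * g' z) has_vector_derivative
      (a * (s * f z + t * g z) - (c - of_real z) * (s * f' z + t * g' z)) / of_real z) (at z)" .
qed

lemma powr_has_vector_derivative:
  assumes "z > 0"
  shows "((\<lambda>z. of_real z powr s :: complex) has_vector_derivative s * of_real z powr s / of_real z) (at z)"
  using assms by (auto intro!: derivative_eq_intros has_vector_derivative_real_field simp: powr_diff)

text \<open>
  Kummer's transformation: multiplication by \<open>z powr (- \<alpha>)\<close> maps solutions with parameters
  \<open>a - \<alpha>\<close>, \<open>1 - \<alpha>\<close> to solutions with parameters \<open>a\<close>, \<open>1 + \<alpha>\<close>.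
\<close>
lemma kummer_pair_twist:
  assumes "kummer_pair (a - \<alpha>) (1 - \<alpha>) f f'"
  shows "kummer_pair a (1 + \<alpha>) (\<lambda>z. of_real z powr (- \<alpha>) * f z)
    (\<lambda>z. of_real z powr (- \<alpha>) * (f' z - \<alpha> * f z / of_real z))"
  unfolding kummer_pair_def
proof (intro allI impI conjI)
  fix z :: real assume z: "z > 0"
  note f = kummer_pairD[OF assms z]
  define w where "w = (of_real z :: complex) powr (- \<alpha>)"
  note p = powr_has_vector_derivative[OF z, of "- \<alpha>", folded w_def]
  have "((\<lambda>z. of_real z powr (- \<alpha>) * f z) has_vector_derivative w * f' z + (- \<alpha> * w / of_real z) * f z) (at z)"
    unfolding w_def using p[unfolded w_def] by (intro has_vector_derivative_mult f)
  also have "w * f' z + (- \<alpha> * w / of_real z) * f z = w * (f' z - \<alpha> * f z / of_real z)"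
    by (simp add: algebra_simps)
  finally show "((\<lambda>z. of_real z powr (- \<alpha>) * f z) has_vector_derivative
     of_real z powr (- \<alpha>) * (f' z - \<alpha> * f z / of_real z)) (at z)" by (simp add: w_def)
  define f2 where "f2 = ((a - \<alpha>) * f z - (1 - \<alpha> - of_real z) * f' z) / of_real z"
  have inv: "((\<lambda>z. inverse (of_real z) :: complex) has_vector_derivative - inverse (of_real z ^ 2)) (at z)"
    using z by (auto intro!: derivative_eq_intros has_vector_derivative_real_field simp: power2_eq_square)
  have "((\<lambda>z. f' z - \<alpha> * (f z * inverse (of_real z))) has_vector_derivative
      f2 - \<alpha> * (f z * (- inverse (of_real z ^ 2)) + f' z * inverse (of_real z))) (at z)"
    using f unfolding f2_def
    by (intro has_vector_derivative_diff has_vector_derivative_mult_right has_vector_derivative_mult inv)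
  then have "((\<lambda>z. of_real z powr (- \<alpha>) * (f' z - \<alpha> * (f z * inverse (of_real z)))) has_vector_derivative
      w * (f2 - \<alpha> * (f z * (- inverse (of_real z ^ 2)) + f' z * inverse (of_real z)))
      + (- \<alpha> * w / of_real z) * (f' z - \<alpha> * (f z * inverse (of_real z)))) (at z)"
    unfolding w_def using p[unfolded w_def] by (intro has_vector_derivative_mult)
  also have "w * (f2 - \<alpha> * (f z * (- inverse (of_real z ^ 2)) + f' z * inverse (of_real z)))
      + (- \<alpha> * w / of_real z) * (f' z - \<alpha> * (f z * inverse (of_real z)))
     = (a * (w * f z) - (1 + \<alpha> - of_real z) * (w * (f' z - \<alpha> * f z / of_real z))) / of_real z"
    using z unfolding f2_def by (simp add: divide_simps power2_eq_square) (simp add: algebra_simps)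
  finally show "((\<lambda>z. of_real z powr (- \<alpha>) * (f' z - \<alpha> * f z / of_real z)) has_vector_derivative
     (a * (of_real z powr (- \<alpha>) * f z) - (1 + \<alpha> - of_real z) * (of_real z powr (- \<alpha>) * (f' z - \<alpha> * f z / of_real z))) / of_real z) (at z)"
    by (simp add: w_def divide_inverse mult.assoc)
qed

text \<open>
  The Wronskian multiplied by the weight that makes Kummer's operator self-adjoint.
\<close>
definition kummer_wronskian :: "complex \<Rightarrow> (real \<Rightarrow> complex) \<Rightarrow> (real \<Rightarrow> complex) \<Rightarrow> (real \<Rightarrow> complex) \<Rightarrow> (real \<Rightarrow> complex) \<Rightarrow> real \<Rightarrow> complex" where
  "kummer_wronskian c f f' g g' z = of_real z powr c * exp (- of_real z) * (f' z * g z - f z * g' z)"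

lemma kummer_weight_has_vector_derivative:
  assumes "z > 0"
  shows "((\<lambda>z. of_real z powr c * exp (- of_real z) :: complex) has_vector_derivative
      of_real z powr c * exp (- of_real z) * (c / of_real z - 1)) (at z)"
proof -
  have "((\<lambda>z. exp (- of_real z) :: complex) has_vector_derivative - exp (- of_real z)) (at z)"
    by (rule has_vector_derivative_real_field) (auto intro!: derivative_eq_intros)
  from has_vector_derivative_mult[OF powr_has_vector_derivative[OF assms, of c] this]
  show ?thesis by (simp add: algebra_simps)
qed

lemma kummer_wronskian_has_vector_derivative:
  assumes f: "kummer_pair a1 c f f'" and g: "kummer_pair a2 c g g'" and z: "z > 0"
  shows "(kummer_wronskian c f f' g g' has_vector_derivative
    (a1 - a2) * (of_real z powr (c - 1) * exp (- of_real z) * f z * g z)) (at z)"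
proof -
  define w where "w = of_real z powr c * exp (- of_real z :: complex)"
  have pw: "of_real z powr (c - 1) * exp (- of_real z) = w / of_real z"
    using z by (simp add: w_def powr_diff)
  note D = kummer_pairD[OF f z] kummer_pairD[OF g z]
  note p = kummer_weight_has_vector_derivative[OF z, of c]
  have "((\<lambda>z. of_real z powr c * exp (- of_real z) * (f' z * g z - f z * g' z)) has_vector_derivative
     of_real z powr c * exp (- of_real z) * ((f' z * g' z + (a1 * f z - (c - of_real z) * f' z) / of_real z * g z)
       - (f z * ((a2 * g z - (c - of_real z) * g' z) / of_real z) + f' z * g' z))
     + of_real z powr c * exp (- of_real z) * (c / of_real z - 1) * (f' z * g z - f z * g' z)) (at z)"
    by (intro has_vector_derivative_mult has_vector_derivative_diff D p)
  also have "of_real z powr c * exp (- of_real z) * ((f' z * g' z + (a1 * f z - (c - of_real z) * f' z) / of_real z * g z)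
       - (f z * ((a2 * g z - (c - of_real z) * g' z) / of_real z) + f' z * g' z))
     + of_real z powr c * exp (- of_real z) * (c / of_real z - 1) * (f' z * g z - f z * g' z)
     = (a1 - a2) * (of_real z powr (c - 1) * exp (- of_real z) * f z * g z)"
    unfolding pw w_def[symmetric] using z by (simp add: divide_simps) (simp add: algebra_simps)
  finally show ?thesis by (simp add: kummer_wronskian_def[abs_def])
qed

lemma zero_derivative_on_pos_imp_const:
  fixes f :: "real \<Rightarrow> complex"
  assumes "\<And>z. z > 0 \<Longrightarrow> (f has_vector_derivative 0) (at z)" "x > 0" "y > 0"
  shows "f x = f y"
proof -
  have "(f has_vector_derivative 0) (at z within {0<..})" if "z \<in> {0<..}" for z
    using assms(1)[of z] that by (auto intro: has_vector_derivative_at_within)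
  then obtain c where "\<And>z. z \<in> {0<..} \<Longrightarrow> f z = c"
    using has_vector_derivative_zero_constant[of "{0<..}" f] by (metis convex_real_interval(3))
  then show ?thesis using assms(2,3) by simp
qed

lemma kummer_wronskian_const:
  assumes "kummer_pair a c f f'" "kummer_pair a c g g'" "x > 0" "y > 0"
  shows "kummer_wronskian c f f' g g' x = kummer_wronskian c f f' g g' y"
  using kummer_wronskian_has_vector_derivative[OF assms(1,2)] assms(3,4)
  by (intro zero_derivative_on_pos_imp_const) auto

text \<open>
  The two Frobenius solutions at 0 with parameters \<open>a\<close>, \<open>1 + \<alpha>\<close>, and their derivatives.
\<close>
definition kummer_M :: "complex \<Rightarrow> complex \<Rightarrow> real \<Rightarrow> complex" where
  "kummer_M a \<alpha> z = eval_fps (kummer_fps a (1 + \<alpha>)) (of_real z)"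
definition kummer_M' :: "complex \<Rightarrow> complex \<Rightarrow> real \<Rightarrow> complex" where
  "kummer_M' a \<alpha> z = eval_fps (fps_deriv (kummer_fps a (1 + \<alpha>))) (of_real z)"
definition kummer_N :: "complex \<Rightarrow> complex \<Rightarrow> real \<Rightarrow> complex" where
  "kummer_N a \<alpha> z = of_real z powr (- \<alpha>) * kummer_M (a - \<alpha>) (- \<alpha>) z"
definition kummer_N' :: "complex \<Rightarrow> complex \<Rightarrow> real \<Rightarrow> complex" where
  "kummer_N' a \<alpha> z = of_real z powr (- \<alpha>) * (kummer_M' (a - \<alpha>) (- \<alpha>) z - \<alpha> * kummer_M (a - \<alpha>) (- \<alpha>) z / of_real z)"

lemma not_Int_add_of_nat:
  assumes "\<alpha> \<notin> \<int>"
  shows "1 + \<alpha> + of_nat n \<noteq> 0" "1 - \<alpha> + of_nat n \<noteq> 0" "\<alpha> + of_nat n \<noteq> -1" "- \<alpha> + of_nat n \<noteq> -1" "\<alpha> \<noteq> 0"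
    "1 + (- \<alpha>) + of_nat n \<noteq> 0" "- \<alpha> \<notin> \<int>" "\<alpha> + 1 \<notin> \<int>"
proof -
  have 1: "1 + \<alpha> + of_nat n \<noteq> 0"
  proof
    assume "1 + \<alpha> + of_nat n = 0"
    moreover have "\<alpha> = (1 + \<alpha> + of_nat n) + of_int (- 1 - int n)" by simp
    ultimately have "\<alpha> = of_int (- 1 - int n)" by simp
    then show False using assms Ints_of_int by metis
  qed
  have 2: "1 - \<alpha> + of_nat n \<noteq> 0"
  proof
    assume "1 - \<alpha> + of_nat n = 0"
    moreover have "\<alpha> = of_int (1 + int n) - (1 - \<alpha> + of_nat n)" by simp
    ultimately have "\<alpha> = of_int (1 + int n)" by simp
    then show False using assms Ints_of_int by metis
  qed
  show "1 + \<alpha> + of_nat n \<noteq> 0" "1 - \<alpha> + of_nat n \<noteq> 0" "1 + (- \<alpha>) + of_nat n \<noteq> 0" using 1 2 by simp_all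
  show "\<alpha> + of_nat n \<noteq> -1"
  proof
    assume *: "\<alpha> + of_nat n = -1"
    have "1 + \<alpha> + of_nat n = 1 + (\<alpha> + of_nat n)" by (simp only: add.assoc)
    then show False using 1 * by simp
  qed
  show "- \<alpha> + of_nat n \<noteq> -1"
  proof
    assume *: "- \<alpha> + of_nat n = -1"
    have "1 - \<alpha> + of_nat n = 1 + (- \<alpha> + of_nat n)" by simp
    also have "\<dots> = 0" unfolding * by simp
    finally show False using 2 by simp
  qed
  show "\<alpha> \<noteq> 0" "- \<alpha> \<notin> \<int>" "\<alpha> + 1 \<notin> \<int>" using assms by (auto simp: minus_in_Ints_iff)
qed

lemma kummer_pair_M:
  assumes "\<alpha> \<notin> \<int>"
  shows "kummer_pair a (1 + \<alpha>) (kummer_M a \<alpha>) (kummer_M' a \<alpha>)"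
  unfolding kummer_pair_def
proof (intro allI impI conjI)
  fix z :: real assume z: "z > 0"
  let ?K = "kummer_fps a (1 + \<alpha>)"
  show "(kummer_M a \<alpha> has_vector_derivative kummer_M' a \<alpha> z) (at z)"
    unfolding kummer_M_def[abs_def] kummer_M'_def by (rule eval_entire_has_vector_derivative) simp
  have "eval_fps (fps_X * fps_deriv (fps_deriv ?K)) (of_real z) =
    eval_fps (fps_const a * ?K - (fps_const (1 + \<alpha>) - fps_X) * fps_deriv ?K) (of_real z)"
    using kummer_fps_ode[OF not_Int_add_of_nat(1)[OF assms], of a] by simp
  then have "of_real z * eval_fps (fps_deriv (fps_deriv ?K)) (of_real z) = a * kummer_M a \<alpha> z - (1 + \<alpha> - of_real z) * kummer_M' a \<alpha> z"
    by (simp add: eval_entire entire kummer_M_def kummer_M'_def del: fps_const_add fps_const_1_eq_1)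
  then have "eval_fps (fps_deriv (fps_deriv ?K)) (of_real z) = (a * kummer_M a \<alpha> z - (1 + \<alpha> - of_real z) * kummer_M' a \<alpha> z) / of_real z"
    using z by (simp add: field_simps)
  then show "(kummer_M' a \<alpha> has_vector_derivative (a * kummer_M a \<alpha> z - (1 + \<alpha> - of_real z) * kummer_M' a \<alpha> z) / of_real z) (at z)"
    using eval_entire_has_vector_derivative[OF entire_deriv[OF entire_kummer_fps[of a "1 + \<alpha>"]], of z]
    by (simp add: kummer_M'_def[abs_def])
qed

lemma kummer_pair_N:
  assumes "\<alpha> \<notin> \<int>"
  shows "kummer_pair a (1 + \<alpha>) (kummer_N a \<alpha>) (kummer_N' a \<alpha>)"
  using kummer_pair_twist[of a \<alpha> "kummer_M (a - \<alpha>) (- \<alpha>)"] kummer_pair_M[OF not_Int_add_of_nat(7)[OF assms], of "a - \<alpha>"]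
  by (simp add: kummer_N_def[abs_def] kummer_N'_def[abs_def])

text \<open>
  The product of two Kummer series and \<open>exp (- z)\<close>, followed by the weighted Wronskians, up to a power
  of \<open>z\<close>, of two solutions of the same Frobenius type and of the two different types.
\<close>
definition weight_fps :: "complex \<Rightarrow> complex \<Rightarrow> complex \<Rightarrow> complex \<Rightarrow> complex fps" where
  "weight_fps a c b d = fps_exp (-1) * (kummer_fps a c * kummer_fps b d)"

definition same_wronskian_fps :: "complex \<Rightarrow> complex \<Rightarrow> complex \<Rightarrow> complex fps" where
  "same_wronskian_fps a b c = fps_exp (-1) *
     (fps_deriv (kummer_fps a c) * kummer_fps b c - kummer_fps a c * fps_deriv (kummer_fps b c))"

definition cross_wronskian_fps :: "complex \<Rightarrow> complex \<Rightarrow> complex \<Rightarrow> complex fps" where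
  "cross_wronskian_fps a b \<alpha> = (let M = kummer_fps a (1 + \<alpha>); N = kummer_fps (b - \<alpha>) (1 - \<alpha>) in
     fps_exp (-1) * (fps_X * (fps_deriv M * N - M * fps_deriv N) + fps_const \<alpha> * (M * N)))"

lemma entire_weight_fps [entire, simp]: "entire_fps (weight_fps a c b d)"
  and entire_same_fps [entire, simp]: "entire_fps (same_wronskian_fps a b c)"
  and entire_cross_fps [entire, simp]: "entire_fps (cross_wronskian_fps a b \<alpha>)"
  by (simp_all add: weight_fps_def same_wronskian_fps_def cross_wronskian_fps_def Let_def entire)

lemma same_wronskian_fps_ode:
  assumes "\<And>n. c + of_nat n \<noteq> 0"
  shows "fps_const c * same_wronskian_fps a b c + fps_X * fps_deriv (same_wronskian_fps a b c)
     = fps_const (a - b) * weight_fps a c b c"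
proof -
  define M where "M = kummer_fps a c"
  define N where "N = kummer_fps b c"
  define E :: "complex fps" where "E = fps_exp (-1)"
  have dE: "fps_deriv E = - E"
    by (simp add: E_def) (simp add: fps_eq_iff)
  have "fps_const c * same_wronskian_fps a b c + fps_X * fps_deriv (same_wronskian_fps a b c)
    = fps_const c * (E * (fps_deriv M * N - M * fps_deriv N))
      + E * ((fps_X * fps_deriv (fps_deriv M)) * N - M * (fps_X * fps_deriv (fps_deriv N))
      - fps_X * (fps_deriv M * N - M * fps_deriv N))"
    by (simp add: same_wronskian_fps_def M_def[symmetric] N_def[symmetric] E_def[symmetric] dE algebra_simps)
  also have "\<dots> = (fps_const a - fps_const b) * (E * (M * N))"
    unfolding M_def N_def kummer_fps_ode[OF assms] by (simp add: algebra_simps del: fps_const_sub)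
  finally show ?thesis by (simp add: weight_fps_def M_def N_def E_def)
qed

lemma powr_prim_weight_same:
  assumes "\<And>n. c + of_nat n \<noteq> 0"
  shows "fps_const (a - b) * powr_prim (c - 1) (weight_fps a c b c) = same_wronskian_fps a b c"
proof (rule fps_ext)
  fix n
  have "(c + of_nat n) * fps_nth (same_wronskian_fps a b c) n = (a - b) * fps_nth (weight_fps a c b c) n"
    using arg_cong[OF same_wronskian_fps_ode[OF assms, of a b], of "\<lambda>F. fps_nth F n"]
    by (cases n) (auto simp: algebra_simps)
  then show "fps_nth (fps_const (a - b) * powr_prim (c - 1) (weight_fps a c b c)) n = fps_nth (same_wronskian_fps a b c) n"
    using assms[of n] by (simp add: field_simps)
qed

lemma cross_wronskian_fps_deriv:
  assumes "\<alpha> \<notin> \<int>"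
  shows "fps_deriv (cross_wronskian_fps a b \<alpha>) = fps_const (a - b) * weight_fps a (1 + \<alpha>) (b - \<alpha>) (1 - \<alpha>)"
proof -
  define M where "M = kummer_fps a (1 + \<alpha>)"
  define N where "N = kummer_fps (b - \<alpha>) (1 - \<alpha>)"
  define E :: "complex fps" where "E = fps_exp (-1)"
  define A where "A = fps_const \<alpha>"
  have dE: "fps_deriv E = - E"
    by (simp add: E_def) (simp add: fps_eq_iff)
  have M2: "fps_X * fps_deriv (fps_deriv M) = fps_const a * M - (1 + A - fps_X) * fps_deriv M"
    using kummer_fps_ode[OF not_Int_add_of_nat(1)[OF assms], of a]
    by (simp add: M_def A_def fps_const_add[symmetric] del: fps_const_add)
  have N2: "fps_X * fps_deriv (fps_deriv N) = (fps_const b - A) * N - (1 - A - fps_X) * fps_deriv N"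
    using kummer_fps_ode[OF not_Int_add_of_nat(2)[OF assms], of "b - \<alpha>"]
    by (simp add: N_def A_def fps_const_sub[symmetric] del: fps_const_sub)
  have "fps_deriv (cross_wronskian_fps a b \<alpha>)
    = E * ((fps_X * fps_deriv (fps_deriv M)) * N - M * (fps_X * fps_deriv (fps_deriv N))
      - fps_X * (fps_deriv M * N - M * fps_deriv N) - A * (M * N)
      + (fps_deriv M * N - M * fps_deriv N) + A * (fps_deriv M * N + M * fps_deriv N))"
    by (simp add: cross_wronskian_fps_def Let_def M_def[symmetric] N_def[symmetric] E_def[symmetric] A_def[symmetric] dE algebra_simps)
       (simp add: A_def)
  also have "\<dots> = (fps_const a - fps_const b) * (E * (M * N))"
    unfolding M2 N2 by (simp add: algebra_simps del: fps_const_sub)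
  finally show ?thesis by (simp add: weight_fps_def M_def N_def E_def)
qed

lemma cross_wronskian_fps_nth_0 [simp]: "fps_nth (cross_wronskian_fps a b \<alpha>) 0 = \<alpha>"
  by (simp add: cross_wronskian_fps_def Let_def)

text \<open>
  Division by \<open>z\<close> is possible because the constant term \<open>\<alpha>\<close> is removed; it is the source of the
  closed form of the integral.
\<close>
lemma powr_prim_weight_cross:
  assumes "\<alpha> \<notin> \<int>"
  shows "fps_const (a - b) * (fps_X * powr_prim 0 (weight_fps a (1 + \<alpha>) (b - \<alpha>) (1 - \<alpha>)))
    = cross_wronskian_fps a b \<alpha> - fps_const \<alpha>"
proof (rule fps_ext)
  fix n
  have *: "of_nat (Suc n) * fps_nth (cross_wronskian_fps a b \<alpha>) (Suc n) = (a - b) * fps_nth (weight_fps a (1 + \<alpha>) (b - \<alpha>) (1 - \<alpha>)) n" for n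
    using arg_cong[OF cross_wronskian_fps_deriv[OF assms, of a b], of "\<lambda>F. fps_nth F n"] by (simp add: add_ac)
  show "fps_nth (fps_const (a - b) * (fps_X * powr_prim 0 (weight_fps a (1 + \<alpha>) (b - \<alpha>) (1 - \<alpha>)))) n
    = fps_nth (cross_wronskian_fps a b \<alpha> - fps_const \<alpha>) n"
  proof (cases n)
    case (Suc m)
    have "of_nat m + 1 \<noteq> (0 :: complex)" using of_nat_neq_0[of m, where ?'a = complex] by (simp add: add.commute)
    then show ?thesis using *[of m] Suc by (simp add: divide_simps) (simp add: algebra_simps)
  qed simp
qed

lemma kummer_wronskian_MN_eq:
  assumes "z > 0"
  shows "kummer_wronskian (1 + \<alpha>) (kummer_M a \<alpha>) (kummer_M' a \<alpha>) (kummer_N b \<alpha>) (kummer_N' b \<alpha>) z = eval_fps (cross_wronskian_fps a b \<alpha>) (of_real z)"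
  using assms
  by (simp add: kummer_wronskian_def cross_wronskian_fps_def Let_def eval_entire entire kummer_N_def kummer_N'_def kummer_M_def kummer_M'_def
      powr_add powr_minus divide_simps) (simp add: algebra_simps)

lemma kummer_wronskian_MN:
  assumes "\<alpha> \<notin> \<int>" "z > 0"
  shows "kummer_wronskian (1 + \<alpha>) (kummer_M a \<alpha>) (kummer_M' a \<alpha>) (kummer_N a \<alpha>) (kummer_N' a \<alpha>) z = \<alpha>"
proof -
  have "fps_deriv (cross_wronskian_fps a a \<alpha>) = 0" using cross_wronskian_fps_deriv[OF assms(1), of a a] by simp
  then have "cross_wronskian_fps a a \<alpha> = fps_const \<alpha>" by (simp add: fps_deriv_eq_0_iff)
  then show ?thesis using kummer_wronskian_MN_eq[OF assms(2)] by simp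
qed

text \<open>
  The coefficients are Wronskians of \<open>h\<close> with the Frobenius solutions, which are constant.
\<close>
lemma kummer_pair_span:
  assumes \<alpha>: "\<alpha> \<notin> \<int>" and h: "kummer_pair a (1 + \<alpha>) h h'"
  obtains s t where "\<And>z. z > 0 \<Longrightarrow> h z = s * kummer_M a \<alpha> z + t * kummer_N a \<alpha> z"
    "\<And>z. z > 0 \<Longrightarrow> h' z = s * kummer_M' a \<alpha> z + t * kummer_N' a \<alpha> z"
proof -
  define k1 where "k1 = kummer_wronskian (1 + \<alpha>) h h' (kummer_M a \<alpha>) (kummer_M' a \<alpha>) 1"
  define k2 where "k2 = kummer_wronskian (1 + \<alpha>) h h' (kummer_N a \<alpha>) (kummer_N' a \<alpha>) 1"
  have *: "h z = (k2 / \<alpha>) * kummer_M a \<alpha> z + (- k1 / \<alpha>) * kummer_N a \<alpha> z \<and> h' z = (k2 / \<alpha>) * kummer_M' a \<alpha> z + (- k1 / \<alpha>) * kummer_N' a \<alpha> z"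
    if z: "z > 0" for z
  proof -
    define p :: complex where "p = of_real z powr (1 + \<alpha>) * exp (- of_real z)"
    have k1: "k1 = p * (h' z * kummer_M a \<alpha> z - h z * kummer_M' a \<alpha> z)"
      unfolding k1_def kummer_wronskian_const[OF h kummer_pair_M[OF \<alpha>] zero_less_one z]
      by (simp add: kummer_wronskian_def p_def)
    have k2: "k2 = p * (h' z * kummer_N a \<alpha> z - h z * kummer_N' a \<alpha> z)"
      unfolding k2_def kummer_wronskian_const[OF h kummer_pair_N[OF \<alpha>] zero_less_one z]
      by (simp add: kummer_wronskian_def p_def)
    have w: "p * (kummer_M' a \<alpha> z * kummer_N a \<alpha> z - kummer_M a \<alpha> z * kummer_N' a \<alpha> z) = \<alpha>"
      using kummer_wronskian_MN[OF \<alpha> z, of a] by (simp add: kummer_wronskian_def p_def)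
    have "\<alpha> * h z = k2 * kummer_M a \<alpha> z - k1 * kummer_N a \<alpha> z"
      unfolding k1 k2 by (subst w[symmetric]) (simp add: algebra_simps)
    moreover have "\<alpha> * h' z = k2 * kummer_M' a \<alpha> z - k1 * kummer_N' a \<alpha> z"
      unfolding k1 k2 by (subst w[symmetric]) (simp add: algebra_simps)
    ultimately show ?thesis using not_Int_add_of_nat(5)[OF \<alpha>] by (simp add: divide_simps mult_ac)
  qed
  then show thesis using that by blast
qed

lemma kummer_basis_independent_at:
  assumes \<alpha>: "\<alpha> \<notin> \<int>" and z: "z > 0"
    and "s * kummer_M a \<alpha> z + t * kummer_N a \<alpha> z = s' * kummer_M a \<alpha> z + t' * kummer_N a \<alpha> z"
    and "s * kummer_M' a \<alpha> z + t * kummer_N' a \<alpha> z = s' * kummer_M' a \<alpha> z + t' * kummer_N' a \<alpha> z"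
  shows "s = s'" "t = t'"
proof -
  define p :: complex where "p = of_real z powr (1 + \<alpha>) * exp (- of_real z)"
  have w: "p * (kummer_M' a \<alpha> z * kummer_N a \<alpha> z - kummer_M a \<alpha> z * kummer_N' a \<alpha> z) = \<alpha>"
    using kummer_wronskian_MN[OF \<alpha> z, of a] by (simp add: kummer_wronskian_def p_def)
  define M N M' N' where d: "M = kummer_M a \<alpha> z" "N = kummer_N a \<alpha> z" "M' = kummer_M' a \<alpha> z" "N' = kummer_N' a \<alpha> z"
  have e1: "(s - s') * M + (t - t') * N = 0" and e2: "(s - s') * M' + (t - t') * N' = 0"
    using assms(3,4) by (auto simp: d algebra_simps)
  have "\<alpha> * (s - s') = p * (M' * N - M * N') * (s - s')" using w by (simp add: d)
  also have "\<dots> = p * (N * ((s - s') * M' + (t - t') * N') - N' * ((s - s') * M + (t - t') * N))"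
    by (simp add: algebra_simps)
  finally have "\<alpha> * (s - s') = 0" unfolding e1 e2 by simp
  then show "s = s'" using not_Int_add_of_nat(5)[OF \<alpha>] by simp
  have "\<alpha> * (t - t') = p * (M' * N - M * N') * (t - t')" using w by (simp add: d)
  also have "\<dots> = p * (M' * ((s - s') * M + (t - t') * N) - M * ((s - s') * M' + (t - t') * N'))"
    by (simp add: algebra_simps)
  finally have "\<alpha> * (t - t') = 0" unfolding e1 e2 by simp
  then show "t = t'" using not_Int_add_of_nat(5)[OF \<alpha>] by simp
qed

lemma kummer_pair_deriv_unique:
  assumes f: "kummer_pair a c f f'" and g: "kummer_pair b d g g'" and eq: "\<And>z. z > 0 \<Longrightarrow> f z = g z" and z: "z > 0"
  shows "f' z = g' z"
proof -
  have "(g has_vector_derivative f' z) (at z)"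
    by (rule has_vector_derivative_transform_within_open[OF kummer_pairD(1)[OF f z], of "{0<..}"])
      (use z eq in auto)
  then show ?thesis using kummer_pairD(1)[OF g z] vector_derivative_unique_at by blast
qed

lemma kummer_basis_independent:
  assumes \<alpha>: "\<alpha> \<notin> \<int>"
    and eq: "\<And>z. z > 0 \<Longrightarrow> s * kummer_M a \<alpha> z + t * kummer_N a \<alpha> z = s' * kummer_M a \<alpha> z + t' * kummer_N a \<alpha> z"
  shows "s = s'" "t = t'"
proof -
  have pair: "kummer_pair a (1 + \<alpha>) (\<lambda>z. s * kummer_M a \<alpha> z + t * kummer_N a \<alpha> z) (\<lambda>z. s * kummer_M' a \<alpha> z + t * kummer_N' a \<alpha> z)" for s t
    by (intro kummer_pair_lincomb kummer_pair_M kummer_pair_N \<alpha>)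
  have "s * kummer_M' a \<alpha> 1 + t * kummer_N' a \<alpha> 1 = s' * kummer_M' a \<alpha> 1 + t' * kummer_N' a \<alpha> 1"
    by (rule kummer_pair_deriv_unique[OF pair pair eq]) auto
  then show "s = s'" "t = t'"
    using kummer_basis_independent_at[OF \<alpha> zero_less_one eq[OF zero_less_one]] by auto
qed

section \<open>The Laplace integral\<close>

text \<open>
  The integrand and the value of the Laplace integral of \<open>t powr (p - 1) * (1 + t) powr q\<close>.  Only
  \<open>Re p > 0\<close> and \<open>Re q \<le> 0\<close> are considered: then \<open>(1 + t) powr q\<close> is bounded by 1, so that a
  Gamma integrand dominates the kernel.
\<close>
definition laplace_kernel :: "complex \<Rightarrow> complex \<Rightarrow> real \<Rightarrow> real \<Rightarrow> complex" where
  "laplace_kernel p q z t = of_real t powr (p - 1) * of_real (1 + t) powr q * exp (- (of_real z * of_real t))"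

definition laplace_J :: "complex \<Rightarrow> complex \<Rightarrow> real \<Rightarrow> complex" where
  "laplace_J p q z = (LINT t:{0<..}|lborel. laplace_kernel p q z t)"

lemma set_borel_measurable_Ioi:
  fixes f :: "real \<Rightarrow> 'a::real_normed_vector"
  assumes "continuous_on {0<..} f"
  shows "(\<lambda>t. indicator {0<..} t *\<^sub>R f t) \<in> borel_measurable lborel"
    "set_borel_measurable lborel {0<..} f"
  using borel_measurable_continuous_on_indicator[OF _ assms] by (auto simp: set_borel_measurable_def)

lemma continuous_laplace_kernel: "continuous_on {0<..} (laplace_kernel p q z)"
  unfolding laplace_kernel_def[abs_def] by (intro continuous_intros) (auto simp del: of_real_add)

lemma norm_laplace_kernel:
  assumes "t > 0"
  shows "norm (laplace_kernel p q z t) = t powr (Re p - 1) * (1 + t) powr Re q * exp (- (z * t))"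
  using assms unfolding laplace_kernel_def norm_mult
  by (subst (1 2) norm_powr_real_powr) (auto simp: norm_exp_eq_Re)

lemma Gamma_kernel_lborel:
  assumes "Re p > 0"
  shows "z > 0 \<Longrightarrow> set_integrable lborel {0<..} (laplace_kernel p 0 z)"
    and "laplace_J p 0 1 = Gamma p"
proof -
  have eq: "laplace_kernel p 0 z t = of_real t powr (p - 1) / of_real (exp (z * t))" if "t \<in> {0<..}" for t z
    using that by (simp add: laplace_kernel_def exp_minus divide_inverse of_real_exp del: of_real_add)
  show int: "set_integrable lborel {0<..} (laplace_kernel p 0 z)" if z: "z > 0" for z
  proof -
    have "laplace_kernel p 0 z absolutely_integrable_on {0<..}"
      using absolutely_integrable_Gamma_integral[OF assms z]
      by (subst set_integrable_cong[OF refl refl eq]) auto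
    then show ?thesis
      unfolding set_integrable_def
      by (subst (asm) integrable_completion) (rule set_borel_measurable_Ioi continuous_laplace_kernel)+
  qed
  have "(LINT t:{0<..}|lborel. laplace_kernel p 0 1 t) = integral {0<..} (laplace_kernel p 0 1)"
    by (rule set_borel_integral_eq_integral(2)[OF int]) simp
  also have "\<dots> = integral {0<..} (\<lambda>t. of_real t powr (p - 1) / of_real (exp t))"
    by (intro integral_cong) (simp add: eq)
  also have "\<dots> = Gamma p" using Gamma_integral_complex'[OF assms] by (rule integral_unique)
  finally show "laplace_J p 0 1 = Gamma p" by (simp add: laplace_J_def)
qed

lemma laplace_kernel_integrable:
  assumes "Re p > 0" "Re q \<le> 0" "z > 0"
  shows "set_integrable lborel {0<..} (laplace_kernel p q z)"
proof (rule set_integrable_bound[OF Gamma_kernel_lborel(1)[OF assms(1,3)]])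
  show "set_borel_measurable lborel {0<..} (laplace_kernel p q z)"
    by (rule set_borel_measurable_Ioi continuous_laplace_kernel)+
  show "AE t in lborel. t \<in> {0<..} \<longrightarrow> norm (laplace_kernel p q z t) \<le> norm (laplace_kernel p 0 z t)"
  proof (intro AE_I2 impI)
    fix t :: real assume "t \<in> {0<..}"
    then show "norm (laplace_kernel p q z t) \<le> norm (laplace_kernel p 0 z t)"
      using assms powr_mono[of "Re q" 0 "1 + t"] by (simp add: norm_laplace_kernel mult_right_le_one_le)
  qed
qed

lemma laplace_J_norm_le:
  assumes "Re p > 0" "Re q \<le> 0" "z \<ge> 1"
  shows "norm (laplace_J p q z) \<le> norm (Gamma (of_real (Re p) :: complex))"
proof -
  let ?k = "laplace_kernel (of_real (Re p)) 0 1"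
  have keq: "?k t = of_real (norm (?k t))" if "t \<in> {0<..}" for t
  proof -
    have "complex_of_real t powr (of_real (Re p) - 1) = of_real (t powr (Re p - 1))"
      using powr_of_real[of t "Re p - 1"] that by simp
    then have "?k t = of_real (t powr (Re p - 1) * exp (- t))"
      using that by (simp add: laplace_kernel_def of_real_exp del: of_real_add)
    moreover have "norm (?k t) = t powr (Re p - 1) * exp (- t)"
      using that by (simp add: norm_laplace_kernel)
    ultimately show ?thesis by simp
  qed
  have int: "set_integrable lborel {0<..} ?k" using assms by (intro Gamma_kernel_lborel) auto
  have "norm (laplace_J p q z) \<le> (LINT t:{0<..}|lborel. norm (laplace_kernel p q z t))"
    unfolding laplace_J_def using assms by (intro set_integral_norm_bound laplace_kernel_integrable) auto
  also have "\<dots> \<le> (LINT t:{0<..}|lborel. norm (?k t))"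
  proof (rule set_integral_mono)
    show "set_integrable lborel {0<..} (\<lambda>t. norm (laplace_kernel p q z t))"
      using assms by (intro set_integrable_norm laplace_kernel_integrable) auto
    show "set_integrable lborel {0<..} (\<lambda>t. norm (?k t))" by (rule set_integrable_norm[OF int])
    fix t :: real assume t: "t \<in> {0<..}"
    have "t powr (Re p - 1) * (1 + t) powr Re q * exp (- (z * t)) \<le> t powr (Re p - 1) * (1 + t) powr 0 * exp (- (1 * t))"
    proof -
      have "1 * t \<le> z * t" using t assms by (intro mult_right_mono) auto
      moreover have "(1 + t) powr Re q \<le> (1 + t) powr 0" using t assms by (intro powr_mono) auto
      ultimately show ?thesis by (intro mult_mono[OF mult_left_mono]) simp_all
    qed
    then show "norm (laplace_kernel p q z t) \<le> norm (?k t)"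
      using t by (simp add: norm_laplace_kernel)
  qed
  also have "\<dots> = norm (of_real (LINT t:{0<..}|lborel. norm (?k t)) :: complex)"
    by (simp add: set_lebesgue_integral_def)
  also have "of_real (LINT t:{0<..}|lborel. norm (?k t)) = (LINT t:{0<..}|lborel. ?k t)"
    unfolding set_integral_complex_of_real[symmetric]
    by (rule set_lebesgue_integral_cong) (use keq in auto)
  also have "\<dots> = Gamma (of_real (Re p))"
    using Gamma_kernel_lborel(2)[of "of_real (Re p)"] assms by (simp add: laplace_J_def)
  finally show ?thesis .
qed

lemma laplace_kernel_shift:
  assumes "t > 0"
  shows "laplace_kernel (p + 1) q z t = of_real t * laplace_kernel p q z t"
    "laplace_kernel (p + 2) q z t = of_real t ^ 2 * laplace_kernel p q z t"
proof -
  have *: "laplace_kernel (p + 1) q z t = of_real t * laplace_kernel p q z t" for p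
    using assms powr_add[of "of_real t :: complex" "p - 1" 1] by (simp add: laplace_kernel_def mult_ac)
  show "laplace_kernel (p + 1) q z t = of_real t * laplace_kernel p q z t" by (rule *)
  have "laplace_kernel (p + 2) q z t = laplace_kernel ((p + 1) + 1) q z t" by (simp add: add.assoc)
  then show "laplace_kernel (p + 2) q z t = of_real t ^ 2 * laplace_kernel p q z t"
    unfolding * by (simp add: power2_eq_square)
qed

lemma laplace_J_has_vector_derivative:
  assumes p: "Re p > 0" and q: "Re q \<le> 0" and z: "z > 0"
  shows "(laplace_J p q has_vector_derivative - laplace_J (p + 1) q z) (at z)"
proof -
  define C where "C = (LINT t:{0<..}|lborel. norm (laplace_kernel (p + 2) q (z / 2) t))"
  have Cint: "set_integrable lborel {0<..} (\<lambda>t. norm (laplace_kernel (p + 2) q (z / 2) t))"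
    using assms by (intro set_integrable_norm laplace_kernel_integrable) auto
  have bound: "norm (laplace_J p q y - laplace_J p q z - (y - z) *\<^sub>R (- laplace_J (p + 1) q z)) \<le> \<bar>y - z\<bar>\<^sup>2 * C"
    if y: "\<bar>y - z\<bar> \<le> z / 2" for y
  proof -
    define h where "h = y - z"
    have yz: "y = z + h" "y > 0" "\<bar>h\<bar> \<le> z / 2" using y z by (auto simp: h_def abs_if split: if_splits)
    define r where "r = (\<lambda>t. laplace_kernel p q y t - laplace_kernel p q z t + of_real h * laplace_kernel (p + 1) q z t)"
    have int: "set_integrable lborel {0<..} (laplace_kernel p q y)" "set_integrable lborel {0<..} (laplace_kernel p q z)"
        "set_integrable lborel {0<..} (laplace_kernel (p + 1) q z)"
      using assms yz by (auto intro!: laplace_kernel_integrable)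
    have rint: "set_integrable lborel {0<..} r"
      unfolding r_def by (intro set_integral_add(1) set_integral_diff(1) set_integrable_mult_right impI int)
    have "laplace_J p q y - laplace_J p q z - h *\<^sub>R (- laplace_J (p + 1) q z) = (LINT t:{0<..}|lborel. r t)"
      unfolding laplace_J_def r_def
      by (subst set_integral_add(2) set_integral_diff(2);
          (intro set_integral_add(1) set_integral_diff(1) set_integrable_mult_right impI int)?)+
         (simp add: scaleR_conv_of_real)
    also have "norm \<dots> \<le> (LINT t:{0<..}|lborel. norm (r t))"
      by (intro set_integral_norm_bound rint)
    also have "\<dots> \<le> (LINT t:{0<..}|lborel. \<bar>h\<bar>\<^sup>2 * norm (laplace_kernel (p + 2) q (z / 2) t))"
    proof (intro set_integral_mono set_integrable_norm[OF rint] set_integrable_mult_right Cint)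
      fix t :: real assume "t \<in> {0<..}"
      then have t: "t > 0" by simp
      have e1: "norm (exp (complex_of_real (- (h * t))) - 1 - of_real (- (h * t))) \<le> exp \<bar>h * t\<bar> * \<bar>h * t\<bar>\<^sup>2"
        using Taylor_exp[of "complex_of_real (- (h * t))" 1]
        by (simp add: power2_eq_square diff_diff_eq del: of_real_mult of_real_minus)
      have "laplace_kernel p q y t = laplace_kernel p q z t * exp (complex_of_real (- (h * t)))"
        by (simp add: laplace_kernel_def yz(1) ring_distribs exp_add[symmetric] mult.assoc)
      then have "r t = laplace_kernel p q z t * (exp (complex_of_real (- (h * t))) - 1 - of_real (- (h * t)))"
        unfolding r_def laplace_kernel_shift[OF t] by (simp add: algebra_simps)
      then have "norm (r t) \<le> norm (laplace_kernel p q z t) * (exp \<bar>h * t\<bar> * \<bar>h * t\<bar>\<^sup>2)"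
        using e1 by (simp add: norm_mult mult_left_mono del: of_real_minus of_real_mult)
      also have "\<dots> = (t powr (Re p - 1) * (1 + t) powr Re q * \<bar>h * t\<bar>\<^sup>2) * (exp (- (z * t)) * exp \<bar>h * t\<bar>)"
        by (simp add: norm_laplace_kernel[OF t] mult_ac)
      also have "\<dots> \<le> (t powr (Re p - 1) * (1 + t) powr Re q * \<bar>h * t\<bar>\<^sup>2) * exp (- (z / 2 * t))"
      proof (intro mult_left_mono)
        have "\<bar>h * t\<bar> \<le> z / 2 * t" using yz t by (simp add: abs_mult mult_right_mono)
        then show "exp (- (z * t)) * exp \<bar>h * t\<bar> \<le> exp (- (z / 2 * t))"
          by (simp add: exp_add[symmetric])
      qed simp
      also have "\<dots> = \<bar>h\<bar>\<^sup>2 * norm (laplace_kernel (p + 2) q (z / 2) t)"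
        unfolding laplace_kernel_shift[OF t] norm_mult norm_laplace_kernel[OF t]
        using t by (simp add: norm_power power_mult_distrib mult_ac)
      finally show "norm (r t) \<le> \<bar>h\<bar>\<^sup>2 * norm (laplace_kernel (p + 2) q (z / 2) t)" .
    qed
    finally show ?thesis by (simp add: h_def C_def)
  qed
  show ?thesis
    unfolding has_vector_derivative_def
  proof (rule has_derivativeI_sandwich[of "z / 2"])
    show "((\<lambda>y. \<bar>y - z\<bar> * C) \<longlongrightarrow> 0) (at z)"
      by (auto intro!: tendsto_eq_intros)
    show "norm (laplace_J p q y - laplace_J p q z - (y - z) *\<^sub>R - laplace_J (p + 1) q z) / norm (y - z) \<le> \<bar>y - z\<bar> * C"
      if "y \<in> UNIV" "y \<noteq> z" "dist y z < z / 2" for y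
      using bound[of y] that by (simp add: dist_real_def divide_le_eq power2_eq_square mult_ac)
    show "bounded_linear (\<lambda>x. x *\<^sub>R - laplace_J (p + 1) q z)"
      by (rule bounded_linear_scaleR_left)
  qed (use z in auto)
qed

text \<open>
  Integration of the derivative of \<open>t powr p * (1 + t) powr (q + 1) * exp (- z * t)\<close>.
\<close>
lemma laplace_J_recurrence:
  assumes p: "Re p > 0" and q: "Re q \<le> 0" and z: "z > 0"
  shows "of_real z * laplace_J (p + 2) q z = p * laplace_J p q z + (p + q + 1 - of_real z) * laplace_J (p + 1) q z"
proof -
  define F where "F = (\<lambda>t::real. of_real t powr p * of_real (1 + t) powr (q + 1) * exp (- (of_real z * of_real t)) :: complex)"
  define f where "f = (\<lambda>t. (p * laplace_kernel p q z t + (p + q + 1 - of_real z) * laplace_kernel (p + 1) q z t)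
      - of_real z * laplace_kernel (p + 2) q z t)"
  have int: "set_integrable lborel {0<..} (laplace_kernel p q z)" "set_integrable lborel {0<..} (laplace_kernel (p + 1) q z)"
        "set_integrable lborel {0<..} (laplace_kernel (p + 2) q z)"
    using assms by (auto intro!: laplace_kernel_integrable)
  have fint: "set_integrable lborel {0<..} f"
    unfolding f_def by (intro set_integral_diff(1) set_integral_add(1) set_integrable_mult_right impI int)
  have fcont: "continuous_on {0<..} f"
    unfolding f_def by (intro continuous_intros continuous_laplace_kernel)
  have nF: "norm (F t) = t powr Re p * (1 + t) powr (Re q + 1) * exp (- (z * t))" if "t > 0" for t
    using that unfolding F_def norm_mult
    by (subst (1 2) norm_powr_real_powr) (auto simp: norm_exp_eq_Re)
  have "(LBINT t=ereal 0..\<infinity>. f t) = 0 - 0"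
  proof (rule interval_integral_FTC_integrable)
    fix t assume "ereal 0 < ereal t"
    then have t: "t > 0" by simp
    show "isCont f t" using fcont t by (simp add: continuous_on_eq_continuous_at)
    have a: "((\<lambda>t. of_real t powr p :: complex) has_vector_derivative p * of_real t powr p / of_real t) (at t)"
      by (rule powr_has_vector_derivative[OF t])
    have b: "((\<lambda>t. of_real (1 + t) powr (q + 1) :: complex) has_vector_derivative (q + 1) * of_real (1 + t) powr q) (at t)"
    proof -
      have "((\<lambda>w::complex. (1 + w) powr (q + 1)) has_field_derivative (q + 1) * (1 + of_real t) powr q) (at (of_real t))"
        using t by (auto intro!: derivative_eq_intros simp: complex_nonpos_Reals_iff)
      from has_vector_derivative_real_field[OF this] show ?thesis by simp
    qed
    have c: "((\<lambda>t. exp (- (of_real z * of_real t)) :: complex) has_vector_derivative - of_real z * exp (- (of_real z * of_real t))) (at t)"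
      by (rule has_vector_derivative_real_field) (auto intro!: derivative_eq_intros)
    have e1: "of_real t powr p = (of_real t powr (p - 1) * of_real t :: complex)"
      using t powr_add[of "of_real t :: complex" "p - 1" 1] by simp
    have e2: "of_real (1 + t) powr (q + 1) = (of_real (1 + t) powr q * of_real (1 + t) :: complex)"
      using t powr_add[of "of_real (1 + t) :: complex" q 1] by (simp del: of_real_add)
    have "(F has_vector_derivative
        of_real t powr p * of_real (1 + t) powr (q + 1) * (- of_real z * exp (- (of_real z * of_real t)))
       + (of_real t powr p * ((q + 1) * of_real (1 + t) powr q) + p * of_real t powr p / of_real t * of_real (1 + t) powr (q + 1))
         * exp (- (of_real z * of_real t))) (at t)"
      unfolding F_def by (intro has_vector_derivative_mult a b c)
    also have "of_real t powr p * of_real (1 + t) powr (q + 1) * (- of_real z * exp (- (of_real z * of_real t)))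
       + (of_real t powr p * ((q + 1) * of_real (1 + t) powr q) + p * of_real t powr p / of_real t * of_real (1 + t) powr (q + 1))
         * exp (- (of_real z * of_real t)) = f t"
      unfolding f_def laplace_kernel_shift[OF t] unfolding laplace_kernel_def e1 e2
      using t by (simp add: algebra_simps power2_eq_square)
    finally show "(F has_vector_derivative f t) (at t)" .
  next
    have "((\<lambda>t. t powr Re p * (1 + t) powr (Re q + 1) * exp (- (z * t))) \<longlongrightarrow> 0 powr Re p * (1 + 0) powr (Re q + 1) * exp (- (z * 0))) (at_right 0)"
      by (intro tendsto_mult tendsto_powr' tendsto_exp tendsto_minus tendsto_add tendsto_const tendsto_ident_at)
        (use p in \<open>auto simp: eventually_at_filter\<close>)
    moreover have "\<forall>\<^sub>F t in at_right 0. t powr Re p * (1 + t) powr (Re q + 1) * exp (- (z * t)) = norm (F t)"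
      by (auto simp: nF eventually_at_filter)
    ultimately have "((\<lambda>t. norm (F t)) \<longlongrightarrow> 0) (at_right 0)"
      by (simp add: Lim_transform_eventually)
    then have "(F \<longlongrightarrow> 0) (at_right 0)" by (rule tendsto_norm_zero_cancel)
    then show "((F \<circ> real_of_ereal) \<longlongrightarrow> 0) (at_right (ereal 0))"
      by (simp add: ereal_tendsto_simps1)
    have "((\<lambda>t. t powr Re p * (1 + t) powr (Re q + 1) * exp (- (z * t))) \<longlongrightarrow> 0) at_top"
      using z by real_asymp
    moreover have "\<forall>\<^sub>F t in at_top. t powr Re p * (1 + t) powr (Re q + 1) * exp (- (z * t)) = norm (F t)"
      using eventually_gt_at_top[of 0] by eventually_elim (simp add: nF)
    ultimately have "((\<lambda>t. norm (F t)) \<longlongrightarrow> 0) at_top"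
      by (rule Lim_transform_eventually)
    then have "(F \<longlongrightarrow> 0) at_top" by (rule tendsto_norm_zero_cancel)
    then show "((F \<circ> real_of_ereal) \<longlongrightarrow> 0) (at_left \<infinity>)"
      by (simp add: ereal_tendsto_simps1)
  qed (use fint in auto)
  then have "(LINT t:{0<..}|lborel. f t) = 0"
    by (simp add: interval_lebesgue_integral_def)
  also have "(LINT t:{0<..}|lborel. f t) = (p * laplace_J p q z + (p + q + 1 - of_real z) * laplace_J (p + 1) q z) - of_real z * laplace_J (p + 2) q z"
    unfolding laplace_J_def f_def
    by (subst set_integral_diff(2) set_integral_add(2); (intro set_integral_diff(1) set_integral_add(1) set_integrable_mult_right impI int)?)+
       simp
  finally show ?thesis by (simp add: algebra_simps)
qed

lemma kummer_pair_laplace_J: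
  assumes "Re a > 0" "Re \<alpha> \<le> Re a"
  shows "kummer_pair a (1 + \<alpha>) (laplace_J a (\<alpha> - a)) (\<lambda>z. - laplace_J (a + 1) (\<alpha> - a) z)"
  unfolding kummer_pair_def
proof (intro allI impI conjI)
  fix z :: real assume z: "z > 0"
  show "(laplace_J a (\<alpha> - a) has_vector_derivative - laplace_J (a + 1) (\<alpha> - a) z) (at z)"
    using assms z by (intro laplace_J_has_vector_derivative) auto
  have "((\<lambda>z. - laplace_J (a + 1) (\<alpha> - a) z) has_vector_derivative - (- laplace_J ((a + 1) + 1) (\<alpha> - a) z)) (at z)"
    using assms z by (intro has_vector_derivative_minus laplace_J_has_vector_derivative) auto
  moreover have "laplace_J ((a + 1) + 1) (\<alpha> - a) z
     = (a * laplace_J a (\<alpha> - a) z - (1 + \<alpha> - of_real z) * - laplace_J (a + 1) (\<alpha> - a) z) / of_real z"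
    using laplace_J_recurrence[of a "\<alpha> - a" z] assms z by (simp add: field_simps add.assoc)
  ultimately show "((\<lambda>z. - laplace_J (a + 1) (\<alpha> - a) z) has_vector_derivative
      (a * laplace_J a (\<alpha> - a) z - (1 + \<alpha> - of_real z) * - laplace_J (a + 1) (\<alpha> - a) z) / of_real z) (at z)"
    by simp
qed

lemma laplace_J_scaled:
  assumes z: "z > 0"
  shows "of_real z powr p * laplace_J p q z
    = (LINT s:{0<..}|lborel. of_real s powr (p - 1) * of_real (1 + s / z) powr q * exp (- of_real s))"
proof -
  have "laplace_J p q z = (1 / z) *\<^sub>R (\<integral>s. indicator {0<..} (s / z) *\<^sub>R laplace_kernel p q z (s / z) \<partial>lborel)"
    unfolding laplace_J_def set_lebesgue_integral_def
    using lborel_integral_real_affine[of "1 / z" "\<lambda>t. indicator {0<..} t *\<^sub>R laplace_kernel p q z t" 0] z by simp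
  also have "\<dots> = (\<integral>s. (1 / z) *\<^sub>R (indicator {0<..} (s / z) *\<^sub>R laplace_kernel p q z (s / z)) \<partial>lborel)"
    by (simp only: integral_scaleR_right)
  finally have "of_real z powr p * laplace_J p q z =
     (\<integral>s. of_real z powr p * ((1 / z) *\<^sub>R (indicator {0<..} (s / z) *\<^sub>R laplace_kernel p q z (s / z))) \<partial>lborel)"
    by (simp only: integral_mult_right_zero)
  also have "\<dots> = (\<integral>s. indicator {0<..} s *\<^sub>R (of_real s powr (p - 1) * of_real (1 + s / z) powr q * exp (- of_real s)) \<partial>lborel)"
  proof (rule Bochner_Integration.integral_cong[OF refl])
    fix s :: real
    show "of_real z powr p * ((1 / z) *\<^sub>R (indicator {0<..} (s / z) *\<^sub>R laplace_kernel p q z (s / z)))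
      = indicator {0<..} s *\<^sub>R (of_real s powr (p - 1) * of_real (1 + s / z) powr q * exp (- of_real s))"
    proof (cases "s > 0")
      case True
      have "of_real z powr p = (of_real z powr (p - 1) * of_real z :: complex)"
        using z powr_add[of "of_real z :: complex" "p - 1" 1] by simp
      moreover have "of_real (s / z) powr (p - 1) * of_real z powr (p - 1) = (of_real s powr (p - 1) :: complex)"
        using z True powr_times_real[of "complex_of_real (s / z)" "of_real z" "p - 1"] by simp
      ultimately show ?thesis
        using z True by (simp add: laplace_kernel_def scaleR_conv_of_real field_simps)
    qed (use z in \<open>auto simp: zero_less_divide_iff indicator_def\<close>)
  qed
  finally show ?thesis by (simp add: set_lebesgue_integral_def)
qed

lemma laplace_J_at_top:
  assumes p: "Re p > 0" and q: "Re q \<le> 0"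
  shows "((\<lambda>z. of_real z powr p * laplace_J p q z) \<longlongrightarrow> Gamma p) at_top"
proof -
  let ?k = "\<lambda>z s::real. of_real s powr (p - 1) * of_real (1 + s / z) powr q * exp (- of_real s) :: complex"
  have int: "set_integrable lborel {0<..} (laplace_kernel p 0 1)" using Gamma_kernel_lborel(1)[OF p] by simp
  define k where "k = (\<lambda>z. if z > 0 then ?k z else laplace_kernel p 0 1)"
  have "((\<lambda>z. \<integral>s. indicator {0<..} s *\<^sub>R k z s \<partial>lborel) \<longlongrightarrow> (\<integral>s. indicator {0<..} s *\<^sub>R laplace_kernel p 0 1 s \<partial>lborel)) at_top"
  proof (rule integral_dominated_convergence_at_top)
    show "(\<lambda>s. indicator {0<..} s *\<^sub>R laplace_kernel p 0 1 s) \<in> borel_measurable lborel"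
      by (rule set_borel_measurable_Ioi continuous_laplace_kernel)+
    show "(\<lambda>s. indicator {0<..} s *\<^sub>R k z s) \<in> borel_measurable lborel" for z
    proof (cases "z > 0")
      case True
      have "1 + x / z \<noteq> 0" if "x > 0" for x
        using divide_pos_pos[OF that True] by linarith
      then have "continuous_on {0<..} (?k z)"
        using True by (intro continuous_intros) (auto simp: add_pos_pos less_imp_le simp del: of_real_add of_real_divide)
      then show ?thesis using True by (simp add: k_def set_borel_measurable_Ioi)
    qed (use set_borel_measurable_Ioi(1)[OF continuous_laplace_kernel] in \<open>simp add: k_def\<close>)
    show "integrable lborel (\<lambda>s. norm (indicator {0<..} s *\<^sub>R laplace_kernel p 0 1 s))"
      using int by (intro integrable_norm) (simp add: set_integrable_def)
    show "AE s in lborel. ((\<lambda>z. indicator {0<..} s *\<^sub>R k z s) \<longlongrightarrow> indicator {0<..} s *\<^sub>R laplace_kernel p 0 1 s) at_top"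
    proof (rule AE_I2)
      fix s :: real
      show "((\<lambda>z. indicator {0<..} s *\<^sub>R k z s) \<longlongrightarrow> indicator {0<..} s *\<^sub>R laplace_kernel p 0 1 s) at_top"
      proof (cases "s > 0")
        case True
        have "((\<lambda>z. 1 + s / z) \<longlongrightarrow> 1 + 0) at_top" by real_asymp
        then have *: "((\<lambda>z. complex_of_real (1 + s / z)) \<longlongrightarrow> of_real (1 + 0)) at_top"
          by (rule tendsto_of_real)
        then have "((\<lambda>z. ?k z s) \<longlongrightarrow> of_real s powr (p - 1) * of_real (1 + 0) powr q * exp (- of_real s)) at_top"
          by (intro tendsto_mult tendsto_const tendsto_powr_complex *) auto
        then have "((\<lambda>z. k z s) \<longlongrightarrow> of_real s powr (p - 1) * of_real (1 + 0) powr q * exp (- of_real s)) at_top"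
          by (rule Lim_transform_eventually) (auto intro!: eventually_mono[OF eventually_gt_at_top[of 0]] simp: k_def)
        then show ?thesis using True by (simp add: laplace_kernel_def del: of_real_add)
      qed simp
    qed
    show "\<forall>\<^sub>F z in at_top. AE s in lborel. norm (indicator {0<..} s *\<^sub>R k z s) \<le> norm (indicator {0<..} s *\<^sub>R laplace_kernel p 0 1 s)"
    proof (intro always_eventually allI AE_I2)
      fix z s :: real
      have "norm (?k z s) \<le> norm (laplace_kernel p 0 1 s)" if "s > 0" "z > 0"
      proof -
        have "norm (complex_of_real (1 + s / z) powr q) = (1 + s / z) powr Re q"
          using that by (subst norm_powr_real_powr) (auto simp: add_pos_pos less_imp_le)
        also have "\<dots> \<le> (1 + s / z) powr 0" using that q by (intro powr_mono) auto
        also have "\<dots> = 1" using that by (simp add: add_pos_pos order_less_imp_not_eq2)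
        finally show ?thesis using that
          by (auto simp: laplace_kernel_def norm_mult mult_right_le_one_le mult_right_mono
              simp del: of_real_add)
      qed
      then show "norm (indicator {0<..} s *\<^sub>R k z s) \<le> norm (indicator {0<..} s *\<^sub>R laplace_kernel p 0 1 s)"
        by (auto simp: k_def indicator_def)
    qed
  qed
  also have "(\<integral>s. indicator {0<..} s *\<^sub>R laplace_kernel p 0 1 s \<partial>lborel) = Gamma p"
    using Gamma_kernel_lborel(2)[OF p] by (simp add: laplace_J_def set_lebesgue_integral_def)
  finally show ?thesis
    by (rule Lim_transform_eventually)
      (auto intro!: eventually_mono[OF eventually_gt_at_top[of 0]] simp: k_def laplace_J_scaled set_lebesgue_integral_def)
qed

text \<open>The limit at 0 is only needed along one sequence, as it determines constants.\<close>
lemma laplace_J_at_0: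
  assumes p: "Re p > 0" and q: "Re q \<le> 0" and pq: "Re (p + q) > 0"
    and y: "\<And>n. y n > 0" "y \<longlonglongrightarrow> 0"
  shows "(\<lambda>n. of_real (y n) powr (p + q) * laplace_J p q (y n)) \<longlonglongrightarrow> Gamma (p + q)"
proof -
  let ?k = "\<lambda>z s::real. of_real s powr (p - 1) * of_real (z + s) powr q * exp (- of_real s) :: complex"
  have int: "set_integrable lborel {0<..} (laplace_kernel (p + q) 0 1)" using Gamma_kernel_lborel(1)[OF pq] by simp
  have "(\<lambda>n. \<integral>s. indicator {0<..} s *\<^sub>R ?k (y n) s \<partial>lborel) \<longlonglongrightarrow> (\<integral>s. indicator {0<..} s *\<^sub>R laplace_kernel (p + q) 0 1 s \<partial>lborel)"
  proof (rule integral_dominated_convergence)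
    show "(\<lambda>s. indicator {0<..} s *\<^sub>R laplace_kernel (p + q) 0 1 s) \<in> borel_measurable lborel"
      by (rule set_borel_measurable_Ioi continuous_laplace_kernel)+
    show "(\<lambda>s. indicator {0<..} s *\<^sub>R ?k (y n) s) \<in> borel_measurable lborel" for n
    proof -
      have "continuous_on {0<..} (?k (y n))"
        using y(1)[of n] by (intro continuous_intros) (auto simp: add_pos_pos less_imp_le simp del: of_real_add of_real_divide)
      then show ?thesis by (rule set_borel_measurable_Ioi)
    qed
    show "integrable lborel (\<lambda>s. norm (indicator {0<..} s *\<^sub>R laplace_kernel (p + q) 0 1 s))"
      using int by (intro integrable_norm) (simp add: set_integrable_def)
    have lk: "laplace_kernel (p + q) 0 1 s = of_real s powr (p - 1) * of_real s powr q * exp (- of_real s)" if "s > 0" for s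
    proof -
      have "p + q - 1 = p - 1 + q" by simp
      then show ?thesis using that by (simp only: laplace_kernel_def powr_add) (simp del: of_real_add)
    qed
    show "AE s in lborel. (\<lambda>n. indicator {0<..} s *\<^sub>R ?k (y n) s) \<longlonglongrightarrow> indicator {0<..} s *\<^sub>R laplace_kernel (p + q) 0 1 s"
    proof (rule AE_I2)
      fix s :: real
      show "(\<lambda>n. indicator {0<..} s *\<^sub>R ?k (y n) s) \<longlonglongrightarrow> indicator {0<..} s *\<^sub>R laplace_kernel (p + q) 0 1 s"
      proof (cases "s > 0")
        case True
        have "(\<lambda>n. complex_of_real (y n + s)) \<longlonglongrightarrow> of_real (0 + s)"
          by (intro tendsto_intros y)
        then have "(\<lambda>n. ?k (y n) s) \<longlonglongrightarrow> of_real s powr (p - 1) * of_real (0 + s) powr q * exp (- of_real s)"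
          using True by (intro tendsto_intros y) auto
        then show ?thesis using True lk by simp
      qed simp
    qed
    show "AE s in lborel. norm (indicator {0<..} s *\<^sub>R ?k (y n) s) \<le> norm (indicator {0<..} s *\<^sub>R laplace_kernel (p + q) 0 1 s)" for n
    proof (intro AE_I2)
      fix s :: real
      have "norm (?k (y n) s) \<le> norm (laplace_kernel (p + q) 0 1 s)" if s: "s > 0"
      proof -
        have "norm (complex_of_real (y n + s) powr q) = (y n + s) powr Re q"
          using s y(1)[of n] by (subst norm_powr_real_powr) auto
        also have "\<dots> \<le> s powr Re q" using s q y(1)[of n] by (intro powr_mono2') auto
        also have "\<dots> = norm (complex_of_real s powr q)"
          using s by (simp add: norm_powr_real_powr)
        finally show ?thesis unfolding lk[OF s] norm_mult
          by (intro mult_right_mono mult_left_mono) auto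
      qed
      then show "norm (indicator {0<..} s *\<^sub>R ?k (y n) s) \<le> norm (indicator {0<..} s *\<^sub>R laplace_kernel (p + q) 0 1 s)"
        by (auto simp: indicator_def)
    qed
  qed
  also have "(\<integral>s. indicator {0<..} s *\<^sub>R laplace_kernel (p + q) 0 1 s \<partial>lborel) = Gamma (p + q)"
    using Gamma_kernel_lborel(2)[OF pq] by (simp add: laplace_J_def set_lebesgue_integral_def)
  also have "(\<lambda>n. \<integral>s. indicator {0<..} s *\<^sub>R ?k (y n) s \<partial>lborel) = (\<lambda>n. of_real (y n) powr (p + q) * laplace_J p q (y n))"
  proof
    fix n
    let ?z = "y n"
    have z: "?z > 0" by (rule y)
    have "of_real ?z powr (p + q) * laplace_J p q ?z = of_real ?z powr q * (of_real ?z powr p * laplace_J p q ?z)"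
      by (simp add: powr_add mult_ac)
    also have "\<dots> = (\<integral>s. of_real ?z powr q * (indicator {0<..} s *\<^sub>R (of_real s powr (p - 1) * of_real (1 + s / ?z) powr q * exp (- of_real s))) \<partial>lborel)"
      unfolding laplace_J_scaled[OF z] set_lebesgue_integral_def
      by (simp only: integral_mult_right_zero)
    also have "\<dots> = (\<integral>s. indicator {0<..} s *\<^sub>R ?k ?z s \<partial>lborel)"
    proof (rule Bochner_Integration.integral_cong[OF refl])
      fix s :: real
      show "of_real ?z powr q * (indicator {0<..} s *\<^sub>R (of_real s powr (p - 1) * of_real (1 + s / ?z) powr q * exp (- of_real s))) = indicator {0<..} s *\<^sub>R ?k ?z s"
      proof (cases "s > 0")
        case True
        have "of_real ?z powr q * of_real (1 + s / ?z) powr q = (of_real (?z * (1 + s / ?z)) powr q :: complex)"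
          using z True unfolding of_real_mult by (subst powr_times_real) auto
        also have "?z * (1 + s / ?z) = ?z + s" using z by (simp add: field_simps)
        finally show ?thesis using True by (simp add: mult_ac)
      qed simp
    qed
    finally show "(\<integral>s. indicator {0<..} s *\<^sub>R ?k ?z s \<partial>lborel) = of_real ?z powr (p + q) * laplace_J p q ?z" ..
  qed
  finally show ?thesis .
qed

section \<open>Uniqueness at infinity\<close>

lemma derivative_limit_eq_0:
  fixes f :: "real \<Rightarrow> complex"
  assumes d: "\<And>z. z > 0 \<Longrightarrow> (f has_vector_derivative f' z) (at z)"
    and f: "(f \<longlongrightarrow> 0) at_top" and f': "(f' \<longlongrightarrow> k) at_top"
  shows "k = 0"
proof -
  have shift: "((\<lambda>x. f (x + 1)) \<longlongrightarrow> 0) at_top"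
    by (rule filterlim_compose[OF f]) real_asymp
  have "((\<lambda>x. f (x + 1) - f x) \<longlongrightarrow> k) at_top"
  proof (rule tendstoI)
    fix e :: real assume "e > 0"
    then have "\<forall>\<^sub>F x in at_top. dist (f' x) k < e / 2" using f' by (intro tendstoD) auto
    then obtain N where N: "\<And>x. x \<ge> N \<Longrightarrow> dist (f' x) k < e / 2"
      by (auto simp: eventually_at_top_linorder)
    show "\<forall>\<^sub>F x in at_top. dist (f (x + 1) - f x) k < e"
      using eventually_ge_at_top[of N] eventually_gt_at_top[of 0]
    proof eventually_elim
      case (elim x)
      have "(f' has_integral (f (x + 1) - f x)) {x..x + 1}"
        using elim d by (intro fundamental_theorem_of_calculus) (auto intro: has_vector_derivative_at_within)
      then have "((\<lambda>y. f' y - k) has_integral (f (x + 1) - f x - k)) (cbox x (x + 1))"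
        using has_integral_diff[OF _ has_integral_const_real[of k x "x + 1"], of f'] by simp
      then have "norm (f (x + 1) - f x - k) \<le> e / 2 * measure lborel (cbox x (x + 1))"
        by (rule has_integral_bound[rotated]) (use N elim \<open>e > 0\<close> in \<open>auto simp: dist_norm less_imp_le\<close>)
      then show ?case using \<open>e > 0\<close> by (simp add: dist_norm)
    qed
  qed
  moreover have "((\<lambda>x. f (x + 1) - f x) \<longlongrightarrow> 0 - 0) at_top" by (intro tendsto_diff shift f)
  ultimately show "k = 0" using tendsto_unique[OF trivial_limit_at_top_linorder] by force
qed

lemma powr_exp_tendsto_0: "((\<lambda>z. of_real z powr s * exp (- of_real z) :: complex) \<longlongrightarrow> 0) at_top"
proof (rule tendsto_norm_zero_cancel, rule Lim_transform_eventually)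
  show "((\<lambda>z::real. z powr Re s * exp (- z)) \<longlongrightarrow> 0) at_top" by real_asymp
  show "\<forall>\<^sub>F z in at_top. z powr Re s * exp (- z) = norm (of_real z powr s * exp (- of_real z) :: complex)"
    using eventually_gt_at_top[of 0] by eventually_elim (simp add: norm_mult norm_powr_real_powr)
qed

lemma inverse_of_real_at_top: "((\<lambda>z. inverse (of_real z) :: complex) \<longlongrightarrow> 0) at_top"
  using tendsto_of_real[OF tendsto_inverse_0_at_top[OF filterlim_ident], where ?'a = complex] by simp

text \<open>
  With \<open>w = z powr (1 + \<alpha>) * exp (- z)\<close>, the function \<open>w * h * U\<close> tends to 0, while its derivative tends
  to the constant Wronskian \<open>K\<close> of \<open>h\<close> and \<open>U\<close>.  Hence \<open>K = 0\<close>, \<open>h\<close> is a multiple of \<open>U\<close>, and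
  the multiple is 0.
\<close>
lemma kummer_unique_at_top:
  assumes \<alpha>: "\<alpha> \<notin> \<int>"
    and U: "kummer_pair a (1 + \<alpha>) U U'" "((\<lambda>z. of_real z powr a * U z) \<longlongrightarrow> 1) at_top"
      "((\<lambda>z. of_real z powr (a + 1) * U' z) \<longlongrightarrow> l) at_top"
    and h: "kummer_pair a (1 + \<alpha>) h h'" "((\<lambda>z. of_real z powr a * h z) \<longlongrightarrow> 0) at_top"
    and z: "z > 0"
  shows "h z = 0"
proof -
  define K where "K = kummer_wronskian (1 + \<alpha>) h h' U U' 1"
  define w where "w = (\<lambda>z. of_real z powr (1 + \<alpha>) * exp (- of_real z) :: complex)"
  define f where "f = (\<lambda>z. w z * (h z * U z))"
  define f' where "f' = (\<lambda>z. K + w z * (((1 + \<alpha>) / of_real z - 1) * (h z * U z) + 2 * (h z * U' z)))"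
  \<comment> \<open>the factors \<open>z powr a\<close> that normalize \<open>h\<close> and \<open>U\<close> are split off the weight\<close>
  define E where "E = (\<lambda>z. of_real z powr (1 + \<alpha> - 2 * a) * exp (- of_real z) :: complex)"
  have E: "(E \<longlongrightarrow> 0) at_top" unfolding E_def by (rule powr_exp_tendsto_0)
  have w: "w z = E z * of_real z powr a * of_real z powr a" if "z > 0" for z
  proof -
    have "1 + \<alpha> = (1 + \<alpha> - 2 * a) + (a + a)" by simp
    then have "(of_real z :: complex) powr (1 + \<alpha>) = of_real z powr (1 + \<alpha> - 2 * a) * (of_real z powr a * of_real z powr a)"
      by (metis powr_add)
    then show ?thesis by (simp add: w_def E_def)
  qed
  note inv = inverse_of_real_at_top
  have hU: "((\<lambda>z. w z * (h z * U z)) \<longlongrightarrow> 0) at_top"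
  proof (rule Lim_transform_eventually)
    show "((\<lambda>z. E z * (of_real z powr a * h z) * (of_real z powr a * U z)) \<longlongrightarrow> 0) at_top"
      using tendsto_mult[OF tendsto_mult[OF E h(2)] U(2)] by simp
    show "\<forall>\<^sub>F z in at_top. E z * (of_real z powr a * h z) * (of_real z powr a * U z) = w z * (h z * U z)"
      using eventually_gt_at_top[of 0] by eventually_elim (simp add: w mult_ac)
  qed
  have hU': "((\<lambda>z. w z * (h z * U' z)) \<longlongrightarrow> 0) at_top"
  proof (rule Lim_transform_eventually)
    show "((\<lambda>z. E z * (of_real z powr a * h z) * (of_real z powr (a + 1) * U' z) * inverse (of_real z)) \<longlongrightarrow> 0) at_top"
      using tendsto_mult[OF tendsto_mult[OF tendsto_mult[OF E h(2)] U(3)] inv] by simp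
    show "\<forall>\<^sub>F z in at_top. E z * (of_real z powr a * h z) * (of_real z powr (a + 1) * U' z) * inverse (of_real z) = w z * (h z * U' z)"
      using eventually_gt_at_top[of 0] by eventually_elim (simp add: w powr_add field_simps)
  qed
  have "K = 0"
  proof (rule derivative_limit_eq_0)
    show "(f has_vector_derivative f' z) (at z)" if z: "z > 0" for z
    proof -
      note D = kummer_pairD(1)[OF h(1) z] kummer_pairD(1)[OF U(1) z]
      have K: "K = w z * (h' z * U z - h z * U' z)"
        unfolding K_def kummer_wronskian_const[OF h(1) U(1) zero_less_one z]
        by (simp add: kummer_wronskian_def w_def)
      have "(w has_vector_derivative w z * ((1 + \<alpha>) / of_real z - 1)) (at z)"
        unfolding w_def by (rule kummer_weight_has_vector_derivative[OF z])
      then have "(f has_vector_derivative w z * (h z * U' z + h' z * U z) + w z * ((1 + \<alpha>) / of_real z - 1) * (h z * U z)) (at z)"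
        unfolding f_def by (intro has_vector_derivative_mult D)
      then show ?thesis unfolding f'_def K by (simp add: algebra_simps)
    qed
    show "(f \<longlongrightarrow> 0) at_top" unfolding f_def by (rule hU)
    have "((\<lambda>z. K + (((1 + \<alpha>) * inverse (of_real z) - 1) * (w z * (h z * U z)) + 2 * (w z * (h z * U' z)))) \<longlongrightarrow>
       K + (((1 + \<alpha>) * 0 - 1) * 0 + 2 * 0)) at_top"
      by (intro tendsto_intros inv hU hU')
    then show "(f' \<longlongrightarrow> K) at_top" by (simp add: f'_def divide_inverse algebra_simps)
  qed
  obtain s t where st: "\<And>z. z > 0 \<Longrightarrow> h z = s * kummer_M a \<alpha> z + t * kummer_N a \<alpha> z"
    "\<And>z. z > 0 \<Longrightarrow> h' z = s * kummer_M' a \<alpha> z + t * kummer_N' a \<alpha> z"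
    using kummer_pair_span[OF \<alpha> h(1)] by blast
  obtain u v where uv: "\<And>z. z > 0 \<Longrightarrow> U z = u * kummer_M a \<alpha> z + v * kummer_N a \<alpha> z"
    "\<And>z. z > 0 \<Longrightarrow> U' z = u * kummer_M' a \<alpha> z + v * kummer_N' a \<alpha> z"
    using kummer_pair_span[OF \<alpha> U(1)] by blast
  have "K = (s * v - t * u) * kummer_wronskian (1 + \<alpha>) (kummer_M a \<alpha>) (kummer_M' a \<alpha>) (kummer_N a \<alpha>) (kummer_N' a \<alpha>) 1"
    unfolding K_def kummer_wronskian_def by (simp add: st uv algebra_simps)
  also have "\<dots> = (s * v - t * u) * \<alpha>" by (simp add: kummer_wronskian_MN[OF \<alpha>])
  finally have sv: "s * v = t * u" using \<open>K = 0\<close> not_Int_add_of_nat(5)[OF \<alpha>] by simp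
  have "\<exists>\<kappa>. s = \<kappa> * u \<and> t = \<kappa> * v"
  proof (cases "u = 0")
    case False
    then show ?thesis using sv by (intro exI[of _ "s / u"]) (simp add: field_simps)
  next
    case True
    have "v \<noteq> 0"
    proof
      assume "v = 0"
      then have "((\<lambda>z. of_real z powr a * U z) \<longlongrightarrow> 0) at_top"
        using True by (intro tendsto_eventually eventually_mono[OF eventually_gt_at_top[of 0]]) (simp add: uv)
      then show False using U(2) tendsto_unique[OF trivial_limit_at_top_linorder] by fastforce
    qed
    then show ?thesis using sv True by (intro exI[of _ "t / v"]) (simp add: field_simps)
  qed
  then obtain \<kappa> where \<kappa>: "s = \<kappa> * u" "t = \<kappa> * v" by blast
  then have hU: "h z = \<kappa> * U z" if "z > 0" for z using that by (simp add: st uv algebra_simps)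
  have "((\<lambda>z. of_real z powr a * h z) \<longlongrightarrow> \<kappa> * 1) at_top"
    by (rule Lim_transform_eventually[OF tendsto_mult[OF tendsto_const U(2)]])
      (intro eventually_mono[OF eventually_gt_at_top[of 0]], simp add: hU)
  then have "\<kappa> = 0" using h(2) tendsto_unique[OF trivial_limit_at_top_linorder] by fastforce
  then show ?thesis using hU[OF z] by simp
qed

section \<open>The connection formula\<close>

text \<open>
  The right-hand side of the connection formula and its derivative.
\<close>
definition tricomi_T :: "complex \<Rightarrow> complex \<Rightarrow> real \<Rightarrow> complex" where
  "tricomi_T a \<alpha> z = Gamma (- \<alpha>) * rGamma (a - \<alpha>) * kummer_M a \<alpha> z + Gamma \<alpha> * rGamma a * kummer_N a \<alpha> z"
definition tricomi_T' :: "complex \<Rightarrow> complex \<Rightarrow> real \<Rightarrow> complex" where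
  "tricomi_T' a \<alpha> z = Gamma (- \<alpha>) * rGamma (a - \<alpha>) * kummer_M' a \<alpha> z + Gamma \<alpha> * rGamma a * kummer_N' a \<alpha> z"

lemma kummer_pair_T:
  assumes "\<alpha> \<notin> \<int>"
  shows "kummer_pair a (1 + \<alpha>) (tricomi_T a \<alpha>) (tricomi_T' a \<alpha>)"
  unfolding tricomi_T_def[abs_def] tricomi_T'_def[abs_def]
  by (intro kummer_pair_lincomb kummer_pair_M kummer_pair_N assms)

text \<open>
  The normalized Laplace integral and its derivative, which is again of this form with both
  parameters raised by 1.
\<close>
definition laplace_U :: "complex \<Rightarrow> complex \<Rightarrow> real \<Rightarrow> complex" where
  "laplace_U a \<alpha> z = rGamma a * laplace_J a (\<alpha> - a) z"
definition laplace_U' :: "complex \<Rightarrow> complex \<Rightarrow> real \<Rightarrow> complex" where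
  "laplace_U' a \<alpha> z = - (a * laplace_U (a + 1) (\<alpha> + 1) z)"

lemma laplace_U'_eq: "laplace_U' a \<alpha> z = rGamma a * - laplace_J (a + 1) (\<alpha> - a) z"
  by (simp add: laplace_U'_def laplace_U_def rGamma_plus1[of a, symmetric])

lemma kummer_pair_laplace_U:
  assumes "Re a > 0" "Re \<alpha> \<le> Re a"
  shows "kummer_pair a (1 + \<alpha>) (laplace_U a \<alpha>) (laplace_U' a \<alpha>)"
  using kummer_pair_lincomb[OF kummer_pair_laplace_J[OF assms] kummer_pair_laplace_J[OF assms], of "rGamma a" 0]
  by (simp add: laplace_U_def[abs_def] laplace_U'_eq[abs_def])

lemma rGamma_Gamma_Re_pos:
  assumes "Re a > 0"
  shows "rGamma a * Gamma a = 1" "rGamma a * Gamma (a + 1) = a"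
proof -
  have a: "a \<notin> \<int>\<^sub>\<le>\<^sub>0" using assms by (auto elim!: nonpos_Ints_cases)
  then show *: "rGamma a * Gamma a = 1" by (simp add: rGamma_inverse_Gamma Gamma_eq_zero_iff)
  have "Gamma (a + 1) = a * Gamma a" using a by (rule Gamma_plus1)
  then have "rGamma a * Gamma (a + 1) = a * (rGamma a * Gamma a)" by simp
  then show "rGamma a * Gamma (a + 1) = a" using * by simp
qed

lemma laplace_U_at_top:
  assumes "Re a > 0" "Re \<alpha> \<le> Re a"
  shows "((\<lambda>z. of_real z powr a * laplace_U a \<alpha> z) \<longlongrightarrow> 1) at_top"
    and "((\<lambda>z. of_real z powr (a + 1) * laplace_U' a \<alpha> z) \<longlongrightarrow> - a) at_top"
proof -
  have "((\<lambda>z. rGamma a * (of_real z powr a * laplace_J a (\<alpha> - a) z)) \<longlongrightarrow> rGamma a * Gamma a) at_top"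
    using assms by (intro tendsto_intros laplace_J_at_top) auto
  then show "((\<lambda>z. of_real z powr a * laplace_U a \<alpha> z) \<longlongrightarrow> 1) at_top"
    using rGamma_Gamma_Re_pos[OF assms(1)] by (simp add: laplace_U_def mult_ac)
  have "((\<lambda>z. - rGamma a * (of_real z powr (a + 1) * laplace_J (a + 1) (\<alpha> - a) z)) \<longlongrightarrow> - rGamma a * Gamma (a + 1)) at_top"
    using assms by (intro tendsto_intros laplace_J_at_top) auto
  then show "((\<lambda>z. of_real z powr (a + 1) * laplace_U' a \<alpha> z) \<longlongrightarrow> - a) at_top"
    using rGamma_Gamma_Re_pos[OF assms(1)] by (simp add: laplace_U'_eq mult_ac)
qed

lemma kummer_fps_deriv:
  assumes "\<And>n. c + of_nat n \<noteq> 0"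
  shows "fps_deriv (kummer_fps a c) = fps_const (a / c) * kummer_fps (a + 1) (c + 1)"
proof (rule fps_ext)
  fix n
  have p: "pochhammer c (Suc n) \<noteq> 0" using assms by (auto simp: pochhammer_eq_0_iff add_eq_0_iff2)
  then have "c \<noteq> 0" "pochhammer (c + 1) n \<noteq> 0" by (auto simp: pochhammer_rec)
  then show "fps_nth (fps_deriv (kummer_fps a c)) n = fps_nth (fps_const (a / c) * kummer_fps (a + 1) (c + 1)) n"
    by (simp add: kummer_fps_nth pochhammer_rec fact_Suc divide_simps del: of_nat_Suc)
qed

lemma kummer_M'_eq:
  assumes "\<alpha> \<notin> \<int>"
  shows "kummer_M' a \<alpha> z = a / (1 + \<alpha>) * kummer_M (a + 1) (\<alpha> + 1) z"
  unfolding kummer_M'_def kummer_M_def kummer_fps_deriv[OF not_Int_add_of_nat(1)[OF assms]]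
  by (subst eval_entire) (auto simp: add_ac)

lemma kummer_fps_lower_c:
  assumes "\<And>n. c + of_nat n \<noteq> 0"
  shows "fps_X * fps_deriv (kummer_fps b (c + 1)) + fps_const c * kummer_fps b (c + 1) = fps_const c * kummer_fps b c"
proof (rule fps_ext)
  fix n
  have p: "pochhammer c n \<noteq> 0" "pochhammer c (Suc n) \<noteq> 0"
    using assms by (auto simp: pochhammer_eq_0_iff add_eq_0_iff2)
  then have q: "c \<noteq> 0" "pochhammer (c + 1) n \<noteq> 0" by (auto simp: pochhammer_rec)
  have e: "(c + of_nat n) * pochhammer c n = c * pochhammer (c + 1) n"
    using pochhammer_Suc[of c n] pochhammer_rec[of c n] by (simp add: mult.commute)
  have "fps_nth (fps_X * fps_deriv (kummer_fps b (c + 1)) + fps_const c * kummer_fps b (c + 1)) n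
      = (c + of_nat n) * fps_nth (kummer_fps b (c + 1)) n"
    by (cases n) (simp_all add: algebra_simps)
  also have "\<dots> = c * fps_nth (kummer_fps b c) n"
  proof -
    have "(c + of_nat n) / pochhammer (c + 1) n = c / pochhammer c n"
      using e p q by (simp add: frac_eq_eq mult_ac)
    moreover have "(c + of_nat n) * fps_nth (kummer_fps b (c + 1)) n
        = (c + of_nat n) / pochhammer (c + 1) n * (pochhammer b n / fact n)"
      by (simp only: kummer_fps_nth) (simp add: divide_inverse mult_ac)
    ultimately show ?thesis by (simp add: kummer_fps_nth)
  qed
  finally show "fps_nth (fps_X * fps_deriv (kummer_fps b (c + 1)) + fps_const c * kummer_fps b (c + 1)) n
     = fps_nth (fps_const c * kummer_fps b c) n" by simp
qed

lemma kummer_N'_eq: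
  assumes \<alpha>: "\<alpha> \<notin> \<int>" and z: "z > 0"
  shows "kummer_N' a \<alpha> z = - \<alpha> * kummer_N (a + 1) (\<alpha> + 1) z"
proof -
  have "of_real z * kummer_M' (a - \<alpha>) (- \<alpha>) z - \<alpha> * kummer_M (a - \<alpha>) (- \<alpha>) z
     = eval_fps (fps_X * fps_deriv (kummer_fps (a - \<alpha>) (- \<alpha> + 1)) + fps_const (- \<alpha>) * kummer_fps (a - \<alpha>) (- \<alpha> + 1)) (of_real z)"
    by (simp add: kummer_M_def kummer_M'_def eval_entire entire add_ac)
  also have "\<dots> = - \<alpha> * kummer_M (a - \<alpha>) (- (\<alpha> + 1)) z"
  proof (subst kummer_fps_lower_c)
    show "- \<alpha> + of_nat n \<noteq> 0" for n
      using not_Int_add_of_nat(7)[OF \<alpha>] by (metis Ints_minus Ints_of_nat add_eq_0_iff2 add.commute neg_eq_iff_add_eq_0)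
  qed (simp add: kummer_M_def eval_entire entire)
  finally have *: "of_real z * kummer_M' (a - \<alpha>) (- \<alpha>) z - \<alpha> * kummer_M (a - \<alpha>) (- \<alpha>) z = - \<alpha> * kummer_M (a - \<alpha>) (- (\<alpha> + 1)) z" .
  have "kummer_N' a \<alpha> z = of_real z powr (- \<alpha>) / of_real z * (of_real z * kummer_M' (a - \<alpha>) (- \<alpha>) z - \<alpha> * kummer_M (a - \<alpha>) (- \<alpha>) z)"
    using z by (simp add: kummer_N'_def field_simps)
  also have "\<dots> = - \<alpha> * (of_real z powr (- (\<alpha> + 1)) * kummer_M (a - \<alpha>) (- (\<alpha> + 1)) z)"
  proof -
    have "- (\<alpha> + 1) = - \<alpha> - 1" by simp
    then have "(of_real z :: complex) powr (- (\<alpha> + 1)) = of_real z powr (- \<alpha>) / of_real z"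
      using z by (simp only: powr_diff) simp
    then show ?thesis unfolding * by simp
  qed
  finally show ?thesis by (simp add: kummer_N_def)
qed

lemma kummer_M_at_0:
  assumes "y \<longlonglongrightarrow> 0"
  shows "(\<lambda>n. kummer_M a \<alpha> (y n)) \<longlonglongrightarrow> 1"
proof -
  have "continuous_on UNIV (\<lambda>z. kummer_M a \<alpha> z)"
    unfolding kummer_M_def by (intro continuous_on_eval_entire continuous_intros) simp
  then have "isCont (\<lambda>z. kummer_M a \<alpha> z) 0" by (simp add: continuous_on_eq_continuous_at)
  then have "(\<lambda>n. kummer_M a \<alpha> (y n)) \<longlonglongrightarrow> kummer_M a \<alpha> 0" by (rule isCont_tendsto_compose[OF _ assms])
  then show ?thesis by (simp add: kummer_M_def eval_fps_at_0)
qed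

lemma powr_at_0:
  assumes "\<And>n. y n > 0" "y \<longlonglongrightarrow> 0" "Re s > 0"
  shows "(\<lambda>n. of_real (y n) powr s :: complex) \<longlonglongrightarrow> 0"
proof (rule tendsto_norm_zero_cancel)
  have "(\<lambda>n. y n powr Re s) \<longlonglongrightarrow> 0 powr Re s"
    using assms by (intro tendsto_powr') (auto intro!: always_eventually less_imp_le)
  then show "(\<lambda>n. norm (of_real (y n) powr s :: complex)) \<longlonglongrightarrow> 0"
    using assms by (simp add: norm_powr_real_powr less_imp_le)
qed

text \<open>
  For \<open>Re \<alpha> > 0\<close> the coefficient is the limit of \<open>z powr \<alpha> * U\<close> at 0.  The induction compares the
  derivatives of both sides with the case \<open>a + 1\<close>, \<open>\<alpha> + 1\<close>.
\<close>
lemma laplace_U_coeff_N: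
  assumes "\<alpha> \<notin> \<int>" "Re a > 0" "Re \<alpha> \<le> Re a" "Re \<alpha> > - real n"
  shows "\<exists>s. \<forall>z>0. laplace_U a \<alpha> z = s * kummer_M a \<alpha> z + Gamma \<alpha> * rGamma a * kummer_N a \<alpha> z"
  using assms
proof (induction n arbitrary: a \<alpha>)
  case 0
  obtain s t where st: "\<And>z. z > 0 \<Longrightarrow> laplace_U a \<alpha> z = s * kummer_M a \<alpha> z + t * kummer_N a \<alpha> z"
    using kummer_pair_span[OF 0(1) kummer_pair_laplace_U[OF 0(2,3)]] by metis
  define y where "y = (\<lambda>n. 1 / real (Suc n))"
  have y: "y n > 0" "y \<longlonglongrightarrow> 0" for n unfolding y_def by (simp, real_asymp)
  have "(\<lambda>n. rGamma a * (of_real (y n) powr (a + (\<alpha> - a)) * laplace_J a (\<alpha> - a) (y n))) \<longlonglongrightarrow> rGamma a * Gamma (a + (\<alpha> - a))"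
    using 0 y by (intro tendsto_intros laplace_J_at_0) auto
  then have "(\<lambda>n. of_real (y n) powr \<alpha> * laplace_U a \<alpha> (y n)) \<longlonglongrightarrow> rGamma a * Gamma \<alpha>"
    by (simp add: laplace_U_def mult_ac)
  also have "(\<lambda>n. of_real (y n) powr \<alpha> * laplace_U a \<alpha> (y n)) =
     (\<lambda>n. of_real (y n) powr \<alpha> * (s * kummer_M a \<alpha> (y n)) + t * kummer_M (a - \<alpha>) (- \<alpha>) (y n))"
  proof
    fix n
    have "of_real (y n) powr \<alpha> * of_real (y n) powr (- \<alpha>) = (1 :: complex)"
      using y(1)[of n] by (simp add: powr_minus)
    then have "of_real (y n) powr \<alpha> * (t * kummer_N a \<alpha> (y n)) = t * kummer_M (a - \<alpha>) (- \<alpha>) (y n)"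
      unfolding kummer_N_def by (metis (no_types, lifting) mult.assoc mult.commute mult.left_neutral)
    then show "of_real (y n) powr \<alpha> * laplace_U a \<alpha> (y n) = of_real (y n) powr \<alpha> * (s * kummer_M a \<alpha> (y n)) + t * kummer_M (a - \<alpha>) (- \<alpha>) (y n)"
      by (simp add: st y ring_distribs)
  qed
  finally have 1: "(\<lambda>n. of_real (y n) powr \<alpha> * (s * kummer_M a \<alpha> (y n)) + t * kummer_M (a - \<alpha>) (- \<alpha>) (y n)) \<longlonglongrightarrow> rGamma a * Gamma \<alpha>" .
  have "(\<lambda>n. of_real (y n) powr \<alpha> * (s * kummer_M a \<alpha> (y n)) + t * kummer_M (a - \<alpha>) (- \<alpha>) (y n)) \<longlonglongrightarrow> 0 * (s * 1) + t * 1"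
    using y 0 by (intro tendsto_intros kummer_M_at_0 powr_at_0) auto
  then have "t = rGamma a * Gamma \<alpha>" using LIMSEQ_unique[OF 1] by simp
  then show ?case using st by (intro exI[of _ s]) (simp add: mult_ac)
next
  case (Suc n)
  note p = kummer_pair_laplace_U[OF Suc.prems(2,3)]
  obtain s t where st: "\<And>z. z > 0 \<Longrightarrow> laplace_U a \<alpha> z = s * kummer_M a \<alpha> z + t * kummer_N a \<alpha> z"
    "\<And>z. z > 0 \<Longrightarrow> laplace_U' a \<alpha> z = s * kummer_M' a \<alpha> z + t * kummer_N' a \<alpha> z"
    using kummer_pair_span[OF Suc.prems(1) p] by metis
  have \<alpha>1: "\<alpha> + 1 \<notin> \<int>" using not_Int_add_of_nat(8)[OF Suc.prems(1)] .
  have "\<exists>s. \<forall>z>0. laplace_U (a + 1) (\<alpha> + 1) z = s * kummer_M (a + 1) (\<alpha> + 1) z + Gamma (\<alpha> + 1) * rGamma (a + 1) * kummer_N (a + 1) (\<alpha> + 1) z"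
    using Suc.prems \<alpha>1 by (intro Suc.IH) auto
  then obtain s' where s': "\<And>z. z > 0 \<Longrightarrow> laplace_U (a + 1) (\<alpha> + 1) z = s' * kummer_M (a + 1) (\<alpha> + 1) z + Gamma (\<alpha> + 1) * rGamma (a + 1) * kummer_N (a + 1) (\<alpha> + 1) z"
    by blast
  have "t * - \<alpha> = - a * (Gamma (\<alpha> + 1) * rGamma (a + 1))"
  proof (rule kummer_basis_independent(2)[OF \<alpha>1])
    fix z :: real assume z: "z > 0"
    have "s * (a / (1 + \<alpha>)) * kummer_M (a + 1) (\<alpha> + 1) z + t * - \<alpha> * kummer_N (a + 1) (\<alpha> + 1) z = laplace_U' a \<alpha> z"
      using st(2)[OF z] kummer_M'_eq[OF Suc.prems(1), of a z] kummer_N'_eq[OF Suc.prems(1) z, of a] by simp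
    also have "\<dots> = - a * s' * kummer_M (a + 1) (\<alpha> + 1) z + - a * (Gamma (\<alpha> + 1) * rGamma (a + 1)) * kummer_N (a + 1) (\<alpha> + 1) z"
      unfolding laplace_U'_def s'[OF z] by (simp add: algebra_simps)
    finally show "s * (a / (1 + \<alpha>)) * kummer_M (a + 1) (\<alpha> + 1) z + t * - \<alpha> * kummer_N (a + 1) (\<alpha> + 1) z
      = - a * s' * kummer_M (a + 1) (\<alpha> + 1) z + - a * (Gamma (\<alpha> + 1) * rGamma (a + 1)) * kummer_N (a + 1) (\<alpha> + 1) z" .
  qed
  also have "Gamma (\<alpha> + 1) = \<alpha> * Gamma \<alpha>"
    using Suc.prems(1) by (intro Gamma_plus1) (auto elim!: nonpos_Ints_cases)
  finally have "\<alpha> * t = \<alpha> * (Gamma \<alpha> * (a * rGamma (a + 1)))" by (simp add: mult_ac)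
  then have "t = Gamma \<alpha> * rGamma a"
    using not_Int_add_of_nat(5)[OF Suc.prems(1)] by (simp add: rGamma_plus1)
  then show ?case using st by auto
qed

text \<open>
  By uniqueness the Laplace integral is invariant under Kummer's transformation, which exchanges the two
  Frobenius solutions; so the coefficient of the first one is known as well.
\<close>
lemma laplace_U_eq_T:
  assumes \<alpha>: "\<alpha> \<notin> \<int>" and a: "Re a > 0" "Re \<alpha> < Re a" and z: "z > 0"
  shows "laplace_U a \<alpha> z = tricomi_T a \<alpha> z" "laplace_U' a \<alpha> z = tricomi_T' a \<alpha> z"
proof -
  note p = kummer_pair_laplace_U[OF a(1) less_imp_le[OF a(2)]]
  obtain n :: nat where n: "real n > \<bar>Re \<alpha>\<bar>" using reals_Archimedean2 by blast
  obtain s where s: "\<And>z. z > 0 \<Longrightarrow> laplace_U a \<alpha> z = s * kummer_M a \<alpha> z + Gamma \<alpha> * rGamma a * kummer_N a \<alpha> z"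
    using laplace_U_coeff_N[OF \<alpha> a(1), of n] a n by fastforce
  have \<alpha>': "- \<alpha> \<notin> \<int>" using not_Int_add_of_nat(7)[OF \<alpha>] .
  obtain s' where s': "\<And>z. z > 0 \<Longrightarrow> laplace_U (a - \<alpha>) (- \<alpha>) z = s' * kummer_M (a - \<alpha>) (- \<alpha>) z + Gamma (- \<alpha>) * rGamma (a - \<alpha>) * kummer_N (a - \<alpha>) (- \<alpha>) z"
    using laplace_U_coeff_N[OF \<alpha>', of "a - \<alpha>" n] a n by fastforce
  define V where "V = (\<lambda>z. of_real z powr (- \<alpha>) * laplace_U (a - \<alpha>) (- \<alpha>) z)"
  define V' where "V' = (\<lambda>z. of_real z powr (- \<alpha>) * (laplace_U' (a - \<alpha>) (- \<alpha>) z - \<alpha> * laplace_U (a - \<alpha>) (- \<alpha>) z / of_real z))"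
  have "kummer_pair (a - \<alpha>) (1 - \<alpha>) (laplace_U (a - \<alpha>) (- \<alpha>)) (laplace_U' (a - \<alpha>) (- \<alpha>))"
    using kummer_pair_laplace_U[of "a - \<alpha>" "- \<alpha>"] a by simp
  then have V: "kummer_pair a (1 + \<alpha>) V V'" unfolding V_def V'_def by (rule kummer_pair_twist)
  have h: "kummer_pair a (1 + \<alpha>) (\<lambda>z. 1 * laplace_U a \<alpha> z + (-1) * V z) (\<lambda>z. 1 * laplace_U' a \<alpha> z + (-1) * V' z)"
    by (intro kummer_pair_lincomb p V)
  note lim = laplace_U_at_top[OF a(1) less_imp_le[OF a(2)]]
  have "((\<lambda>z. of_real z powr a * laplace_U a \<alpha> z - of_real z powr (a - \<alpha>) * laplace_U (a - \<alpha>) (- \<alpha>) z) \<longlongrightarrow> 1 - 1) at_top"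
    using a by (intro tendsto_diff lim laplace_U_at_top) auto
  also have "(\<lambda>z. of_real z powr a * laplace_U a \<alpha> z - of_real z powr (a - \<alpha>) * laplace_U (a - \<alpha>) (- \<alpha>) z)
     = (\<lambda>z. of_real z powr a * (1 * laplace_U a \<alpha> z + (-1) * V z))"
  proof
    fix z :: real
    have "a - \<alpha> = a + (- \<alpha>)" by simp
    then have "(of_real z :: complex) powr (a - \<alpha>) = of_real z powr a * of_real z powr (- \<alpha>)" by (simp only: powr_add)
    then show "of_real z powr a * laplace_U a \<alpha> z - of_real z powr (a - \<alpha>) * laplace_U (a - \<alpha>) (- \<alpha>) z = of_real z powr a * (1 * laplace_U a \<alpha> z + (-1) * V z)"
      by (simp add: V_def ring_distribs mult.assoc)
  qed
  finally have hlim: "((\<lambda>z. of_real z powr a * (1 * laplace_U a \<alpha> z + (-1) * V z)) \<longlongrightarrow> 0) at_top" by simp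
  have eq: "laplace_U a \<alpha> z = V z" if "z > 0" for z
    using kummer_unique_at_top[OF \<alpha> p lim h hlim that] by simp
  have "s = Gamma (- \<alpha>) * rGamma (a - \<alpha>)"
  proof (rule kummer_basis_independent(1)[OF \<alpha>])
    fix z :: real assume z: "z > 0"
    have "of_real z powr (- \<alpha>) * of_real z powr \<alpha> = (1 :: complex)" using z by (simp add: powr_minus)
    then have "of_real z powr (- \<alpha>) * kummer_N (a - \<alpha>) (- \<alpha>) z = kummer_M a \<alpha> z"
      by (simp add: kummer_N_def mult.assoc[symmetric])
    then have "V z = s' * kummer_N a \<alpha> z + Gamma (- \<alpha>) * rGamma (a - \<alpha>) * kummer_M a \<alpha> z"
      unfolding V_def s'[OF z] by (simp add: kummer_N_def[of a \<alpha>] ring_distribs mult_ac)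
    then show "s * kummer_M a \<alpha> z + Gamma \<alpha> * rGamma a * kummer_N a \<alpha> z = Gamma (- \<alpha>) * rGamma (a - \<alpha>) * kummer_M a \<alpha> z + s' * kummer_N a \<alpha> z"
      unfolding s[OF z, symmetric] eq[OF z] by simp
  qed
  then have T: "laplace_U a \<alpha> z = tricomi_T a \<alpha> z" if "z > 0" for z
    using s[OF that] by (simp add: tricomi_T_def)
  show "laplace_U a \<alpha> z = tricomi_T a \<alpha> z" by (rule T[OF z])
  show "laplace_U' a \<alpha> z = tricomi_T' a \<alpha> z"
    by (rule kummer_pair_deriv_unique[OF p kummer_pair_T[OF \<alpha>] T z])
qed

section \<open>The contiguous relation in the first parameter\<close>

lemma kummer_fps_lower_a:
  assumes "\<And>n. c + of_nat n \<noteq> 0"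
  shows "fps_const (c - a) * kummer_fps (a - 1) c = (fps_const (c - a) - fps_X) * kummer_fps a c + fps_X * fps_deriv (kummer_fps a c)"
proof (rule fps_ext)
  fix n
  show "fps_nth (fps_const (c - a) * kummer_fps (a - 1) c) n
    = fps_nth ((fps_const (c - a) - fps_X) * kummer_fps a c + fps_X * fps_deriv (kummer_fps a c)) n"
  proof (cases n)
    case (Suc m)
    have p: "pochhammer c m \<noteq> 0" "c + of_nat m \<noteq> 0" using assms by (auto simp: pochhammer_eq_0_iff add_eq_0_iff2)
    define u where "u = pochhammer a m / (pochhammer c m * fact m)"
    define d :: complex where "d = (c + of_nat m) * of_nat (Suc m)"
    have d: "d \<noteq> 0" using p by (simp add: d_def del: of_nat_Suc)
    have 1: "fps_nth (kummer_fps a c) m = u" by (simp add: u_def kummer_fps_nth)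
    have 2: "fps_nth (kummer_fps a c) (Suc m) = u * (a + of_nat m) / d"
      unfolding kummer_fps_Suc 1 d_def by simp
    have 3: "fps_nth (kummer_fps (a - 1) c) (Suc m) = (a - 1) * u / d"
      unfolding kummer_fps_nth pochhammer_rec[of "a - 1"] pochhammer_Suc[of c] u_def d_def
      by (simp add: fact_Suc divide_inverse mult_ac del: of_nat_Suc)
    have "(c - a) * ((a - 1) * u / d) = (c - a) * (u * (a + of_nat m) / d) - u + of_nat (Suc m) * (u * (a + of_nat m) / d)"
      using d by (simp add: divide_simps del: of_nat_Suc) (simp add: d_def algebra_simps)
    then show ?thesis unfolding Suc
      by (simp add: 1 2 3 left_diff_distrib add_ac del: of_nat_Suc fps_const_sub)
  qed simp
qed

lemma kummer_M_lower_a: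
  assumes "\<alpha> \<notin> \<int>"
  shows "(1 + \<alpha> - a) * kummer_M (a - 1) \<alpha> z = (1 + \<alpha> - a - of_real z) * kummer_M a \<alpha> z + of_real z * kummer_M' a \<alpha> z"
proof -
  have "eval_fps (fps_const (1 + \<alpha> - a) * kummer_fps (a - 1) (1 + \<alpha>)) (of_real z) =
    eval_fps ((fps_const (1 + \<alpha> - a) - fps_X) * kummer_fps a (1 + \<alpha>) + fps_X * fps_deriv (kummer_fps a (1 + \<alpha>))) (of_real z)"
    by (simp only: kummer_fps_lower_a[OF not_Int_add_of_nat(1)[OF assms]])
  then show ?thesis by (simp add: kummer_M_def kummer_M'_def eval_entire entire)
qed

lemma tricomi_T_lower:
  assumes \<alpha>: "\<alpha> \<notin> \<int>" and z: "z > 0"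
  shows "tricomi_T a \<alpha> z = (of_real z + a - \<alpha>) * tricomi_T (a + 1) \<alpha> z - of_real z * tricomi_T' (a + 1) \<alpha> z"
proof -
  define b where "b = a + 1"
  have M: "(b - 1 - \<alpha>) * kummer_M (b - 1) \<alpha> z = (of_real z + (b - 1 - \<alpha>)) * kummer_M b \<alpha> z - of_real z * kummer_M' b \<alpha> z"
    using kummer_M_lower_a[OF \<alpha>, of b z] by (simp add: algebra_simps)
  have N: "(b - 1) * kummer_N (b - 1) \<alpha> z = (of_real z + (b - 1 - \<alpha>)) * kummer_N b \<alpha> z - of_real z * kummer_N' b \<alpha> z"
  proof -
    have e: "b - 1 - \<alpha> = b - \<alpha> - 1" by simp
    have K: "(1 - b) * kummer_M (b - \<alpha> - 1) (- \<alpha>) z = (1 - b - of_real z) * kummer_M (b - \<alpha>) (- \<alpha>) z + of_real z * kummer_M' (b - \<alpha>) (- \<alpha>) z"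
      using kummer_M_lower_a[OF not_Int_add_of_nat(7)[OF \<alpha>], of "b - \<alpha>" z] by simp
    have "(b - 1) * kummer_N (b - 1) \<alpha> z = - (of_real z powr (- \<alpha>) * ((1 - b) * kummer_M (b - \<alpha> - 1) (- \<alpha>) z))"
      by (simp add: kummer_N_def e algebra_simps)
    also have "\<dots> = (of_real z + (b - 1 - \<alpha>)) * kummer_N b \<alpha> z - of_real z * kummer_N' b \<alpha> z"
      unfolding K kummer_N_def kummer_N'_def using z by (simp add: divide_simps) (simp add: algebra_simps)
    finally show ?thesis .
  qed
  have g1: "rGamma (b - 1 - \<alpha>) = (b - 1 - \<alpha>) * rGamma (b - \<alpha>)"
    using rGamma_plus1[of "b - 1 - \<alpha>"] by (simp add: algebra_simps)
  have g2: "rGamma (b - 1) = (b - 1) * rGamma b"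
    using rGamma_plus1[of "b - 1"] by (simp add: algebra_simps)
  have "tricomi_T (b - 1) \<alpha> z = Gamma (- \<alpha>) * rGamma (b - \<alpha>) * ((b - 1 - \<alpha>) * kummer_M (b - 1) \<alpha> z)
      + Gamma \<alpha> * rGamma b * ((b - 1) * kummer_N (b - 1) \<alpha> z)"
    unfolding tricomi_T_def g1 g2 by (simp add: mult_ac)
  also have "\<dots> = (of_real z + (b - 1 - \<alpha>)) * tricomi_T b \<alpha> z - of_real z * tricomi_T' b \<alpha> z"
    unfolding M N tricomi_T_def tricomi_T'_def by (simp only: ring_distribs mult_ac) simp
  finally show ?thesis by (simp add: b_def algebra_simps)
qed

lemma tricomi_T'_lower:
  assumes \<alpha>: "\<alpha> \<notin> \<int>" and z: "z > 0"
  shows "tricomi_T' a \<alpha> z = a * (tricomi_T' (a + 1) \<alpha> z - tricomi_T (a + 1) \<alpha> z)"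
proof -
  let ?T = "tricomi_T (a + 1) \<alpha>" and ?T' = "tricomi_T' (a + 1) \<alpha>"
  note D = kummer_pairD[OF kummer_pair_T[OF \<alpha>, of "a + 1"] z]
  have l: "((\<lambda>z. of_real z + a - \<alpha> :: complex) has_vector_derivative 1) (at z)" "((\<lambda>z. of_real z :: complex) has_vector_derivative 1) (at z)"
    by (auto intro!: derivative_eq_intros)
  have "((\<lambda>z. (of_real z + a - \<alpha>) * ?T z - of_real z * ?T' z) has_vector_derivative
     ((of_real z + a - \<alpha>) * ?T' z + 1 * ?T z)
     - (of_real z * (((a + 1) * ?T z - (1 + \<alpha> - of_real z) * ?T' z) / of_real z) + 1 * ?T' z)) (at z)"
    by (intro has_vector_derivative_diff has_vector_derivative_mult D l)
  then have "(tricomi_T a \<alpha> has_vector_derivative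
     ((of_real z + a - \<alpha>) * ?T' z + 1 * ?T z)
     - (of_real z * (((a + 1) * ?T z - (1 + \<alpha> - of_real z) * ?T' z) / of_real z) + 1 * ?T' z)) (at z)"
    by (rule has_vector_derivative_transform_within_open[of _ _ _ "{0<..}"])
      (use z in \<open>simp_all add: tricomi_T_lower[OF \<alpha>, where a = a]\<close>)
  then have "tricomi_T' a \<alpha> z = ((of_real z + a - \<alpha>) * ?T' z + 1 * ?T z)
     - (of_real z * (((a + 1) * ?T z - (1 + \<alpha> - of_real z) * ?T' z) / of_real z) + 1 * ?T' z)"
    using kummer_pairD(1)[OF kummer_pair_T[OF \<alpha>, of a] z] vector_derivative_unique_at by blast
  moreover have "of_real z * (w / of_real z) = w" for w :: complex using z by simp
  ultimately show ?thesis by (simp add: algebra_simps del: times_divide_eq_right)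
qed

text \<open>
  Induction from large real parts downwards.
\<close>
lemma lowering_induct [consumes 0, case_names large lower]:
  fixes P :: "complex \<Rightarrow> bool"
  assumes "\<And>a. Re a > r \<Longrightarrow> P a" "\<And>a. P (a + 1) \<Longrightarrow> P a"
  shows "P a"
proof -
  have "\<forall>a. Re a > r - real n \<longrightarrow> P a" for n
  proof (induction n)
    case (Suc n)
    show ?case
    proof (intro allI impI)
      fix a assume "Re a > r - real (Suc n)"
      then have "P (a + 1)" using Suc by simp
      then show "P a" by (rule assms(2))
    qed
  qed (use assms in auto)
  moreover obtain n :: nat where "real n > r - Re a" using reals_Archimedean2 by blast
  ultimately show ?thesis by (metis diff_less_eq add.commute less_diff_eq)
qed

lemma tricomi_T_at_top:
  assumes \<alpha>: "\<alpha> \<notin> \<int>"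
  shows "((\<lambda>z. of_real z powr a * tricomi_T a \<alpha> z) \<longlongrightarrow> 1) at_top \<and>
    ((\<lambda>z. of_real z powr (a + 1) * tricomi_T' a \<alpha> z) \<longlongrightarrow> - a) at_top"
proof (induction a rule: lowering_induct[where r = "max 0 (Re \<alpha>)"])
  case (large a)
  then have a: "Re a > 0" "Re \<alpha> < Re a" by auto
  note lim = laplace_U_at_top[OF a(1) less_imp_le[OF a(2)]]
  have "((\<lambda>z. of_real z powr a * tricomi_T a \<alpha> z) \<longlongrightarrow> 1) at_top"
    by (rule Lim_transform_eventually[OF lim(1)])
      (intro eventually_mono[OF eventually_gt_at_top[of 0]], simp add: laplace_U_eq_T[OF \<alpha> a])
  moreover have "((\<lambda>z. of_real z powr (a + 1) * tricomi_T' a \<alpha> z) \<longlongrightarrow> - a) at_top"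
    by (rule Lim_transform_eventually[OF lim(2)])
      (intro eventually_mono[OF eventually_gt_at_top[of 0]], simp add: laplace_U_eq_T[OF \<alpha> a])
  ultimately show ?case by simp
next
  case (lower a)
  let ?A = "\<lambda>z. of_real z powr (a + 1) * tricomi_T (a + 1) \<alpha> z"
  let ?B = "\<lambda>z. of_real z powr (a + 1 + 1) * tricomi_T' (a + 1) \<alpha> z"
  let ?i = "\<lambda>z. inverse (of_real z) :: complex"
  note A = lower[THEN conjunct1] and B = lower[THEN conjunct2]
  have "((\<lambda>z. (1 + (a - \<alpha>) * ?i z) * ?A z - ?i z * ?B z) \<longlongrightarrow> (1 + (a - \<alpha>) * 0) * 1 - 0 * (- (a + 1))) at_top"
    by (intro tendsto_intros A B inverse_of_real_at_top)
  then have "((\<lambda>z. (1 + (a - \<alpha>) * ?i z) * ?A z - ?i z * ?B z) \<longlongrightarrow> 1) at_top" by simp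
  then have "((\<lambda>z. of_real z powr a * tricomi_T a \<alpha> z) \<longlongrightarrow> 1) at_top"
  proof (rule Lim_transform_eventually)
    show "\<forall>\<^sub>F z in at_top. (1 + (a - \<alpha>) * ?i z) * ?A z - ?i z * ?B z = of_real z powr a * tricomi_T a \<alpha> z"
      using eventually_gt_at_top[of 0]
    proof eventually_elim
      case (elim z)
      then show ?case unfolding tricomi_T_lower[OF \<alpha> elim, of a]
        by (simp add: powr_add field_simps) (simp add: power2_eq_square)
    qed
  qed
  moreover have "((\<lambda>z. a * (?i z * ?B z - ?A z)) \<longlongrightarrow> a * (0 * (- (a + 1)) - 1)) at_top"
    by (intro tendsto_intros A B inverse_of_real_at_top)
  then have "((\<lambda>z. a * (?i z * ?B z - ?A z)) \<longlongrightarrow> - a) at_top" by simp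
  then have "((\<lambda>z. of_real z powr (a + 1) * tricomi_T' a \<alpha> z) \<longlongrightarrow> - a) at_top"
  proof (rule Lim_transform_eventually)
    show "\<forall>\<^sub>F z in at_top. a * (?i z * ?B z - ?A z) = of_real z powr (a + 1) * tricomi_T' a \<alpha> z"
      using eventually_gt_at_top[of 0]
    proof eventually_elim
      case (elim z)
      then show ?case unfolding tricomi_T'_lower[OF \<alpha> elim, of a]
        by (simp add: powr_add field_simps) (simp add: power2_eq_square)
    qed
  qed
  ultimately show ?case by simp
qed

lemma asymp_equiv_powr_iff:
  fixes f :: "real \<Rightarrow> complex"
  shows "f \<sim>[at_top] (\<lambda>x. of_real x powr (- a)) \<longleftrightarrow> ((\<lambda>z. of_real z powr a * f z) \<longlongrightarrow> 1) at_top"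
proof -
  have "f \<sim>[at_top] (\<lambda>x. of_real x powr (- a)) \<longleftrightarrow> ((\<lambda>z. f z / of_real z powr (- a)) \<longlongrightarrow> 1) at_top"
  proof
    assume "f \<sim>[at_top] (\<lambda>x. of_real x powr (- a))"
    from asymp_equivD[OF this] show "((\<lambda>z. f z / of_real z powr (- a)) \<longlongrightarrow> 1) at_top"
      by (rule Lim_transform_eventually) (auto intro!: eventually_mono[OF eventually_gt_at_top[of 0]])
  qed (rule asymp_equivI')
  also have "\<dots> \<longleftrightarrow> ((\<lambda>z. of_real z powr a * f z) \<longlongrightarrow> 1) at_top"
    by (intro tendsto_cong eventually_mono[OF eventually_gt_at_top[of 0]]) (auto simp: powr_minus field_simps)
  finally show ?thesis .
qed

theorem tricomi_U_eq_T:
  assumes \<alpha>: "\<alpha> \<notin> \<int>" and z: "z > 0"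
  shows "tricomi_U a (1 + \<alpha>) z = tricomi_T a \<alpha> z"
  unfolding tricomi_U_def
proof (rule the_equality)
  note T = tricomi_T_at_top[OF \<alpha>, of a]
  show "\<exists>f. kummer_solution a (1 + \<alpha>) f \<and> f \<sim>[at_top] (\<lambda>x. of_real x powr (- a)) \<and> tricomi_T a \<alpha> z = f z"
    using kummer_pair_T[OF \<alpha>] T by (auto simp: kummer_solution_iff asymp_equiv_powr_iff)
  fix w assume "\<exists>f. kummer_solution a (1 + \<alpha>) f \<and> f \<sim>[at_top] (\<lambda>x. of_real x powr (- a)) \<and> w = f z"
  then obtain f f' where f: "kummer_pair a (1 + \<alpha>) f f'" "((\<lambda>z. of_real z powr a * f z) \<longlongrightarrow> 1) at_top" "w = f z"
    by (auto simp: kummer_solution_iff asymp_equiv_powr_iff)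
  have h: "kummer_pair a (1 + \<alpha>) (\<lambda>z. 1 * f z + (-1) * tricomi_T a \<alpha> z) (\<lambda>z. 1 * f' z + (-1) * tricomi_T' a \<alpha> z)"
    by (intro kummer_pair_lincomb f kummer_pair_T \<alpha>)
  have "((\<lambda>z. of_real z powr a * f z - of_real z powr a * tricomi_T a \<alpha> z) \<longlongrightarrow> 1 - 1) at_top"
    using T f by (intro tendsto_diff) auto
  then have "((\<lambda>z. of_real z powr a * (1 * f z + (-1) * tricomi_T a \<alpha> z)) \<longlongrightarrow> 0) at_top"
    by (simp add: algebra_simps)
  from kummer_unique_at_top[OF \<alpha> kummer_pair_T[OF \<alpha>] T[THEN conjunct1] T[THEN conjunct2] h this z]
  show "w = tricomi_T a \<alpha> z" using f by simp
qed

lemma tendsto_rGamma: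
  assumes "(f \<longlongrightarrow> (l :: complex)) X"
  shows "((\<lambda>x. rGamma (f x)) \<longlongrightarrow> rGamma l) X"
  by (rule isCont_tendsto_compose[OF isCont_rGamma[OF continuous_ident] assms])

text \<open>
  A polynomial bound on \<open>{1..}\<close> that is uniform for parameters near \<open>a\<close>.
\<close>
lemma tricomi_T_bound:
  assumes \<alpha>: "\<alpha> \<notin> \<int>"
  shows "\<exists>K m. \<forall>\<^sub>F b in nhds a. \<forall>z\<ge>1. norm (tricomi_T b \<alpha> z) \<le> K * z ^ m \<and> norm (tricomi_T' b \<alpha> z) \<le> K * z ^ m"
proof (induction a rule: lowering_induct[where r = "max 0 (Re \<alpha>)"])
  case (large a)
  then have a: "Re a > 0" "Re \<alpha> < Re a" by auto
  have "open {b. Re b > 0 \<and> Re \<alpha> < Re b}"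
    unfolding Collect_conj_eq by (intro open_Int open_halfspace_Re_gt)
  then have 1: "\<forall>\<^sub>F b in nhds a. Re b > 0 \<and> Re \<alpha> < Re b"
    using a eventually_nhds_in_open[of "{b. Re b > 0 \<and> Re \<alpha> < Re b}" a] by simp
  define k1 where "k1 = (\<lambda>b. norm (rGamma b) * norm (Gamma (of_real (Re b) :: complex)))"
  define k2 where "k2 = (\<lambda>b. norm (rGamma b) * norm (Gamma (of_real (Re (b + 1)) :: complex)))"
  have nonpos: "complex_of_real x \<notin> \<int>\<^sub>\<le>\<^sub>0" if "x > 0" for x
  proof
    assume "complex_of_real x \<in> \<int>\<^sub>\<le>\<^sub>0"
    then obtain n where n: "complex_of_real x = of_int n" "n \<le> 0" by (elim nonpos_Ints_cases)
    have "x = of_int n" using arg_cong[OF n(1), of Re] by simp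
    then show False using that n(2) by simp
  qed
  have id: "filterlim (\<lambda>b. b) (nhds a) (nhds a)" by (rule filterlim_ident)
  have lim: "(k1 \<longlongrightarrow> k1 a) (nhds a)" "(k2 \<longlongrightarrow> k2 a) (nhds a)"
    unfolding k1_def k2_def using a
    by (intro tendsto_mult tendsto_norm tendsto_rGamma tendsto_Gamma tendsto_of_real tendsto_Re tendsto_add tendsto_const id nonpos; simp)+
  have "\<forall>\<^sub>F b in nhds a. k1 b < k1 a + 1" "\<forall>\<^sub>F b in nhds a. k2 b < k2 a + 1"
    by (rule order_tendstoD(2)[OF lim(1)], simp) (rule order_tendstoD(2)[OF lim(2)], simp)
  with 1 have "\<forall>\<^sub>F b in nhds a. \<forall>z\<ge>1. norm (tricomi_T b \<alpha> z) \<le> (k1 a + 1 + (k2 a + 1)) * z ^ 0 \<and> norm (tricomi_T' b \<alpha> z) \<le> (k1 a + 1 + (k2 a + 1)) * z ^ 0"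
  proof eventually_elim
    case (elim b)
    then have b: "Re b > 0" "Re \<alpha> < Re b" by auto
    have pos: "k1 a \<ge> 0" "k2 a \<ge> 0" by (auto simp: k1_def k2_def)
    show ?case
    proof (intro allI impI)
      fix z :: real assume z: "z \<ge> 1"
      have "norm (tricomi_T b \<alpha> z) = norm (rGamma b) * norm (laplace_J b (\<alpha> - b) z)"
        using laplace_U_eq_T(1)[OF \<alpha> b, of z] z by (simp add: laplace_U_def norm_mult flip: laplace_U_eq_T(1)[OF \<alpha> b, of z])
      also have "\<dots> \<le> k1 b" unfolding k1_def using b z by (intro mult_left_mono laplace_J_norm_le) auto
      finally have T: "norm (tricomi_T b \<alpha> z) \<le> k1 b" .
      have "norm (tricomi_T' b \<alpha> z) = norm (rGamma b) * norm (laplace_J (b + 1) (\<alpha> - b) z)"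
        using laplace_U_eq_T(2)[OF \<alpha> b, of z] z by (simp add: laplace_U'_eq norm_mult flip: laplace_U_eq_T(2)[OF \<alpha> b, of z])
      also have "\<dots> \<le> k2 b" unfolding k2_def using b z by (intro mult_left_mono laplace_J_norm_le) auto
      finally have T': "norm (tricomi_T' b \<alpha> z) \<le> k2 b" .
      show "norm (tricomi_T b \<alpha> z) \<le> (k1 a + 1 + (k2 a + 1)) * z ^ 0 \<and> norm (tricomi_T' b \<alpha> z) \<le> (k1 a + 1 + (k2 a + 1)) * z ^ 0"
        using T T' elim pos by auto
    qed
  qed
  then show ?case by blast
next
  case (lower a)
  then obtain K m where K: "\<forall>\<^sub>F b in nhds (a + 1). \<forall>z\<ge>1. norm (tricomi_T b \<alpha> z) \<le> K * z ^ m \<and> norm (tricomi_T' b \<alpha> z) \<le> K * z ^ m"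
    by blast
  have "filterlim (\<lambda>b. b + 1) (nhds (a + 1)) (nhds a)"
    by (intro tendsto_add filterlim_ident tendsto_const)
  then have K': "\<forall>\<^sub>F b in nhds a. \<forall>z\<ge>1. norm (tricomi_T (b + 1) \<alpha> z) \<le> K * z ^ m \<and> norm (tricomi_T' (b + 1) \<alpha> z) \<le> K * z ^ m"
    using K unfolding filterlim_iff by blast
  have "\<forall>\<^sub>F b in nhds a. b \<in> ball a 1" by (intro eventually_nhds_in_open) auto
  then have "\<forall>\<^sub>F b in nhds a. norm b \<le> norm a + 1"
  proof eventually_elim
    case (elim b)
    then show ?case using norm_triangle_ineq2[of b a] by (simp add: dist_norm norm_minus_commute)
  qed
  define D where "D = norm a + 1 + norm \<alpha>"
  have "\<forall>\<^sub>F b in nhds a. \<forall>z\<ge>1. norm (tricomi_T b \<alpha> z) \<le> ((2 + 2 * D) * K) * z ^ Suc m \<and> norm (tricomi_T' b \<alpha> z) \<le> ((2 + 2 * D) * K) * z ^ Suc m"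
    using K' \<open>\<forall>\<^sub>F b in nhds a. norm b \<le> norm a + 1\<close>
  proof eventually_elim
    case (elim b)
    show ?case
    proof (intro allI impI)
      fix z :: real assume z: "z \<ge> 1"
      define B where "B = K * z ^ m"
      have B: "norm (tricomi_T (b + 1) \<alpha> z) \<le> B" "norm (tricomi_T' (b + 1) \<alpha> z) \<le> B"
        using elim z by (auto simp: B_def)
      then have B0: "B \<ge> 0" using norm_ge_zero order_trans by blast
      have D0: "D \<ge> 0" "D \<ge> 1" by (auto simp: D_def)
      have bD: "norm b \<le> D" "norm (b - \<alpha>) \<le> D"
        using elim norm_triangle_ineq4[of b \<alpha>] norm_ge_zero[of \<alpha>] unfolding D_def by linarith+
      have "norm (of_real z + b - \<alpha>) \<le> z + D"
        using norm_triangle_ineq[of "of_real z" "b - \<alpha>"] bD z by (simp add: algebra_simps)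
      then have "norm (tricomi_T b \<alpha> z) \<le> (z + D) * B + z * B"
        unfolding tricomi_T_lower[OF \<alpha> order_less_le_trans[OF zero_less_one z], of b]
        using B z D0 B0 by (intro norm_triangle_le_diff add_mono) (auto simp: norm_mult intro!: mult_mono)
      also have "\<dots> \<le> (2 + 2 * D) * (B * z)"
      proof -
        have "D * B * 1 \<le> D * B * z" using D0 B0 z by (intro mult_left_mono) auto
        moreover have "0 \<le> D * (B * z)" using D0 B0 z by auto
        ultimately show ?thesis by (simp add: algebra_simps)
      qed
      finally have T: "norm (tricomi_T b \<alpha> z) \<le> (2 + 2 * D) * (B * z)" .
      have "norm (tricomi_T' b \<alpha> z) \<le> D * (B + B)"
        unfolding tricomi_T'_lower[OF \<alpha> order_less_le_trans[OF zero_less_one z], of b] norm_mult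
        using B D0 B0 bD by (intro mult_mono norm_triangle_le_diff add_mono) auto
      also have "\<dots> \<le> (2 + 2 * D) * (B * z)"
      proof -
        have "D * B * 1 \<le> D * B * z" using D0 B0 z by (intro mult_left_mono) auto
        moreover have "0 \<le> B * z" using B0 z by auto
        ultimately show ?thesis by (simp add: algebra_simps)
      qed
      finally show "norm (tricomi_T b \<alpha> z) \<le> ((2 + 2 * D) * K) * z ^ Suc m \<and> norm (tricomi_T' b \<alpha> z) \<le> ((2 + 2 * D) * K) * z ^ Suc m"
        using T by (simp add: B_def mult_ac)
    qed
  qed
  then show ?case by blast
qed

section \<open>Continuity in the first parameter\<close>

lemma eval_fps_tendsto_dominated:
  fixes F :: "'a \<Rightarrow> complex fps"
  assumes lim: "\<And>n. ((\<lambda>x. fps_nth (F x) n) \<longlongrightarrow> fps_nth F0 n) X"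
    and bound: "\<forall>\<^sub>F x in X. \<forall>n. norm (fps_nth (F x) n) \<le> norm (fps_nth G n)"
    and G: "entire_fps G" and X: "X \<noteq> bot"
  shows "((\<lambda>x. eval_fps (F x) z) \<longlongrightarrow> eval_fps F0 z) X"
proof -
  have "\<forall>\<^sub>F (n, x) in at_top \<times>\<^sub>F X. norm (fps_nth (F x) n * z ^ n) \<le> norm (fps_nth G n * z ^ n)"
  proof -
    have "\<forall>\<^sub>F (n :: nat, x) in at_top \<times>\<^sub>F X. \<forall>m. norm (fps_nth (F x) m) \<le> norm (fps_nth G m)"
      using bound by (subst eventually_prod2) auto
    then show ?thesis
      by (rule eventually_mono) (auto simp: norm_mult intro!: mult_right_mono)
  qed
  from tannerys_theorem[OF tendsto_mult[OF lim tendsto_const] this entire_fps_summable(2)[OF G] X]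
  show ?thesis by (simp add: eval_fps_def)
qed

text \<open>
  The series of the absolute values of the coefficients.
\<close>
definition abs_fps :: "complex fps \<Rightarrow> complex fps" where
  "abs_fps F = Abs_fps (\<lambda>n. of_real (norm (fps_nth F n)))"

lemma abs_fps_nth [simp]: "fps_nth (abs_fps F) n = of_real (norm (fps_nth F n))"
  by (simp add: abs_fps_def)

lemma entire_abs_fps [entire]: "entire_fps F \<Longrightarrow> entire_fps (abs_fps F)"
proof (rule entire_fpsI)
  fix z assume "entire_fps F"
  from entire_fps_summable(2)[OF this, of z]
  show "summable (\<lambda>n. fps_nth (abs_fps F) n * z ^ n)"
    by (intro summable_norm_cancel[of "\<lambda>n. fps_nth (abs_fps F) n * z ^ n"]) (simp add: norm_mult)
qed

lemma norm_fps_mult_le: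
  assumes "\<And>n. norm (fps_nth F n) \<le> norm (fps_nth G n)"
  shows "norm (fps_nth (C * F) n) \<le> norm (fps_nth (abs_fps C * abs_fps G) n)"
proof -
  have "norm (fps_nth (C * F) n) \<le> (\<Sum>i=0..n. norm (fps_nth C i) * norm (fps_nth G (n - i)))"
    unfolding fps_mult_nth using assms
    by (intro sum_norm_le) (simp add: norm_mult mult_left_mono)
  also have "\<dots> = norm (complex_of_real \<dots>)" by (simp only: norm_of_real) (simp add: sum_nonneg)
  also have "complex_of_real (\<Sum>i=0..n. norm (fps_nth C i) * norm (fps_nth G (n - i))) = fps_nth (abs_fps C * abs_fps G) n"
    by (simp add: fps_mult_nth)
  finally show ?thesis .
qed

lemma kummer_fps_majorant:
  assumes "norm b \<le> R"
  shows "norm (fps_nth (kummer_fps b c) n) \<le> norm (fps_nth (kummer_fps (of_real R) c) n)"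
proof -
  have R: "R \<ge> 0" using assms norm_ge_zero order_trans by blast
  have "norm (pochhammer b n) \<le> norm (pochhammer (complex_of_real R) n)"
  proof (induction n)
    case (Suc n)
    have "norm (b + of_nat n) \<le> norm (complex_of_real R + of_nat n)"
    proof -
      have "norm (b + of_nat n) \<le> R + real n"
        using norm_triangle_ineq[of b "of_nat n"] assms by simp
      also have "\<dots> = norm (complex_of_real (R + real n))" using R by (simp only: norm_of_real)
      finally show ?thesis by simp
    qed
    then show ?case unfolding pochhammer_Suc norm_mult using Suc by (intro mult_mono) auto
  qed simp
  then show ?thesis by (simp add: kummer_fps_nth norm_divide divide_right_mono)
qed

lemma eventually_norm_le:
  assumes "(b \<longlongrightarrow> (a :: complex)) X"
  shows "\<forall>\<^sub>F x in X. norm (b x) \<le> norm a + 1"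
  using order_tendstoD(2)[OF tendsto_norm[OF assms], of "norm a + 1"]
  by (auto elim: eventually_mono)

lemma kummer_fps_nth_tendsto:
  assumes "(b \<longlongrightarrow> a) X"
  shows "((\<lambda>x. fps_nth (kummer_fps (b x) c) n) \<longlongrightarrow> fps_nth (kummer_fps a c) n) X"
proof -
  have "((\<lambda>x. pochhammer (b x) n) \<longlongrightarrow> pochhammer a n) X"
    unfolding pochhammer_prod by (intro tendsto_intros assms)
  then show ?thesis
    unfolding kummer_fps_nth divide_inverse by (intro tendsto_intros)
qed

lemma kummer_M_tendsto:
  assumes "(b \<longlongrightarrow> a) X" "X \<noteq> bot"
  shows "((\<lambda>x. kummer_M (b x) \<alpha> z) \<longlongrightarrow> kummer_M a \<alpha> z) X"
  unfolding kummer_M_def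
proof (rule eval_fps_tendsto_dominated[OF kummer_fps_nth_tendsto[OF assms(1)] _ _ assms(2)])
  show "\<forall>\<^sub>F x in X. \<forall>n. norm (fps_nth (kummer_fps (b x) (1 + \<alpha>)) n) \<le> norm (fps_nth (kummer_fps (of_real (norm a + 1)) (1 + \<alpha>)) n)"
    using eventually_norm_le[OF assms(1)] by eventually_elim (intro allI kummer_fps_majorant)
qed simp

lemma tricomi_T_tendsto:
  assumes "(b \<longlongrightarrow> a) X" "X \<noteq> bot"
  shows "((\<lambda>x. tricomi_T (b x) \<alpha> z) \<longlongrightarrow> tricomi_T a \<alpha> z) X"
  unfolding tricomi_T_def kummer_N_def
  by (intro tendsto_intros tendsto_rGamma kummer_M_tendsto assms)

lemma powr_prim_weight_tendsto:
  assumes b: "(b \<longlongrightarrow> a) X" "X \<noteq> bot"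
  shows "((\<lambda>x. eval_fps (powr_prim s (weight_fps e c (b x) d)) 1) \<longlongrightarrow> eval_fps (powr_prim s (weight_fps e c a d)) 1) X"
proof -
  define C where "C = fps_exp (-1) * kummer_fps e c"
  have w: "weight_fps e c b d = C * kummer_fps b d" for b by (simp add: weight_fps_def C_def mult.assoc)
  define G where "G = abs_fps C * abs_fps (kummer_fps (of_real (norm a + 1)) d)"
  show ?thesis
  proof (rule eval_fps_tendsto_dominated[OF _ _ _ b(2)])
    show "((\<lambda>x. fps_nth (powr_prim s (weight_fps e c (b x) d)) n) \<longlongrightarrow> fps_nth (powr_prim s (weight_fps e c a d)) n) X" for n
      unfolding powr_prim_nth w fps_mult_nth divide_inverse
      by (intro tendsto_intros kummer_fps_nth_tendsto b)
    show "\<forall>\<^sub>F x in X. \<forall>n. norm (fps_nth (powr_prim s (weight_fps e c (b x) d)) n) \<le> norm (fps_nth (powr_prim s G) n)"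
      using eventually_norm_le[OF b(1)]
    proof eventually_elim
      case (elim x)
      show ?case unfolding powr_prim_nth w norm_divide G_def
        by (intro allI divide_right_mono norm_fps_mult_le kummer_fps_majorant elim) simp
    qed
    show "entire_fps (powr_prim s G)" by (simp add: G_def C_def entire)
  qed
qed

section \<open>The integral of a product of two Tricomi functions\<close>

text \<open>
  The integrand in terms of the connection formula.
\<close>
definition tricomi_integrand :: "complex \<Rightarrow> complex \<Rightarrow> complex \<Rightarrow> real \<Rightarrow> complex" where
  "tricomi_integrand a b \<alpha> z = tricomi_T a \<alpha> z * tricomi_T b \<alpha> z * exp (- of_real z) * of_real z powr \<alpha>"

lemma continuous_on_tricomi_T:
  assumes "\<alpha> \<notin> \<int>"
  shows "continuous_on {0<..} (tricomi_T a \<alpha>)"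
  using kummer_pairD(1)[OF kummer_pair_T[OF assms]]
  by (auto intro!: continuous_at_imp_continuous_on has_vector_derivative_continuous)

lemma continuous_on_tricomi_integrand:
  assumes "\<alpha> \<notin> \<int>" "S \<subseteq> {0<..}"
  shows "continuous_on S (tricomi_integrand a b \<alpha>)"
  unfolding tricomi_integrand_def[abs_def]
  using assms by (intro continuous_intros continuous_on_subset[OF continuous_on_tricomi_T[OF assms(1)] assms(2)]) auto

text \<open>
  The dominating functions at infinity.
\<close>
definition decay :: "nat \<Rightarrow> real \<Rightarrow> real \<Rightarrow> real" where
  "decay m r z = z ^ m * exp (- z) * z powr r"

lemma decay_integrable: "decay m r absolutely_integrable_on {1..}"
proof -
  define x where "x = max (real m + r + 1) 1"
  have "(\<lambda>t. complex_of_real t powr (of_real x - 1) / of_real (exp t)) absolutely_integrable_on {0<..}"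
    by (rule absolutely_integrable_Gamma_integral') (simp add: x_def)
  then have "(\<lambda>t. complex_of_real t powr (of_real x - 1) / of_real (exp t)) absolutely_integrable_on {1..}"
    by (rule set_integrable_subset) auto
  then have g: "(\<lambda>t. norm (complex_of_real t powr (of_real x - 1) / of_real (exp t))) integrable_on {1..}"
    by (intro set_lebesgue_integral_eq_integral(1) set_integrable_norm)
  show ?thesis
  proof (rule measurable_bounded_by_integrable_imp_absolutely_integrable[OF _ _ g])
    show "decay m r \<in> borel_measurable (lebesgue_on {1..})"
      unfolding decay_def[abs_def]
      by (intro continuous_imp_measurable_on_sets_lebesgue continuous_intros) auto
    fix z :: real assume "z \<in> {1..}"
    then have z: "z \<ge> 1" by simp
    have "z ^ m * z powr r = z powr (real m + r)" using z by (simp add: powr_add powr_realpow)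
    also have "\<dots> \<le> z powr (x - 1)" using z by (intro powr_mono) (auto simp: x_def)
    finally have "exp (- z) * (z ^ m * z powr r) \<le> exp (- z) * z powr (x - 1)" by (rule mult_left_mono) simp
    moreover have "norm (complex_of_real z powr (of_real x - 1)) = z powr (x - 1)"
      using z by (subst norm_powr_real_powr) auto
    then have "norm (complex_of_real z powr (of_real x - 1) / of_real (exp z)) = exp (- z) * z powr (x - 1)"
      unfolding norm_divide norm_of_real by (simp add: exp_minus divide_inverse)
    moreover have "norm (decay m r z) = exp (- z) * (z ^ m * z powr r)"
      using z by (simp add: decay_def abs_mult)
    ultimately show "norm (decay m r z) \<le> norm (complex_of_real z powr (of_real x - 1) / of_real (exp z))"
      by (simp only:)
  qed auto
qed

lemma tricomi_integrand_bound:
  assumes \<alpha>: "\<alpha> \<notin> \<int>"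
  shows "\<exists>K m. \<forall>\<^sub>F b in nhds b0. \<forall>z\<ge>1. norm (tricomi_integrand a b \<alpha> z) \<le> K * decay m (Re \<alpha>) z"
proof -
  obtain K m where K: "\<forall>\<^sub>F b in nhds a. \<forall>z\<ge>1. norm (tricomi_T b \<alpha> z) \<le> K * z ^ m \<and> norm (tricomi_T' b \<alpha> z) \<le> K * z ^ m"
    using tricomi_T_bound[OF \<alpha>] by blast
  obtain L n where L: "\<forall>\<^sub>F b in nhds b0. \<forall>z\<ge>1. norm (tricomi_T b \<alpha> z) \<le> L * z ^ n \<and> norm (tricomi_T' b \<alpha> z) \<le> L * z ^ n"
    using tricomi_T_bound[OF \<alpha>] by blast
  have K: "norm (tricomi_T a \<alpha> z) \<le> K * z ^ m" if "z \<ge> 1" for z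
    using eventually_nhds_x_imp_x[OF K] that by blast
  have "\<forall>\<^sub>F b in nhds b0. \<forall>z\<ge>1. norm (tricomi_integrand a b \<alpha> z) \<le> (K * L) * decay (m + n) (Re \<alpha>) z"
    using L
  proof eventually_elim
    case (elim b)
    show ?case
    proof (intro allI impI)
      fix z :: real assume z: "z \<ge> 1"
      have "norm (tricomi_T a \<alpha> z) * norm (tricomi_T b \<alpha> z) \<le> (K * z ^ m) * (L * z ^ n)"
        using K[OF z] elim z order_trans[OF norm_ge_zero K[OF z]] by (intro mult_mono) auto
      then have "norm (tricomi_T a \<alpha> z) * norm (tricomi_T b \<alpha> z) * (exp (- z) * z powr Re \<alpha>)
        \<le> (K * z ^ m) * (L * z ^ n) * (exp (- z) * z powr Re \<alpha>)"
        by (rule mult_right_mono) simp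
      then show "norm (tricomi_integrand a b \<alpha> z) \<le> (K * L) * decay (m + n) (Re \<alpha>) z"
        using z by (simp add: tricomi_integrand_def decay_def norm_mult norm_powr_real_powr power_add mult_ac)
    qed
  qed
  then show ?thesis by blast
qed

lemma tricomi_integrand_integrable:
  assumes \<alpha>: "\<alpha> \<notin> \<int>"
  shows "tricomi_integrand a b \<alpha> absolutely_integrable_on {1..}"
proof -
  obtain K m where "\<forall>\<^sub>F b in nhds b. \<forall>z\<ge>1. norm (tricomi_integrand a b \<alpha> z) \<le> K * decay m (Re \<alpha>) z"
    using tricomi_integrand_bound[OF \<alpha>] by blast
  then have K: "\<And>z. z \<ge> 1 \<Longrightarrow> norm (tricomi_integrand a b \<alpha> z) \<le> K * decay m (Re \<alpha>) z"
    using eventually_nhds_x_imp_x by blast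
  have g: "(\<lambda>z. K * decay m (Re \<alpha>) z) integrable_on {1..}"
    by (intro set_lebesgue_integral_eq_integral(1) set_integrable_mult_right decay_integrable)
  show ?thesis
  proof (rule measurable_bounded_by_integrable_imp_absolutely_integrable[OF _ _ g])
    show "tricomi_integrand a b \<alpha> \<in> borel_measurable (lebesgue_on {1..})"
      by (intro continuous_imp_measurable_on_sets_lebesgue continuous_on_tricomi_integrand \<alpha>) auto
  qed (use K in auto)
qed

lemma integral_Ioi_eq_Ici:
  fixes f :: "real \<Rightarrow> complex"
  shows "integral {1<..} f = integral {1..} f"
proof (rule integral_spike_set)
  show "negligible {x \<in> {1<..} - {1..}. f x \<noteq> 0}" by (simp add: negligible_subset[of "{}"])
  show "negligible {x \<in> {1..} - {1<..}. f x \<noteq> 0}"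
    by (rule negligible_subset[of "{1}"]) auto
qed

lemma tricomi_wronskian_at_top:
  assumes \<alpha>: "\<alpha> \<notin> \<int>"
  shows "(kummer_wronskian (1 + \<alpha>) (tricomi_T a \<alpha>) (tricomi_T' a \<alpha>) (tricomi_T b \<alpha>) (tricomi_T' b \<alpha>) \<longlongrightarrow> 0) at_top"
proof (rule Lim_transform_eventually)
  let ?E = "\<lambda>z. of_real z powr (1 + \<alpha> - a - b) * exp (- of_real z) :: complex"
  let ?i = "\<lambda>z. inverse (of_real z) :: complex"
  let ?f = "\<lambda>z. ?E z * (?i z * (of_real z powr (a + 1) * tricomi_T' a \<alpha> z) * (of_real z powr b * tricomi_T b \<alpha> z)
     - (of_real z powr a * tricomi_T a \<alpha> z) * (?i z * (of_real z powr (b + 1) * tricomi_T' b \<alpha> z)))"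
  note A = tricomi_T_at_top[OF \<alpha>, of a, THEN conjunct1] tricomi_T_at_top[OF \<alpha>, of a, THEN conjunct2]
    tricomi_T_at_top[OF \<alpha>, of b, THEN conjunct1] tricomi_T_at_top[OF \<alpha>, of b, THEN conjunct2]
  have "(?f \<longlongrightarrow> 0 * (0 * (- a) * 1 - 1 * (0 * (- b)))) at_top"
    by (intro tendsto_mult[OF powr_exp_tendsto_0] tendsto_diff tendsto_mult[OF tendsto_mult] tendsto_mult inverse_of_real_at_top A)
  then show "(?f \<longlongrightarrow> 0) at_top" by simp
  show "\<forall>\<^sub>F z in at_top. ?f z = kummer_wronskian (1 + \<alpha>) (tricomi_T a \<alpha>) (tricomi_T' a \<alpha>) (tricomi_T b \<alpha>) (tricomi_T' b \<alpha>) z"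
    using eventually_gt_at_top[of 0]
  proof eventually_elim
    case (elim z)
    define w p q :: complex where "w = of_real z powr (1 + \<alpha> - a - b)" and "p = of_real z powr a" and "q = of_real z powr b"
    have "1 + \<alpha> = (1 + \<alpha> - a - b) + (a + b)" by simp
    then have "(of_real z :: complex) powr (1 + \<alpha>) = w * (p * q)"
      unfolding w_def p_def q_def by (metis powr_add)
    note e1 = this
    have e2: "inverse (of_real z) * (of_real z powr (a + 1) * x) = p * x"
      "inverse (of_real z) * (of_real z powr (b + 1) * x) = q * x" for x :: complex
      using elim by (simp_all add: powr_add p_def q_def)
    show ?case
      unfolding kummer_wronskian_def w_def[symmetric] p_def[symmetric] q_def[symmetric] e1 e2
      by (simp add: algebra_simps)
  qed
qed

lemma tricomi_integral_1_infinity: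
  assumes \<alpha>: "\<alpha> \<notin> \<int>"
  shows "(a - b) * integral {1<..} (tricomi_integrand a b \<alpha>)
    = - kummer_wronskian (1 + \<alpha>) (tricomi_T a \<alpha>) (tricomi_T' a \<alpha>) (tricomi_T b \<alpha>) (tricomi_T' b \<alpha>) 1"
proof -
  let ?F = "kummer_wronskian (1 + \<alpha>) (tricomi_T a \<alpha>) (tricomi_T' a \<alpha>) (tricomi_T b \<alpha>) (tricomi_T' b \<alpha>)"
  define f where "f = (\<lambda>z. (a - b) * tricomi_integrand a b \<alpha> z)"
  have int: "f absolutely_integrable_on {1..}"
    unfolding f_def by (intro set_integrable_mult_right tricomi_integrand_integrable \<alpha>)
  have D: "(?F has_vector_derivative f z) (at z)" if "z > 0" for z
    using kummer_wronskian_has_vector_derivative[OF kummer_pair_T[OF \<alpha>] kummer_pair_T[OF \<alpha>] that, of a b]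
    by (simp add: f_def tricomi_integrand_def mult_ac)
  have "((\<lambda>y. LINT z:{1..y}|lebesgue. f z) \<longlongrightarrow> (LINT z:{1..}|lebesgue. f z)) at_top"
    by (rule tendsto_set_lebesgue_integral_at_top[OF _ int]) auto
  moreover have "((\<lambda>y. LINT z:{1..y}|lebesgue. f z) \<longlongrightarrow> 0 - ?F 1) at_top"
  proof (rule Lim_transform_eventually)
    show "((\<lambda>y. ?F y - ?F 1) \<longlongrightarrow> 0 - ?F 1) at_top"
      by (intro tendsto_diff tricomi_wronskian_at_top \<alpha> tendsto_const)
    show "\<forall>\<^sub>F y in at_top. ?F y - ?F 1 = (LINT z:{1..y}|lebesgue. f z)"
      using eventually_ge_at_top[of 1]
    proof eventually_elim
      case (elim y)
      have "(f has_integral (?F y - ?F 1)) {1..y}"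
        using elim D by (intro fundamental_theorem_of_calculus) (auto intro: has_vector_derivative_at_within)
      moreover have "f absolutely_integrable_on {1..y}"
        by (rule set_integrable_subset[OF int]) auto
      ultimately show ?case
        by (simp add: set_lebesgue_integral_eq_integral(2) integral_unique)
    qed
  qed
  ultimately have "(LINT z:{1..}|lebesgue. f z) = 0 - ?F 1"
    by (rule tendsto_unique[OF trivial_limit_at_top_linorder])
  then have "integral {1..} f = - ?F 1"
    using set_lebesgue_integral_eq_integral(2)[OF int] by simp
  then show ?thesis by (simp add: integral_Ioi_eq_Ici f_def)
qed

text \<open>
  The contribution of the unit interval to the generalized integral: the connection formula is
  multiplied out, and each of the four products is integrated formally.
\<close>
definition tricomi_near :: "complex \<Rightarrow> complex \<Rightarrow> complex \<Rightarrow> complex" where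
  "tricomi_near a b \<alpha> =
     (Gamma (- \<alpha>) * rGamma (a - \<alpha>)) * (Gamma (- \<alpha>) * rGamma (b - \<alpha>)) * eval_fps (powr_prim \<alpha> (weight_fps a (1 + \<alpha>) b (1 + \<alpha>))) 1
   + (Gamma (- \<alpha>) * rGamma (a - \<alpha>)) * (Gamma \<alpha> * rGamma b) * eval_fps (powr_prim 0 (weight_fps a (1 + \<alpha>) (b - \<alpha>) (1 - \<alpha>))) 1
   + (Gamma \<alpha> * rGamma a) * (Gamma (- \<alpha>) * rGamma (b - \<alpha>)) * eval_fps (powr_prim 0 (weight_fps b (1 + \<alpha>) (a - \<alpha>) (1 - \<alpha>))) 1
   + (Gamma \<alpha> * rGamma a) * (Gamma \<alpha> * rGamma b) * eval_fps (powr_prim (- \<alpha>) (weight_fps (a - \<alpha>) (1 - \<alpha>) (b - \<alpha>) (1 - \<alpha>))) 1"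

lemma powr_prim_cmult: "powr_prim s (fps_const c * F) = fps_const c * powr_prim s F"
  by (rule fps_ext) simp

lemma gen_integral_tricomi:
  assumes \<alpha>: "\<alpha> \<notin> \<int>" and f: "\<And>z. z > 0 \<Longrightarrow> f z = tricomi_integrand a b \<alpha> z"
  shows "gen_integrable f"
    and "gen_integral f = tricomi_near a b \<alpha> + integral {1<..} (tricomi_integrand a b \<alpha>)"
proof -
  define A where "A = (\<lambda>a. Gamma (- \<alpha>) * rGamma (a - \<alpha>))"
  define B where "B = (\<lambda>a. Gamma \<alpha> * rGamma a)"
  define s where "s = (\<lambda>j::nat. if j = 0 then \<alpha> else if j = 3 then - \<alpha> else 0)"
  define F where "F = (\<lambda>j::nat. if j = 0 then fps_const (A a * A b) * weight_fps a (1 + \<alpha>) b (1 + \<alpha>)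
     else if j = 1 then fps_const (A a * B b) * weight_fps a (1 + \<alpha>) (b - \<alpha>) (1 - \<alpha>)
     else if j = 2 then fps_const (B a * A b) * weight_fps b (1 + \<alpha>) (a - \<alpha>) (1 - \<alpha>)
     else fps_const (B a * B b) * weight_fps (a - \<alpha>) (1 - \<alpha>) (b - \<alpha>) (1 - \<alpha>))"
  have J: "{..<4::nat} = {0, 1, 2, 3}" by auto
  have inf: "f absolutely_integrable_on {1<..}"
  proof -
    have "tricomi_integrand a b \<alpha> absolutely_integrable_on {1<..}"
      by (rule set_integrable_subset[OF tricomi_integrand_integrable[OF \<alpha>]]) auto
    then show ?thesis
      by (subst set_integrable_cong[OF refl refl, of "{1<..}" f "tricomi_integrand a b \<alpha>"]) (auto simp: f)
  qed
  have F: "entire_fps (F j)" for j by (simp add: F_def entire)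
  have s: "s j + of_nat n \<noteq> - 1" for j n
    proof -
      have "of_nat n \<noteq> (- 1 :: complex)"
        by (metis of_nat_0_le_iff of_int_of_nat_eq of_int_eq_iff of_int_minus of_int_1 neg_0_le_iff_le not_one_le_zero)
      then show ?thesis using not_Int_add_of_nat(3,4)[OF \<alpha>, of n] by (auto simp: s_def)
    qed
  have sum: "f r = (\<Sum>j<4. of_real r powr s j * eval_fps (F j) (of_real r))" if r: "r \<in> {0<..<1}" for r
  proof -
    define w where "w = (of_real r :: complex) powr \<alpha>"
    have w: "w \<noteq> 0" "of_real r powr (- \<alpha>) = 1 / w" using r by (auto simp: w_def powr_minus divide_inverse)
    have "f r = (A a * kummer_M a \<alpha> r + B a * kummer_N a \<alpha> r) * (A b * kummer_M b \<alpha> r + B b * kummer_N b \<alpha> r) * exp (- of_real r) * w"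
      using r by (simp add: f tricomi_integrand_def tricomi_T_def A_def B_def w_def)
    also have "\<dots> = (\<Sum>j<4. of_real r powr s j * eval_fps (F j) (of_real r))"
      using r w(1) unfolding J
      by (simp add: s_def F_def weight_fps_def eval_entire entire kummer_M_def kummer_N_def w(2) w_def[symmetric] field_simps)
    finally show ?thesis .
  qed
  note G = gen_integral_powr_fps_sum[OF finite_lessThan F s sum inf]
  show "gen_integrable f" by (rule G(1))
  have "integral {1<..} f = integral {1<..} (tricomi_integrand a b \<alpha>)"
    by (rule integral_cong) (simp add: f)
  moreover have "(\<Sum>j<4. eval_fps (powr_prim (s j) (F j)) 1) = tricomi_near a b \<alpha>"
    unfolding J by (simp add: s_def F_def powr_prim_cmult eval_entire entire tricomi_near_def A_def B_def)
  ultimately show "gen_integral f = tricomi_near a b \<alpha> + integral {1<..} (tricomi_integrand a b \<alpha>)"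
    using G(2) by simp
qed

lemma tricomi_near_wronskian:
  assumes \<alpha>: "\<alpha> \<notin> \<int>"
  shows "(a - b) * tricomi_near a b \<alpha> =
     kummer_wronskian (1 + \<alpha>) (tricomi_T a \<alpha>) (tricomi_T' a \<alpha>) (tricomi_T b \<alpha>) (tricomi_T' b \<alpha>) 1
     + \<alpha> * Gamma \<alpha> * Gamma (- \<alpha>) * (rGamma a * rGamma (b - \<alpha>) - rGamma (a - \<alpha>) * rGamma b)"
proof -
  define A where "A = (\<lambda>a. Gamma (- \<alpha>) * rGamma (a - \<alpha>))"
  define B where "B = (\<lambda>a. Gamma \<alpha> * rGamma a)"
  define P0 P1 P2 P3 where P: "P0 = eval_fps (powr_prim \<alpha> (weight_fps a (1 + \<alpha>) b (1 + \<alpha>))) 1"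
    "P1 = eval_fps (powr_prim 0 (weight_fps a (1 + \<alpha>) (b - \<alpha>) (1 - \<alpha>))) 1"
    "P2 = eval_fps (powr_prim 0 (weight_fps b (1 + \<alpha>) (a - \<alpha>) (1 - \<alpha>))) 1"
    "P3 = eval_fps (powr_prim (- \<alpha>) (weight_fps (a - \<alpha>) (1 - \<alpha>) (b - \<alpha>) (1 - \<alpha>))) 1"
  define m m' where "m = (\<lambda>a. kummer_M a \<alpha> 1)" and "m' = (\<lambda>a. kummer_M' a \<alpha> 1)"
  define k k' where "k = (\<lambda>a. kummer_M (a - \<alpha>) (- \<alpha>) 1)" and "k' = (\<lambda>a. kummer_M' (a - \<alpha>) (- \<alpha>) 1)"
  define e :: complex where "e = exp (- 1)"
  have 0: "(a - b) * P0 = e * (m' a * m b - m a * m' b)"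
    using arg_cong[OF powr_prim_weight_same[OF not_Int_add_of_nat(1)[OF \<alpha>], of a b], of "\<lambda>F. eval_fps F 1"]
    by (simp add: P eval_entire entire same_wronskian_fps_def kummer_M_def kummer_M'_def m_def m'_def e_def)
  have 3: "(a - b) * P3 = e * (k' a * k b - k a * k' b)"
    using arg_cong[OF powr_prim_weight_same[OF not_Int_add_of_nat(2)[OF \<alpha>], of "a - \<alpha>" "b - \<alpha>"], of "\<lambda>F. eval_fps F 1"]
    by (simp add: P eval_entire entire same_wronskian_fps_def kummer_M_def kummer_M'_def k_def k'_def e_def)
  have cross: "(a - b) * eval_fps (powr_prim 0 (weight_fps a (1 + \<alpha>) (b - \<alpha>) (1 - \<alpha>))) 1
    = e * ((m' a * k b - m a * k' b) + \<alpha> * (m a * k b)) - \<alpha>" for a b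
    using arg_cong[OF powr_prim_weight_cross[OF \<alpha>, of a b], of "\<lambda>F. eval_fps F 1"]
    by (simp add: eval_entire entire cross_wronskian_fps_def Let_def kummer_M_def kummer_M'_def m_def m'_def k_def k'_def e_def)
  have 1: "(a - b) * P1 = e * ((m' a * k b - m a * k' b) + \<alpha> * (m a * k b)) - \<alpha>" unfolding P by (rule cross)
  have 2: "(a - b) * P2 = - (e * ((m' b * k a - m b * k' a) + \<alpha> * (m b * k a)) - \<alpha>)"
    unfolding P cross[of b a, symmetric] by (simp add: algebra_simps)
  have T: "tricomi_T a \<alpha> 1 = A a * m a + B a * k a" "tricomi_T' a \<alpha> 1 = A a * m' a + B a * (k' a - \<alpha> * k a)" for a
    by (simp_all add: tricomi_T_def tricomi_T'_def A_def B_def m_def m'_def k_def k'_def kummer_N_def kummer_N'_def)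
  have near: "(a - b) * tricomi_near a b \<alpha> = A a * A b * ((a - b) * P0) + A a * B b * ((a - b) * P1)
     + B a * A b * ((a - b) * P2) + B a * B b * ((a - b) * P3)"
    unfolding tricomi_near_def P A_def B_def by (simp only: ring_distribs mult_ac)
  have w: "kummer_wronskian (1 + \<alpha>) (tricomi_T a \<alpha>) (tricomi_T' a \<alpha>) (tricomi_T b \<alpha>) (tricomi_T' b \<alpha>) 1
     = e * ((A a * m' a + B a * (k' a - \<alpha> * k a)) * (A b * m b + B b * k b)
       - (A a * m a + B a * k a) * (A b * m' b + B b * (k' b - \<alpha> * k b)))"
    by (simp add: kummer_wronskian_def T e_def)
  have c: "\<alpha> * Gamma \<alpha> * Gamma (- \<alpha>) * (rGamma a * rGamma (b - \<alpha>) - rGamma (a - \<alpha>) * rGamma b) = \<alpha> * (B a * A b - A a * B b)"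
    by (simp add: A_def B_def algebra_simps)
  show ?thesis unfolding near 0 1 2 3 w c by (simp add: algebra_simps)
qed

lemma Gamma_reflection_minus:
  fixes \<alpha> :: complex
  assumes \<alpha>: "\<alpha> \<notin> \<int>"
  shows "sin (of_real pi * \<alpha>) \<noteq> 0" "\<alpha> * Gamma \<alpha> * Gamma (- \<alpha>) = - (of_real pi / sin (of_real pi * \<alpha>))"
proof -
  show "sin (of_real pi * \<alpha>) \<noteq> 0"
  proof
    assume "sin (of_real pi * \<alpha>) = 0"
    then obtain n :: int where "of_real pi * \<alpha> = of_real (n * pi)" using Complex_Transcendental.sin_eq_0 by blast
    then have "\<alpha> = of_int n" by (simp add: field_simps)
    then show False using \<alpha> by auto
  qed
  have "- \<alpha> \<notin> \<int>\<^sub>\<le>\<^sub>0" using not_Int_add_of_nat(7)[OF \<alpha>] nonpos_Ints_Int by blast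
  then have "Gamma (- \<alpha> + 1) = - \<alpha> * Gamma (- \<alpha>)" by (rule Gamma_plus1)
  moreover have "Gamma \<alpha> * Gamma (1 - \<alpha>) = of_real pi / sin (of_real pi * \<alpha>)" by (rule Gamma_reflection_complex)
  ultimately have "Gamma \<alpha> * (- \<alpha> * Gamma (- \<alpha>)) = of_real pi / sin (of_real pi * \<alpha>)"
    by (simp add: add.commute)
  moreover have "\<alpha> * Gamma \<alpha> * Gamma (- \<alpha>) = - (Gamma \<alpha> * (- \<alpha> * Gamma (- \<alpha>)))" by simp
  ultimately show "\<alpha> * Gamma \<alpha> * Gamma (- \<alpha>) = - (of_real pi / sin (of_real pi * \<alpha>))"
    by (simp only:)
qed

lemma gen_integral_tricomi_offdiag:
  assumes \<alpha>: "\<alpha> \<notin> \<int>" and "a \<noteq> b"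
  shows "tricomi_near a b \<alpha> + integral {1<..} (tricomi_integrand a b \<alpha>)
     = of_real pi / ((a - b) * sin (of_real pi * \<alpha>)) * (rGamma (a - \<alpha>) * rGamma b - rGamma (b - \<alpha>) * rGamma a)"
proof -
  have "(a - b) * (tricomi_near a b \<alpha> + integral {1<..} (tricomi_integrand a b \<alpha>))
    = \<alpha> * Gamma \<alpha> * Gamma (- \<alpha>) * (rGamma a * rGamma (b - \<alpha>) - rGamma (a - \<alpha>) * rGamma b)"
    unfolding ring_distribs(1) tricomi_near_wronskian[OF \<alpha>] tricomi_integral_1_infinity[OF \<alpha>] by simp
  then show ?thesis unfolding Gamma_reflection_minus(2)[OF \<alpha>]
    using assms(2) Gamma_reflection_minus(1)[OF \<alpha>] by (simp add: field_simps)
qed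

lemma tricomi_integral_tendsto:
  assumes \<alpha>: "\<alpha> \<notin> \<int>" and b: "b \<longlonglongrightarrow> a"
  shows "(\<lambda>n. tricomi_near a (b n) \<alpha> + integral {1<..} (tricomi_integrand a (b n) \<alpha>))
    \<longlonglongrightarrow> tricomi_near a a \<alpha> + integral {1<..} (tricomi_integrand a a \<alpha>)"
proof (intro tendsto_add)
  have ba: "(\<lambda>n. b n - \<alpha>) \<longlonglongrightarrow> a - \<alpha>" by (intro tendsto_intros b)
  have sym: "weight_fps b c e d = weight_fps e d b c" for b c e d by (simp add: weight_fps_def mult_ac)
  have 2: "(\<lambda>n. eval_fps (powr_prim 0 (weight_fps (b n) (1 + \<alpha>) (a - \<alpha>) (1 - \<alpha>))) 1)
      \<longlonglongrightarrow> eval_fps (powr_prim 0 (weight_fps a (1 + \<alpha>) (a - \<alpha>) (1 - \<alpha>))) 1"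
    using powr_prim_weight_tendsto[OF b sequentially_bot, of 0 "a - \<alpha>" "1 - \<alpha>" "1 + \<alpha>"]
    unfolding sym[of "a - \<alpha>" "1 - \<alpha>" _ "1 + \<alpha>"] .
  show "(\<lambda>n. tricomi_near a (b n) \<alpha>) \<longlonglongrightarrow> tricomi_near a a \<alpha>"
    unfolding tricomi_near_def
    by (intro tendsto_add tendsto_mult tendsto_const tendsto_rGamma b ba 2
        powr_prim_weight_tendsto[OF b sequentially_bot] powr_prim_weight_tendsto[OF ba sequentially_bot])
  obtain K m where "\<forall>\<^sub>F b in nhds a. \<forall>z\<ge>1. norm (tricomi_integrand a b \<alpha> z) \<le> K * decay m (Re \<alpha>) z"
    using tricomi_integrand_bound[OF \<alpha>] by blast
  then have "\<forall>\<^sub>F n in sequentially. \<forall>z\<ge>1. norm (tricomi_integrand a (b n) \<alpha> z) \<le> K * decay m (Re \<alpha>) z"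
    using b unfolding filterlim_iff by blast
  then obtain N where N: "\<And>n z. n \<ge> N \<Longrightarrow> z \<ge> 1 \<Longrightarrow> norm (tricomi_integrand a (b n) \<alpha> z) \<le> K * decay m (Re \<alpha>) z"
    unfolding eventually_sequentially by blast
  have "(\<lambda>n. integral {1..} (tricomi_integrand a (b (n + N)) \<alpha>)) \<longlonglongrightarrow> integral {1..} (tricomi_integrand a a \<alpha>)"
  proof (rule dominated_convergence(2))
    show "tricomi_integrand a (b (n + N)) \<alpha> integrable_on {1..}" for n
      by (intro set_lebesgue_integral_eq_integral(1) tricomi_integrand_integrable \<alpha>)
    show "(\<lambda>z. K * decay m (Re \<alpha>) z) integrable_on {1..}"
      by (intro set_lebesgue_integral_eq_integral(1) set_integrable_mult_right decay_integrable)
    show "norm (tricomi_integrand a (b (n + N)) \<alpha> z) \<le> K * decay m (Re \<alpha>) z" if "z \<in> {1..}" for n z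
      using N that by simp
    show "(\<lambda>n. tricomi_integrand a (b (n + N)) \<alpha> z) \<longlonglongrightarrow> tricomi_integrand a a \<alpha> z" for z
      unfolding tricomi_integrand_def
      by (intro tendsto_intros tricomi_T_tendsto LIMSEQ_ignore_initial_segment b) simp
  qed
  then show "(\<lambda>n. integral {1<..} (tricomi_integrand a (b n) \<alpha>)) \<longlonglongrightarrow> integral {1<..} (tricomi_integrand a a \<alpha>)"
    unfolding integral_Ioi_eq_Ici by (rule LIMSEQ_offset)
qed

lemma gen_integral_tricomi_diag:
  assumes \<alpha>: "\<alpha> \<notin> \<int>"
  shows "tricomi_near a a \<alpha> + integral {1<..} (tricomi_integrand a a \<alpha>)
     = of_real pi / sin (of_real pi * \<alpha>) * (rGamma a * deriv rGamma (a - \<alpha>) - rGamma (a - \<alpha>) * deriv rGamma a)"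
proof -
  \<comment> \<open>the numerator of the off-diagonal formula, which vanishes at \<open>b = a\<close>\<close>
  define g where "g = (\<lambda>b. rGamma (a - \<alpha>) * rGamma b - rGamma (b - \<alpha>) * rGamma a)"
  have rG: "(rGamma has_field_derivative deriv rGamma z) (at z)" for z :: complex
    using field_differentiable_derivI[OF field_differentiable_rGamma[of z UNIV]] .
  have D: "(g has_field_derivative (rGamma (a - \<alpha>) * deriv rGamma a - deriv rGamma (a - \<alpha>) * rGamma a)) (at a)"
    unfolding g_def
  proof (intro DERIV_diff DERIV_cmult DERIV_cmult_right rG)
    have "((\<lambda>b. b - \<alpha>) has_field_derivative 1) (at a)" by (auto intro!: derivative_eq_intros)
    from DERIV_chain2[OF rG this]
    show "((\<lambda>b. rGamma (b - \<alpha>)) has_field_derivative deriv rGamma (a - \<alpha>)) (at a)" by simp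
  qed
  define h where "h = (\<lambda>n. complex_of_real (1 / real (Suc n)))"
  have "(\<lambda>n. 1 / real (Suc n)) \<longlonglongrightarrow> 0" by real_asymp
  then have h0: "h \<longlonglongrightarrow> 0" unfolding h_def using tendsto_of_real[where ?'a = complex] by fastforce
  have hne: "h n \<noteq> 0" for n unfolding h_def by (simp del: of_nat_Suc)
  have "filterlim h (at 0) sequentially" using h0 hne by (simp add: filterlim_at)
  then have "(\<lambda>n. (g (a + h n) - g a) / h n) \<longlonglongrightarrow> rGamma (a - \<alpha>) * deriv rGamma a - deriv rGamma (a - \<alpha>) * rGamma a"
    using D[unfolded DERIV_def] filterlim_compose by blast
  then have lim: "(\<lambda>n. - (of_real pi / sin (of_real pi * \<alpha>)) * ((g (a + h n) - g a) / h n))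
     \<longlonglongrightarrow> - (of_real pi / sin (of_real pi * \<alpha>)) * (rGamma (a - \<alpha>) * deriv rGamma a - deriv rGamma (a - \<alpha>) * rGamma a)"
    by (intro tendsto_intros)
  have "g a = 0" by (simp add: g_def)
  have "tricomi_near a (a + h n) \<alpha> + integral {1<..} (tricomi_integrand a (a + h n) \<alpha>)
     = - (of_real pi / sin (of_real pi * \<alpha>)) * ((g (a + h n) - g a) / h n)" for n
    using gen_integral_tricomi_offdiag[OF \<alpha>, of a "a + h n"] hne[of n] Gamma_reflection_minus(1)[OF \<alpha>]
    by (simp add: \<open>g a = 0\<close>) (simp add: g_def divide_simps)
  moreover have "(\<lambda>n. a + h n) \<longlonglongrightarrow> a" using tendsto_add[OF tendsto_const h0, of a] by simp
  from tricomi_integral_tendsto[OF \<alpha> this]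
  have "(\<lambda>n. tricomi_near a (a + h n) \<alpha> + integral {1<..} (tricomi_integrand a (a + h n) \<alpha>))
    \<longlonglongrightarrow> tricomi_near a a \<alpha> + integral {1<..} (tricomi_integrand a a \<alpha>)" .
  ultimately have "tricomi_near a a \<alpha> + integral {1<..} (tricomi_integrand a a \<alpha>) =
    - (of_real pi / sin (of_real pi * \<alpha>)) * (rGamma (a - \<alpha>) * deriv rGamma a - deriv rGamma (a - \<alpha>) * rGamma a)"
    using LIMSEQ_unique[OF lim] by simp
  then show ?thesis by (simp add: algebra_simps)
qed

text \<open>
  The diagonal value in terms of the entire function \<open>1 / Gamma\<close>; unlike the form with digamma
  functions it needs no exception at the poles of \<open>Gamma\<close>.
\<close>
definition diag_cont :: "complex \<Rightarrow> complex \<Rightarrow> complex" where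
  "diag_cont \<theta> \<alpha> = of_real pi / sin (of_real pi * \<alpha>) *
     (rGamma ((1 + \<theta> + \<alpha>) / 2) * deriv rGamma ((1 + \<theta> - \<alpha>) / 2) - rGamma ((1 + \<theta> - \<alpha>) / 2) * deriv rGamma ((1 + \<theta> + \<alpha>) / 2))"

lemma diag_rhs_eq_cont:
  assumes "(\<theta>, \<alpha>) \<in> diag_regular"
  shows "diag_rhs \<theta> \<alpha> = diag_cont \<theta> \<alpha>"
proof -
  have d: "deriv rGamma z = - rGamma z * Digamma z" if "z \<notin> \<int>\<^sub>\<le>\<^sub>0" for z :: complex
    using has_field_derivative_rGamma_no_nonpos_int[OF that] by (rule DERIV_imp_deriv)
  have key: "(dx - dy) / (gx * gy) = inverse gx * (- inverse gy * dy) - inverse gy * (- inverse gx * dx)"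
    for dx dy gx gy :: complex
    by (simp add: divide_inverse algebra_simps)
  have reg: "(1 + \<theta> + \<alpha>) / 2 \<notin> \<int>\<^sub>\<le>\<^sub>0" "(1 + \<theta> - \<alpha>) / 2 \<notin> \<int>\<^sub>\<le>\<^sub>0"
    using assms by (auto simp: diag_regular_def)
  show ?thesis
    unfolding diag_rhs_def diag_cont_def key d[OF reg(1)] d[OF reg(2)]
    by (simp only: rGamma_inverse_Gamma)
qed

lemma diag_cont_tendsto:
  assumes \<alpha>: "\<alpha> \<notin> \<int>"
  shows "((\<lambda>(t, b). diag_cont t b) \<longlongrightarrow> diag_cont \<theta> \<alpha>) (at (\<theta>, \<alpha>) within S)"
proof -
  have "deriv rGamma holomorphic_on (UNIV :: complex set)"
    by (intro holomorphic_deriv holomorphic_rGamma) auto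
  then have "isCont (deriv rGamma) z" for z :: complex
    using holomorphic_on_imp_continuous_on continuous_on_eq_continuous_at by blast
  then have d: "(f \<longlongrightarrow> l) X \<Longrightarrow> ((\<lambda>x. deriv rGamma (f x)) \<longlongrightarrow> deriv rGamma l) X"
    for f :: "complex \<times> complex \<Rightarrow> complex" and l X
    by (rule isCont_tendsto_compose)
  have id: "((\<lambda>p. p) \<longlongrightarrow> (\<theta>, \<alpha>)) (at (\<theta>, \<alpha>) within S)" by (rule tendsto_ident_at)
  have 1: "(fst \<longlongrightarrow> \<theta>) (at (\<theta>, \<alpha>) within S)" "(snd \<longlongrightarrow> \<alpha>) (at (\<theta>, \<alpha>) within S)"
    using tendsto_fst[OF id] tendsto_snd[OF id] by simp_all
  have "((\<lambda>p. diag_cont (fst p) (snd p)) \<longlongrightarrow> diag_cont \<theta> \<alpha>) (at (\<theta>, \<alpha>) within S)"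
    unfolding diag_cont_def
    by (intro tendsto_intros d tendsto_rGamma 1 Gamma_reflection_minus(1)[OF \<alpha>]) auto
  then show ?thesis by (simp add: case_prod_beta')
qed

lemma tricomi_Lie_eq:
  assumes "\<alpha> \<notin> \<int>" "z > 0"
  shows "tricomi_Lie \<theta> \<alpha> z = tricomi_T ((1 + \<theta> + \<alpha>) / 2) \<alpha> z"
  using tricomi_U_eq_T[OF assms] by (simp add: tricomi_Lie_def add_ac)

(* Gamma is 0 at its poles and 1 / 0 = 0, so 1 / Gamma is the entire reciprocal Gamma function. *)
theorem mainTheorem2:
  fixes \<alpha> :: complex
  assumes "\<alpha> \<notin> \<int>"
  shows
    "(\<forall>\<theta>1 \<theta>2 :: complex. \<theta>1 \<noteq> \<theta>2 \<longrightarrow>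
        (let f = (\<lambda>z. tricomi_Lie \<theta>1 \<alpha> z * tricomi_Lie \<theta>2 \<alpha> z
                       * exp (- of_real z) * of_real z powr \<alpha>)
         in gen_integrable f \<and>
            gen_integral f =
              2 * of_real pi / ((\<theta>1 - \<theta>2) * sin (of_real pi * \<alpha>)) *
                (1 / (Gamma ((1 + \<theta>1 - \<alpha>) / 2) * Gamma ((1 + \<theta>2 + \<alpha>) / 2))
                 - 1 / (Gamma ((1 + \<theta>2 - \<alpha>) / 2) * Gamma ((1 + \<theta>1 + \<alpha>) / 2))))) \<and>
     (\<forall>\<theta> :: complex.
        (let f = (\<lambda>z. (tricomi_Lie \<theta> \<alpha> z)\<^sup>2 * exp (- of_real z) * of_real z powr \<alpha>)
         in gen_integrable f \<and>
            ((\<theta>, \<alpha>) \<in> diag_regular \<longrightarrow> gen_integral f = diag_rhs \<theta> \<alpha>) \<and>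
            ((\<theta>, \<alpha>) \<notin> diag_regular \<longrightarrow>
               ((\<lambda>(t, b). diag_rhs t b) \<longlongrightarrow> gen_integral f) (at (\<theta>, \<alpha>) within diag_regular))))"
proof (intro conjI allI impI)
  fix \<theta>1 \<theta>2 :: complex assume ne: "\<theta>1 \<noteq> \<theta>2"
  define a where "a = (1 + \<theta>1 + \<alpha>) / 2"
  define b where "b = (1 + \<theta>2 + \<alpha>) / 2"
  have ab: "a - b = (\<theta>1 - \<theta>2) / 2" "a \<noteq> b" using ne by (auto simp: a_def b_def diff_divide_distrib add_divide_distrib)
  have y: "a - \<alpha> = (1 + \<theta>1 - \<alpha>) / 2" "b - \<alpha> = (1 + \<theta>2 - \<alpha>) / 2" by (auto simp: a_def b_def field_simps)
  let ?f = "\<lambda>z. tricomi_Lie \<theta>1 \<alpha> z * tricomi_Lie \<theta>2 \<alpha> z * exp (- of_real z) * of_real z powr \<alpha>"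
  have f: "?f z = tricomi_integrand a b \<alpha> z" if "z > 0" for z
    using tricomi_Lie_eq[OF assms that] by (simp add: tricomi_integrand_def a_def b_def)
  note G = gen_integral_tricomi[OF assms f]
  have key: "of_real pi / (d / 2 * s) * (inverse p * inverse q - inverse p' * inverse q')
    = 2 * of_real pi / (d * s) * (1 / (p * q) - 1 / (p' * q'))" for d s p q p' q' :: complex
  proof -
    have "of_real pi / (d / 2 * s) = 2 * of_real pi / (d * s)" by simp
    moreover have "inverse x * inverse y = 1 / (x * y)" for x y :: complex
      by (simp add: divide_inverse)
    ultimately show ?thesis by (simp only:)
  qed
  have "gen_integral ?f = of_real pi / ((a - b) * sin (of_real pi * \<alpha>)) * (rGamma (a - \<alpha>) * rGamma b - rGamma (b - \<alpha>) * rGamma a)"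
    using G(2) gen_integral_tricomi_offdiag[OF assms ab(2)] by simp
  also have "\<dots> = 2 * of_real pi / ((\<theta>1 - \<theta>2) * sin (of_real pi * \<alpha>)) *
                (1 / (Gamma ((1 + \<theta>1 - \<alpha>) / 2) * Gamma ((1 + \<theta>2 + \<alpha>) / 2))
                 - 1 / (Gamma ((1 + \<theta>2 - \<alpha>) / 2) * Gamma ((1 + \<theta>1 + \<alpha>) / 2)))"
    unfolding ab(1) y rGamma_inverse_Gamma a_def[symmetric] b_def[symmetric] by (rule key)
  finally show "let f = ?f in gen_integrable f \<and> gen_integral f = 2 * of_real pi / ((\<theta>1 - \<theta>2) * sin (of_real pi * \<alpha>)) *
                (1 / (Gamma ((1 + \<theta>1 - \<alpha>) / 2) * Gamma ((1 + \<theta>2 + \<alpha>) / 2))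
                 - 1 / (Gamma ((1 + \<theta>2 - \<alpha>) / 2) * Gamma ((1 + \<theta>1 + \<alpha>) / 2)))"
    using G(1) unfolding Let_def by blast
next
  fix \<theta> :: complex
  define a where "a = (1 + \<theta> + \<alpha>) / 2"
  have y: "a - \<alpha> = (1 + \<theta> - \<alpha>) / 2" by (auto simp: a_def field_simps)
  let ?f = "\<lambda>z. (tricomi_Lie \<theta> \<alpha> z)\<^sup>2 * exp (- of_real z) * of_real z powr \<alpha>"
  have f: "?f z = tricomi_integrand a a \<alpha> z" if "z > 0" for z
    using tricomi_Lie_eq[OF assms that] by (simp add: tricomi_integrand_def a_def power2_eq_square)
  note G = gen_integral_tricomi[OF assms f]
  have I: "gen_integral ?f = diag_cont \<theta> \<alpha>"
    using G(2) gen_integral_tricomi_diag[OF assms, of a] unfolding y by (simp add: diag_cont_def a_def)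
  have "((\<lambda>(t, b). diag_rhs t b) \<longlongrightarrow> diag_cont \<theta> \<alpha>) (at (\<theta>, \<alpha>) within diag_regular)"
  proof (rule Lim_transform_eventually[OF diag_cont_tendsto[OF assms]])
    show "\<forall>\<^sub>F p in at (\<theta>, \<alpha>) within diag_regular. (case p of (t, b) \<Rightarrow> diag_cont t b) = (case p of (t, b) \<Rightarrow> diag_rhs t b)"
      unfolding eventually_at_filter by (intro always_eventually) (auto simp: diag_rhs_eq_cont)
  qed
  then show "let f = ?f in gen_integrable f \<and>
            ((\<theta>, \<alpha>) \<in> diag_regular \<longrightarrow> gen_integral f = diag_rhs \<theta> \<alpha>) \<and>
            ((\<theta>, \<alpha>) \<notin> diag_regular \<longrightarrow>
               ((\<lambda>(t, b). diag_rhs t b) \<longlongrightarrow> gen_integral f) (at (\<theta>, \<alpha>) within diag_regular))"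
    using G(1) I diag_rhs_eq_cont[of \<theta> \<alpha>] unfolding Let_def by simp
qed

end
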